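(* Let $\mathbb{K}\in\{\mathbb{R},\mathbb{C}\}$, let $\mathcal{H}$ be a graded and connected Hopf algebra over $\mathbb{K}$ and let $B$ be a commutative locally convex algebra over $\mathbb{K}$. Then the group $G(\mathcal{H},B)$ of $B$-valued characters of $\mathcal{H}$ is a $\mathbb{K}$-analytic Lie group. The Lie algebra of $G(\mathcal{H},B)$ is the Lie algebra $\mathfrak{g}(\mathcal{H},B)$ of infinitesimal characters.
   Context: Algebras are unital associative $\mathbb{K}$-algebras. A locally convex space is a Hausdorff locally convex topological $\mathbb{K}$-vector space. A locally convex algebra is an algebra with a locally convex vector space topology for which multiplication $B\times B\to B$ is continuous. Graded connected Hopf algebra: a Hopf algebra $\mathcal{H}$ with a vector space decomposition $\mathcal{H}=\bigoplus_{n\in\mathbb{N}_0}\mathcal{H}_n$ such that $1_{\mathcal{H}}\in\mathcal{H}_0$, $\mathcal{H}_n\mathcal{H}_m\subseteq\mathcal{H}_{n+m}$, $\Delta(\mathcal{H}_n)\subseteq\bigoplus_{i+j=n}\mathcal{H}_i\otimes\mathcal{H}_j$, $\bigoplus_{n\ge1}\mathcal{H}_n\subseteq\ker\epsilon$, and $\dim\mathcal{H}_0=1$. Put $A:=\mathrm{Hom}_{\mathbb{K}}(\mathcal{H},B)$ (all $\mathbb{K}$-linear maps) with the topology of pointwise convergence and the convolution product $\phi\star\psi=m_B\circ(\phi\otimes\psi)\circ\Delta_{\mathcal{H}}$; it is a locally convex algebra with unit $1_A=\epsilon_{\mathcal{H}}(\cdot)1_B$. $G(\mathcal{H},B)=\{\phi\in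 A:\phi(ab)=\phi(a)\phi(b)\ \forall a,b\in\mathcal{H},\ \phi(1_{\mathcal{H}})=1_B\}$, a group under $\star$ with inversion $\phi\mapsto\phi\circ S_{\mathcal{H}}$. $\mathfrak{g}(\mathcal{H},B)=\{\phi\in A:\phi(ab)=\epsilon_{\mathcal{H}}(a)\phi(b)+\epsilon_{\mathcal{H}}(b)\phi(a)\ \forall a,b\in\mathcal{H}\}$ with bracket $[\phi,\psi]=\phi\star\psi-\psi\star\phi$. Both carry the topology of pointwise convergence. Calculus (Keller's $C^r_c$-theory): a map $f:U\to F$, $U\subseteq E$ open, between locally convex spaces is $C^r$ if its iterated directional derivatives $d^{(k)}f:U\times E^k\to F$ ($k\le r$) exist and are continuous. For $\mathbb{K}=\mathbb{C}$, $\mathbb{K}$-analytic means $C^\infty_{\mathbb{C}}$; for $\mathbb{K}=\mathbb{R}$ it means extendable to a $C^\infty_{\mathbb{C}}$-map on an open neighbourhood of $U$ in the complexification of $E$, with values in the complexification of $F$. Manifolds are Hausdorff and modelled on locally convex spaces; a $\mathbb{K}$-analytic Lie group is a group with a $\mathbb{K}$-analytic manifold structure for which the group operations are $\mathbb{K}$-analytic. The manifold structure meant on $G(\mathcal{H},B)$ is the one inherited as a $\mathbb{K}$-analytic submanifold of the locally convex space $A$ (locally, in suitable $\mathbb{K}$-analytic charts of the affine subspace $\{\phi\in A:\phi(1_{\mathcal{H}})=1_B\}$, it corresponds to a closed vector subspace); in particular it induces the topology of pointwise convergence. *)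

theory Defs
  imports
    "HOL-Analysis.Analysis"
    "HOL-Library.Function_Algebras"
    "HOL-Library.Poly_Mapping"
    "HOL-Algebra.Group"
begin

text \<open>
  Vector spaces are given by a type (providing addition), an explicit scalar multiplication
  and, where subspaces occur, a carrier set.  Function types carry pointwise addition and the
  product topology, i.e. the topology of pointwise convergence.
\<close>

section \<open>Scalars\<close>

text \<open>The fields of real and of complex numbers.\<close>

class rc_field = real_normed_field +
  assumes real_or_complex:
    "(\<forall>z. \<exists>a. z = a *\<^sub>R 1) \<or> (\<exists>j. j * j = - 1 \<and> (\<forall>z. \<exists>a b. z = a *\<^sub>R 1 + b *\<^sub>R j))"

instance real :: rc_field
  by standard simp

instance complex :: rc_field
proof
  have "\<exists>a b. z = a *\<^sub>R 1 + b *\<^sub>R \<i>" for z :: complex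
    by (intro exI[of _ "Re z"] exI[of _ "Im z"]) (simp add: complex_eq_iff)
  then show "(\<forall>z :: complex. \<exists>a. z = a *\<^sub>R 1)
      \<or> (\<exists>j :: complex. j * j = - 1 \<and> (\<forall>z. \<exists>a b. z = a *\<^sub>R 1 + b *\<^sub>R j))"
    by (intro disjI2 exI[of _ \<i>]) auto
qed

instance "fun" :: (type, t0_space) t0_space
proof
  fix f g :: "'a \<Rightarrow> 'b"
  assume "f \<noteq> g"
  then obtain a where ne: "f a \<noteq> g a" by blast
  then obtain U where U: "open U" "\<not> (f a \<in> U \<longleftrightarrow> g a \<in> U)"
    using t0_space_class.t0_space[OF ne] by blast
  have "open ((\<lambda>h :: 'a \<Rightarrow> 'b. h a) -` U)"
    using U(1) by (rule open_vimage) (rule continuous_on_product_coordinates)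
  then show "\<exists>U. open U \<and> \<not> (f \<in> U \<longleftrightarrow> g \<in> U)"
    using U by (intro exI[of _ "(\<lambda>h. h a) -` U"]) auto
qed

instance "fun" :: (type, t1_space) t1_space
proof
  fix f g :: "'a \<Rightarrow> 'b"
  assume "f \<noteq> g"
  then obtain a where ne: "f a \<noteq> g a" by blast
  then obtain U where U: "open U" "f a \<in> U" "g a \<notin> U"
    using t1_space_class.t1_space[OF ne] by blast
  have "open ((\<lambda>h :: 'a \<Rightarrow> 'b. h a) -` U)"
    using U(1) by (rule open_vimage) (rule continuous_on_product_coordinates)
  then show "\<exists>U. open U \<and> f \<in> U \<and> g \<notin> U"
    using U by (intro exI[of _ "(\<lambda>h. h a) -` U"]) auto
qed

instance "fun" :: (type, t2_space) t2_space
proof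
  fix f g :: "'a \<Rightarrow> 'b"
  assume "f \<noteq> g"
  then obtain a where ne: "f a \<noteq> g a" by blast
  then obtain U V where UV: "open U" "open V" "f a \<in> U" "g a \<in> V" "U \<inter> V = {}"
    using hausdorff[OF ne] by blast
  have "open ((\<lambda>h :: 'a \<Rightarrow> 'b. h a) -` U)" "open ((\<lambda>h :: 'a \<Rightarrow> 'b. h a) -` V)"
    by (rule open_vimage[OF UV(1) continuous_on_product_coordinates])
       (rule open_vimage[OF UV(2) continuous_on_product_coordinates])
  then show "\<exists>U V. open U \<and> open V \<and> f \<in> U \<and> g \<in> V \<and> U \<inter> V = {}"
    using UV by (intro exI[of _ "(\<lambda>h. h a) -` U"] exI[of _ "(\<lambda>h. h a) -` V"]) auto
qed

definition fun_scale :: "('k \<Rightarrow> 'v \<Rightarrow> 'v) \<Rightarrow> 'k \<Rightarrow> ('x \<Rightarrow> 'v) \<Rightarrow> 'x \<Rightarrow> 'v" where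
  "fun_scale s c f = (\<lambda>x. s c (f x))"

definition prod_scale :: "('k \<Rightarrow> 'v \<Rightarrow> 'v) \<Rightarrow> ('k \<Rightarrow> 'w \<Rightarrow> 'w) \<Rightarrow> 'k \<Rightarrow> 'v \<times> 'w \<Rightarrow> 'v \<times> 'w" where
  "prod_scale s t c = map_prod (s c) (t c)"

text \<open>The complexification of a real vector space: a pair \<open>(x, y)\<close> stands for \<open>x + iy\<close>.\<close>

definition complexified_scale ::
    "('k::real_normed_field \<Rightarrow> 'v::ab_group_add \<Rightarrow> 'v) \<Rightarrow> complex \<Rightarrow> 'v \<times> 'v \<Rightarrow> 'v \<times> 'v" where
  "complexified_scale s c = (\<lambda>(x, y).
     (s (of_real (Re c)) x - s (of_real (Im c)) y, s (of_real (Im c)) x + s (of_real (Re c)) y))"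

section \<open>Tensor products\<close>

text \<open>
  The tensor product \<open>V \<otimes> V\<close> is the quotient of the free vector space on \<open>V \<times> V\<close> by the
  subspace spanned by the bilinearity relations.  Elements of \<open>V \<otimes> V\<close> are handled through
  representatives in the free vector space; \<open>tensor2_eq\<close> is equality in the quotient.
  Similarly for \<open>V \<otimes> V \<otimes> V\<close>.
\<close>

definition free_scale :: "'k::field \<Rightarrow> ('x \<Rightarrow>\<^sub>0 'k) \<Rightarrow> ('x \<Rightarrow>\<^sub>0 'k)" where
  "free_scale c = Poly_Mapping.map ((*) c)"

lemma lookup_free_scale [simp]: "Poly_Mapping.lookup (free_scale c u) p = c * Poly_Mapping.lookup u p"
  by (simp add: free_scale_def Poly_Mapping.map.rep_eq when_def)

lemma vector_space_free_scale: "vector_space (free_scale :: 'k::field \<Rightarrow> ('x \<Rightarrow>\<^sub>0 'k) \<Rightarrow> _)"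
  by unfold_locales (auto intro!: poly_mapping_eqI simp: lookup_add algebra_simps)

abbreviation pure :: "'x \<Rightarrow> ('x \<Rightarrow>\<^sub>0 'k::field)" where
  "pure p \<equiv> Poly_Mapping.single p 1"

text \<open>Linear extension to the free vector space of a map given on generators.\<close>

definition free_lift :: "('k::field \<Rightarrow> 'v::ab_group_add \<Rightarrow> 'v) \<Rightarrow> ('x \<Rightarrow> 'v) \<Rightarrow> ('x \<Rightarrow>\<^sub>0 'k) \<Rightarrow> 'v" where
  "free_lift s g u = (\<Sum>p\<in>Poly_Mapping.keys u. s (Poly_Mapping.lookup u p) (g p))"

definition tensor2_relations ::
    "('k::field \<Rightarrow> 'v::ab_group_add \<Rightarrow> 'v) \<Rightarrow> ('v \<times> 'v \<Rightarrow>\<^sub>0 'k) set" where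
  "tensor2_relations s =
     {pure (x + x', y) - pure (x, y) - pure (x', y) | x x' y. True} \<union>
     {pure (x, y + y') - pure (x, y) - pure (x, y') | x y y'. True} \<union>
     {pure (s c x, y) - free_scale c (pure (x, y)) | c x y. True} \<union>
     {pure (x, s c y) - free_scale c (pure (x, y)) | c x y. True}"

definition tensor2_eq ::
    "('k::field \<Rightarrow> 'v::ab_group_add \<Rightarrow> 'v) \<Rightarrow> ('v \<times> 'v \<Rightarrow>\<^sub>0 'k) \<Rightarrow> ('v \<times> 'v \<Rightarrow>\<^sub>0 'k) \<Rightarrow> bool" where
  "tensor2_eq s u w \<longleftrightarrow> u - w \<in> module.span free_scale (tensor2_relations s)"

definition tensor3_relations ::
    "('k::field \<Rightarrow> 'v::ab_group_add \<Rightarrow> 'v) \<Rightarrow> ('v \<times> 'v \<times> 'v \<Rightarrow>\<^sub>0 'k) set" where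
  "tensor3_relations s =
     {pure (x + x', y, z) - pure (x, y, z) - pure (x', y, z) | x x' y z. True} \<union>
     {pure (x, y + y', z) - pure (x, y, z) - pure (x, y', z) | x y y' z. True} \<union>
     {pure (x, y, z + z') - pure (x, y, z) - pure (x, y, z') | x y z z'. True} \<union>
     {pure (s c x, y, z) - free_scale c (pure (x, y, z)) | c x y z. True} \<union>
     {pure (x, s c y, z) - free_scale c (pure (x, y, z)) | c x y z. True} \<union>
     {pure (x, y, s c z) - free_scale c (pure (x, y, z)) | c x y z. True}"

definition tensor3_eq ::
    "('k::field \<Rightarrow> 'v::ab_group_add \<Rightarrow> 'v) \<Rightarrow> ('v \<times> 'v \<times> 'v \<Rightarrow>\<^sub>0 'k) \<Rightarrow> ('v \<times> 'v \<times> 'v \<Rightarrow>\<^sub>0 'k) \<Rightarrow> bool" where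
  "tensor3_eq s u w \<longleftrightarrow> u - w \<in> module.span free_scale (tensor3_relations s)"

text \<open>Bilinear maps factor through equality in the tensor product.\<close>

lemma free_lift_superset:
  assumes "vector_space s" "finite A" "Poly_Mapping.keys u \<subseteq> A"
  shows "free_lift s g u = (\<Sum>p\<in>A. s (Poly_Mapping.lookup u p) (g p))"
proof -
  interpret vector_space s by fact
  show ?thesis
    unfolding free_lift_def using assms
    by (intro sum.mono_neutral_left) (auto simp: in_keys_iff)
qed

lemma linear_free_lift:
  assumes "vector_space s"
  shows "Vector_Spaces.linear free_scale s (free_lift s g)"
proof -
  interpret vector_space s by fact
  interpret F: vector_space "free_scale :: 'a \<Rightarrow> ('c \<Rightarrow>\<^sub>0 'a) \<Rightarrow> _"
    by (rule vector_space_free_scale)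
  have add: "free_lift s g (u + w) = free_lift s g u + free_lift s g w" for u w
  proof -
    let ?A = "Poly_Mapping.keys u \<union> Poly_Mapping.keys w"
    have "Poly_Mapping.keys (u + w) \<subseteq> ?A" by (rule Poly_Mapping.keys_add)
    then show ?thesis
      by (simp add: free_lift_superset[OF assms, of ?A] lookup_add scale_left_distrib sum.distrib)
  qed
  have scale: "free_lift s g (free_scale c u) = s c (free_lift s g u)" for c u
  proof -
    have "Poly_Mapping.keys (free_scale c u) \<subseteq> Poly_Mapping.keys u" by (auto simp: in_keys_iff)
    then show ?thesis
      by (simp add: free_lift_superset[OF assms, of "Poly_Mapping.keys u"] scale_sum_right)
  qed
  show ?thesis by unfold_locales (simp_all add: add scale)
qed

lemma free_lift_tensor2_eq:
  assumes t: "vector_space t" and eq: "tensor2_eq s u w"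
    and left: "\<And>y. Vector_Spaces.linear s t (\<lambda>x. \<beta> x y)"
    and right: "\<And>x. Vector_Spaces.linear s t (\<lambda>y. \<beta> x y)"
  shows "free_lift t (\<lambda>(x, y). \<beta> x y) u = free_lift t (\<lambda>(x, y). \<beta> x y) w"
proof -
  let ?L = "free_lift t (\<lambda>(x, y). \<beta> x y)"
  interpret L: Vector_Spaces.linear free_scale t ?L
    using t by (rule linear_free_lift)
  have p: "?L (pure (x, y)) = \<beta> x y" for x y
    by (simp add: free_lift_def vector_space.vector_space_assms(4)[OF t])
  have l: "\<beta> (x + x') y = \<beta> x y + \<beta> x' y" "\<beta> (s c x) y = t c (\<beta> x y)"
      "\<beta> x (y + y') = \<beta> x y + \<beta> x y'" "\<beta> x (s c y) = t c (\<beta> x y)" for x x' y y' c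
  proof -
    interpret l: Vector_Spaces.linear s t "\<lambda>x. \<beta> x y" by (rule left)
    interpret r: Vector_Spaces.linear s t "\<lambda>y. \<beta> x y" by (rule right)
    show "\<beta> (x + x') y = \<beta> x y + \<beta> x' y" "\<beta> (s c x) y = t c (\<beta> x y)"
      "\<beta> x (y + y') = \<beta> x y + \<beta> x y'" "\<beta> x (s c y) = t c (\<beta> x y)"
      by (rule l.add l.scale r.add r.scale)+
  qed
  have "?L r = 0" if "r \<in> tensor2_relations s" for r
    using that by (auto simp: tensor2_relations_def L.diff L.scale p l)
  then have "?L (u - w) = 0"
    using eq L.eq_0_on_span unfolding tensor2_eq_def by blast
  then show ?thesis by (simp add: L.diff)
qed

section \<open>Graded connected Hopf algebras\<close>

text \<open>
  \<open>\<Delta> h\<close> is a representative of the coproduct of \<open>h\<close>; every map into \<open>H \<otimes> H\<close> arises from such a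
  choice of representatives, and all axioms are equalities in the tensor products
  (or are invariant under the choice).
\<close>

locale hopf_algebra = vector_space sH
  for sH :: "'k::field \<Rightarrow> 'h::ring_1 \<Rightarrow> 'h" +
  fixes \<Delta> :: "'h \<Rightarrow> ('h \<times> 'h \<Rightarrow>\<^sub>0 'k)"
    and \<epsilon> :: "'h \<Rightarrow> 'k"
    and S :: "'h \<Rightarrow> 'h"
  assumes mult_scale_left: "sH c a * b = sH c (a * b)"
    and mult_scale_right: "a * sH c b = sH c (a * b)"
    and coproduct_add: "tensor2_eq sH (\<Delta> (a + b)) (\<Delta> a + \<Delta> b)"
    and coproduct_scale: "tensor2_eq sH (\<Delta> (sH c a)) (free_scale c (\<Delta> a))"
    and counit_linear: "Vector_Spaces.linear sH (*) \<epsilon>"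
    and coassociative:
      "tensor3_eq sH
         (free_lift free_scale (\<lambda>(x, y). free_lift free_scale (\<lambda>(x1, x2). pure (x1, x2, y)) (\<Delta> x)) (\<Delta> a))
         (free_lift free_scale (\<lambda>(x, y). free_lift free_scale (\<lambda>(y1, y2). pure (x, y1, y2)) (\<Delta> y)) (\<Delta> a))"
    and counit_left: "free_lift sH (\<lambda>(x, y). sH (\<epsilon> x) y) (\<Delta> a) = a"
    and counit_right: "free_lift sH (\<lambda>(x, y). sH (\<epsilon> y) x) (\<Delta> a) = a"
    and coproduct_mult:
      "tensor2_eq sH (\<Delta> (a * b))
         (free_lift free_scale
           (\<lambda>(x, y). free_lift free_scale (\<lambda>(x', y'). pure (x * x', y * y')) (\<Delta> b)) (\<Delta> a))"
    and coproduct_one: "tensor2_eq sH (\<Delta> 1) (pure (1, 1))"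
    and counit_mult: "\<epsilon> (a * b) = \<epsilon> a * \<epsilon> b"
    and counit_one: "\<epsilon> 1 = 1"
    and antipode_linear: "Vector_Spaces.linear sH sH S"
    and antipode_left: "free_lift sH (\<lambda>(x, y). S x * y) (\<Delta> a) = sH (\<epsilon> a) 1"
    and antipode_right: "free_lift sH (\<lambda>(x, y). x * S y) (\<Delta> a) = sH (\<epsilon> a) 1"

locale graded_connected_hopf_algebra = hopf_algebra sH \<Delta> \<epsilon> S
  for sH :: "'k::field \<Rightarrow> 'h::ring_1 \<Rightarrow> 'h" and \<Delta> \<epsilon> S +
  fixes H :: "nat \<Rightarrow> 'h set"
  assumes component_subspace: "subspace (H n)"
    and direct_sum:
      "\<exists>!f :: nat \<Rightarrow> 'h. (\<forall>n. f n \<in> H n) \<and> finite {n. f n \<noteq> 0} \<and> a = (\<Sum>n | f n \<noteq> 0. f n)"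
    and one_degree: "1 \<in> H 0"
    and mult_degree: "a \<in> H n \<Longrightarrow> b \<in> H m \<Longrightarrow> a * b \<in> H (n + m)"
    and coproduct_degree:
      "a \<in> H n \<Longrightarrow> \<exists>u \<in> module.span free_scale {pure (x, y) | x y i j. x \<in> H i \<and> y \<in> H j \<and> i + j = n}.
         tensor2_eq sH (\<Delta> a) u"
    and counit_degree: "n \<ge> 1 \<Longrightarrow> a \<in> H n \<Longrightarrow> \<epsilon> a = 0"
    and connected: "dim (H 0) = 1"

section \<open>Locally convex spaces and algebras\<close>

definition locally_convex_space ::
    "('k::real_normed_field \<Rightarrow> 'e::{ab_group_add, t2_space} \<Rightarrow> 'e) \<Rightarrow> 'e set \<Rightarrow> bool" where
  "locally_convex_space s E \<longleftrightarrow>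
     vector_space s \<and> module.subspace s E \<and>
     continuous_on (E \<times> E) (\<lambda>(x, y). x + y) \<and>
     continuous_on (UNIV \<times> E) (\<lambda>(c, x). s c x) \<and>
     (\<forall>U. openin (top_of_set E) U \<and> 0 \<in> U \<longrightarrow>
        (\<exists>C. openin (top_of_set E) C \<and> 0 \<in> C \<and> C \<subseteq> U \<and>
           (\<forall>x\<in>C. \<forall>y\<in>C. \<forall>r\<in>{0..1}. s (of_real r) x + s (of_real (1 - r)) y \<in> C)))"

text \<open>Algebras are unital, but the zero algebra is allowed; hence no \<open>ring_1\<close> class.\<close>

definition commutative_locally_convex_algebra ::
    "('k::real_normed_field \<Rightarrow> 'b::{comm_ring, comm_monoid_mult, t2_space} \<Rightarrow> 'b) \<Rightarrow> bool" where
  "commutative_locally_convex_algebra s \<longleftrightarrow>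
     locally_convex_space s UNIV \<and>
     (\<forall>c x y. s c x * y = s c (x * y)) \<and>
     continuous_on UNIV (\<lambda>(x, y). x * y :: 'b)"

section \<open>Calculus in locally convex spaces\<close>

definition has_dir_derivative ::
    "('k::real_normed_field \<Rightarrow> 'e::{ab_group_add, t2_space} \<Rightarrow> 'e)
      \<Rightarrow> ('k \<Rightarrow> 'f::{ab_group_add, t2_space} \<Rightarrow> 'f) \<Rightarrow> ('e \<Rightarrow> 'f) \<Rightarrow> 'e \<Rightarrow> 'e \<Rightarrow> 'f \<Rightarrow> bool" where
  "has_dir_derivative s t f x v d \<longleftrightarrow>
     ((\<lambda>c. t (inverse c) (f (x + s c v) - f x)) \<longlongrightarrow> d) (at 0)"

definition dir_derivative ::
    "('k::real_normed_field \<Rightarrow> 'e::{ab_group_add, t2_space} \<Rightarrow> 'e)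
      \<Rightarrow> ('k \<Rightarrow> 'f::{ab_group_add, t2_space} \<Rightarrow> 'f) \<Rightarrow> ('e \<Rightarrow> 'f) \<Rightarrow> 'e \<Rightarrow> 'e \<Rightarrow> 'f" where
  "dir_derivative s t f x v = (THE d. has_dir_derivative s t f x v d)"

primrec iter_derivative ::
    "('k::real_normed_field \<Rightarrow> 'e::{ab_group_add, t2_space} \<Rightarrow> 'e)
      \<Rightarrow> ('k \<Rightarrow> 'f::{ab_group_add, t2_space} \<Rightarrow> 'f) \<Rightarrow> ('e \<Rightarrow> 'f) \<Rightarrow> nat \<Rightarrow> 'e \<Rightarrow> (nat \<Rightarrow> 'e) \<Rightarrow> 'f" where
  "iter_derivative s t f 0 = (\<lambda>x v. f x)"
| "iter_derivative s t f (Suc k) =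
     (\<lambda>x v. dir_derivative s t (\<lambda>y. iter_derivative s t f k y v) x (v k))"

text \<open>
  \<open>C\<^sup>\<infinity>\<close>-maps from \<open>U\<close>, open in the locally convex space \<open>E\<close>, to \<open>F\<close>.  The power \<open>E\<^sup>k\<close> is
  \<open>{..<k} \<rightarrow>\<^sub>E E\<close>, on which the product topology of \<open>nat \<Rightarrow> 'e\<close> induces the one of \<open>E\<^sup>k\<close>.
  Derivatives are taken with respect to the scalar field \<open>'k\<close>.
\<close>

definition smooth_map_on ::
    "('k::real_normed_field \<Rightarrow> 'e::{ab_group_add, t2_space} \<Rightarrow> 'e) \<Rightarrow> 'e set
      \<Rightarrow> ('k \<Rightarrow> 'f::{ab_group_add, t2_space} \<Rightarrow> 'f) \<Rightarrow> 'f set \<Rightarrow> 'e set \<Rightarrow> ('e \<Rightarrow> 'f) \<Rightarrow> bool" where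
  "smooth_map_on s E t F U f \<longleftrightarrow>
     openin (top_of_set E) U \<and>
     (\<forall>k.
       (\<forall>x\<in>U. \<forall>v \<in> {..<Suc k} \<rightarrow>\<^sub>E E.
          \<exists>d. has_dir_derivative s t (\<lambda>y. iter_derivative s t f k y v) x (v k) d) \<and>
       (\<forall>x\<in>U. \<forall>v \<in> {..<k} \<rightarrow>\<^sub>E E. iter_derivative s t f k x v \<in> F) \<and>
       continuous_on (U \<times> ({..<k} \<rightarrow>\<^sub>E E)) (\<lambda>(x, v). iter_derivative s t f k x v))"

text \<open>
  Over the reals, an analytic map is one that extends to a complex \<open>C\<^sup>\<infinity>\<close>-map on an open
  neighbourhood \<open>W\<close> of \<open>U\<close> in the complexification of \<open>E\<close>; over the complex numbers, analytic
  means complex \<open>C\<^sup>\<infinity>\<close>.  The condition \<open>\<real> = UNIV\<close> says that the scalar field is real.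
\<close>

definition analytic_map_on ::
    "('k::rc_field \<Rightarrow> 'e::{ab_group_add, t2_space} \<Rightarrow> 'e) \<Rightarrow> 'e set
      \<Rightarrow> ('k \<Rightarrow> 'f::{ab_group_add, t2_space} \<Rightarrow> 'f) \<Rightarrow> 'f set \<Rightarrow> 'e set \<Rightarrow> ('e \<Rightarrow> 'f) \<Rightarrow> bool" where
  "analytic_map_on s E t F U f \<longleftrightarrow>
     openin (top_of_set E) U \<and>
     (if (\<real> :: 'k set) = UNIV
      then \<exists>W g. smooth_map_on (complexified_scale s) (E \<times> E) (complexified_scale t) (F \<times> F) W g \<and>
             (\<forall>x\<in>U. (x, 0) \<in> W \<and> g (x, 0) = (f x, 0))
      else smooth_map_on s E t F U f)"

section \<open>Analytic manifolds\<close>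

text \<open>A chart is a pair \<open>(U, \<phi>)\<close>; the values of \<open>\<phi>\<close> outside of the domain \<open>U\<close> are irrelevant.\<close>

type_synonym ('m, 'e) chart = "'m set \<times> ('m \<Rightarrow> 'e)"

definition chart_on :: "'e::t2_space set \<Rightarrow> 'm topology \<Rightarrow> ('m, 'e) chart \<Rightarrow> bool" where
  "chart_on E T = (\<lambda>(U, \<phi>).
     openin T U \<and> openin (top_of_set E) (\<phi> ` U) \<and>
     homeomorphic_map (subtopology T U) (top_of_set (\<phi> ` U)) \<phi>)"

definition analytic_transition ::
    "('k::rc_field \<Rightarrow> 'e::{ab_group_add, t2_space} \<Rightarrow> 'e) \<Rightarrow> 'e set
      \<Rightarrow> ('m, 'e) chart \<Rightarrow> ('m, 'e) chart \<Rightarrow> bool" where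
  "analytic_transition s E = (\<lambda>(U, \<phi>) (V, \<psi>).
     analytic_map_on s E s E (\<phi> ` (U \<inter> V)) (\<psi> \<circ> inv_into U \<phi>))"

definition analytic_manifold ::
    "('k::rc_field \<Rightarrow> 'e::{ab_group_add, t2_space} \<Rightarrow> 'e) \<Rightarrow> 'e set
      \<Rightarrow> 'm topology \<Rightarrow> ('m, 'e) chart set \<Rightarrow> bool" where
  "analytic_manifold s E T \<A> \<longleftrightarrow>
     locally_convex_space s E \<and> Hausdorff_space T \<and>
     (\<forall>c\<in>\<A>. chart_on E T c) \<and> \<Union> (fst ` \<A>) = topspace T \<and>
     (\<forall>c\<in>\<A>. \<forall>d\<in>\<A>. analytic_transition s E c d)"

definition maximal_atlas ::
    "('k::rc_field \<Rightarrow> 'e::{ab_group_add, t2_space} \<Rightarrow> 'e) \<Rightarrow> 'e set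
      \<Rightarrow> 'm topology \<Rightarrow> ('m, 'e) chart set \<Rightarrow> ('m, 'e) chart set" where
  "maximal_atlas s E T \<A> =
     {c. chart_on E T c \<and> (\<forall>d\<in>\<A>. analytic_transition s E c d \<and> analytic_transition s E d c)}"

definition product_atlas ::
    "('m, 'e) chart set \<Rightarrow> ('n, 'f) chart set \<Rightarrow> ('m \<times> 'n, 'e \<times> 'f) chart set" where
  "product_atlas \<A> \<B> = {(U \<times> V, map_prod \<phi> \<psi>) | U \<phi> V \<psi>. (U, \<phi>) \<in> \<A> \<and> (V, \<psi>) \<in> \<B>}"

definition analytic_manifold_map ::
    "('k::rc_field \<Rightarrow> 'e::{ab_group_add, t2_space} \<Rightarrow> 'e) \<Rightarrow> 'e set \<Rightarrow> 'm topology \<Rightarrow> ('m, 'e) chart set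
      \<Rightarrow> ('k \<Rightarrow> 'f::{ab_group_add, t2_space} \<Rightarrow> 'f) \<Rightarrow> 'f set \<Rightarrow> 'n topology \<Rightarrow> ('n, 'f) chart set
      \<Rightarrow> ('m \<Rightarrow> 'n) \<Rightarrow> bool" where
  "analytic_manifold_map s E T \<A> s' E' T' \<B> f \<longleftrightarrow>
     continuous_map T T' f \<and>
     (\<forall>(U, \<phi>) \<in> \<A>. \<forall>(V, \<psi>) \<in> \<B>.
        analytic_map_on s E s' E' (\<phi> ` (U \<inter> f -` V)) (\<psi> \<circ> f \<circ> inv_into U \<phi>))"

text \<open>
  \<open>N\<close> is a submanifold, modelled on the closed vector subspace \<open>F\<close> of \<open>E\<close>, of the manifold
  \<open>(T, \<A>)\<close> modelled on \<open>E\<close>, and \<open>\<B>\<close> is an atlas (not necessarily maximal) of the inherited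
  manifold structure, consisting of restrictions of adapted charts.
\<close>

definition analytic_submanifold ::
    "('k::rc_field \<Rightarrow> 'e::{ab_group_add, t2_space} \<Rightarrow> 'e) \<Rightarrow> 'e set \<Rightarrow> 'm topology \<Rightarrow> ('m, 'e) chart set
      \<Rightarrow> 'm set \<Rightarrow> 'e set \<Rightarrow> ('m, 'e) chart set \<Rightarrow> bool" where
  "analytic_submanifold s E T \<A> N F \<B> \<longleftrightarrow>
     analytic_manifold s E T \<A> \<and> N \<subseteq> topspace T \<and>
     module.subspace s F \<and> closedin (top_of_set E) F \<and>
     \<B> \<subseteq> {(W \<inter> N, \<psi>) | W \<psi>. (W, \<psi>) \<in> maximal_atlas s E T \<A> \<and> \<psi> ` (W \<inter> N) = \<psi> ` W \<inter> F} \<and>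
     \<Union> (fst ` \<B>) = N"

section \<open>Tangent spaces and vector fields\<close>

text \<open>
  A tangent vector at \<open>p\<close> is a family of coordinate vectors, one for each chart of the atlas
  around \<open>p\<close>, compatible with the changes of charts (and 0 at all other indices).
  The vector space structure and the topology on the tangent space are the pointwise ones.
\<close>

definition tangent_space ::
    "('k::rc_field \<Rightarrow> 'e::{ab_group_add, t2_space} \<Rightarrow> 'e) \<Rightarrow> 'e set \<Rightarrow> ('m, 'e) chart set
      \<Rightarrow> 'm \<Rightarrow> (('m, 'e) chart \<Rightarrow> 'e) set" where
  "tangent_space s E \<A> p =
     {v. (\<forall>c. if c \<in> \<A> \<and> p \<in> fst c then v c \<in> E else v c = 0) \<and>
         (\<forall>(U, \<phi>) \<in> \<A>. \<forall>(V, \<psi>) \<in> \<A>. p \<in> U \<inter> V \<longrightarrow>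
            v (V, \<psi>) = dir_derivative s s (\<psi> \<circ> inv_into U \<phi>) (\<phi> p) (v (U, \<phi>)))}"

definition chart_at :: "('m, 'e) chart set \<Rightarrow> 'm \<Rightarrow> ('m, 'e) chart" where
  "chart_at \<A> p = (SOME c. c \<in> \<A> \<and> p \<in> fst c)"

definition tangent_map ::
    "('k::rc_field \<Rightarrow> 'e::{ab_group_add, t2_space} \<Rightarrow> 'e) \<Rightarrow> ('m, 'e) chart set
      \<Rightarrow> ('k \<Rightarrow> 'f::{ab_group_add, t2_space} \<Rightarrow> 'f) \<Rightarrow> ('n, 'f) chart set
      \<Rightarrow> ('m \<Rightarrow> 'n) \<Rightarrow> 'm \<Rightarrow> (('m, 'e) chart \<Rightarrow> 'e) \<Rightarrow> ('n, 'f) chart \<Rightarrow> 'f" where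
  "tangent_map s \<A> t \<B> f p v = (\<lambda>(V, \<psi>).
     if (V, \<psi>) \<in> \<B> \<and> f p \<in> V
     then case chart_at \<A> p of (U, \<phi>) \<Rightarrow>
       dir_derivative s t (\<psi> \<circ> f \<circ> inv_into U \<phi>) (\<phi> p) (v (U, \<phi>))
     else 0)"

text \<open>In a chart, the bracket of the vector fields \<open>X\<close> and \<open>Y\<close> is \<open>dY(X) - dX(Y)\<close>.\<close>

definition vector_field_bracket ::
    "('k::rc_field \<Rightarrow> 'e::{ab_group_add, t2_space} \<Rightarrow> 'e) \<Rightarrow> ('m, 'e) chart set
      \<Rightarrow> ('m \<Rightarrow> ('m, 'e) chart \<Rightarrow> 'e) \<Rightarrow> ('m \<Rightarrow> ('m, 'e) chart \<Rightarrow> 'e)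
      \<Rightarrow> 'm \<Rightarrow> ('m, 'e) chart \<Rightarrow> 'e" where
  "vector_field_bracket s \<A> X Y p = (\<lambda>(U, \<phi>).
     if (U, \<phi>) \<in> \<A> \<and> p \<in> U
     then dir_derivative s s (\<lambda>x. Y (inv_into U \<phi> x) (U, \<phi>)) (\<phi> p) (X p (U, \<phi>))
        - dir_derivative s s (\<lambda>x. X (inv_into U \<phi> x) (U, \<phi>)) (\<phi> p) (Y p (U, \<phi>))
     else 0)"

section \<open>Lie groups and their Lie algebras\<close>

definition analytic_lie_group ::
    "('k::rc_field \<Rightarrow> 'e::{ab_group_add, t2_space} \<Rightarrow> 'e) \<Rightarrow> 'e set
      \<Rightarrow> ('m, 'z) monoid_scheme \<Rightarrow> 'm topology \<Rightarrow> ('m, 'e) chart set \<Rightarrow> bool" where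
  "analytic_lie_group s E G T \<A> \<longleftrightarrow>
     group G \<and> topspace T = carrier G \<and> analytic_manifold s E T \<A> \<and>
     analytic_manifold_map (prod_scale s s) (E \<times> E) (prod_topology T T) (product_atlas \<A> \<A>) s E T \<A>
       (\<lambda>(g, h). g \<otimes>\<^bsub>G\<^esub> h) \<and>
     analytic_manifold_map s E T \<A> s E T \<A> (\<lambda>g. inv\<^bsub>G\<^esub> g)"

definition left_invariant_field ::
    "('k::rc_field \<Rightarrow> 'e::{ab_group_add, t2_space} \<Rightarrow> 'e) \<Rightarrow> ('m, 'z) monoid_scheme
      \<Rightarrow> ('m, 'e) chart set \<Rightarrow> (('m, 'e) chart \<Rightarrow> 'e) \<Rightarrow> 'm \<Rightarrow> ('m, 'e) chart \<Rightarrow> 'e" where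
  "left_invariant_field s G \<A> v g = tangent_map s \<A> s \<A> (\<lambda>h. g \<otimes>\<^bsub>G\<^esub> h) \<one>\<^bsub>G\<^esub> v"

text \<open>The Lie algebra of a Lie group is the tangent space at the unit with this bracket.\<close>

definition lie_group_bracket ::
    "('k::rc_field \<Rightarrow> 'e::{ab_group_add, t2_space} \<Rightarrow> 'e) \<Rightarrow> ('m, 'z) monoid_scheme
      \<Rightarrow> ('m, 'e) chart set \<Rightarrow> (('m, 'e) chart \<Rightarrow> 'e) \<Rightarrow> (('m, 'e) chart \<Rightarrow> 'e)
      \<Rightarrow> ('m, 'e) chart \<Rightarrow> 'e" where
  "lie_group_bracket s G \<A> v w =
     vector_field_bracket s \<A> (left_invariant_field s G \<A> v) (left_invariant_field s G \<A> w) \<one>\<^bsub>G\<^esub>"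

definition lie_algebra_on ::
    "('k::field \<Rightarrow> 'v::ab_group_add \<Rightarrow> 'v) \<Rightarrow> 'v set \<Rightarrow> ('v \<Rightarrow> 'v \<Rightarrow> 'v) \<Rightarrow> bool" where
  "lie_algebra_on s V br \<longleftrightarrow>
     vector_space s \<and> module.subspace s V \<and>
     (\<forall>x\<in>V. \<forall>y\<in>V. br x y \<in> V) \<and>
     (\<forall>x\<in>V. \<forall>y\<in>V. \<forall>z\<in>V. br (x + y) z = br x z + br y z \<and> br x (y + z) = br x y + br x z) \<and>
     (\<forall>c. \<forall>x\<in>V. \<forall>y\<in>V. br (s c x) y = s c (br x y) \<and> br x (s c y) = s c (br x y)) \<and>
     (\<forall>x\<in>V. br x x = 0) \<and>
     (\<forall>x\<in>V. \<forall>y\<in>V. \<forall>z\<in>V. br x (br y z) + br y (br z x) + br z (br x y) = 0)"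

definition topological_lie_algebra_iso ::
    "('k::field \<Rightarrow> 'v::{ab_group_add, t2_space} \<Rightarrow> 'v) \<Rightarrow> 'v set \<Rightarrow> ('v \<Rightarrow> 'v \<Rightarrow> 'v)
      \<Rightarrow> ('k \<Rightarrow> 'w::{ab_group_add, t2_space} \<Rightarrow> 'w) \<Rightarrow> 'w set \<Rightarrow> ('w \<Rightarrow> 'w \<Rightarrow> 'w)
      \<Rightarrow> ('v \<Rightarrow> 'w) \<Rightarrow> bool" where
  "topological_lie_algebra_iso s V brV t W brW L \<longleftrightarrow>
     lie_algebra_on s V brV \<and> lie_algebra_on t W brW \<and>
     homeomorphic_map (top_of_set V) (top_of_set W) L \<and>
     (\<forall>x\<in>V. \<forall>y\<in>V. L (x + y) = L x + L y) \<and>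
     (\<forall>c. \<forall>x\<in>V. L (s c x) = t c (L x)) \<and>
     (\<forall>x\<in>V. \<forall>y\<in>V. L (brV x y) = brW (L x) (L y))"

section \<open>Characters and infinitesimal characters\<close>

definition hom_space ::
    "('k::field \<Rightarrow> 'h::ab_group_add \<Rightarrow> 'h) \<Rightarrow> ('k \<Rightarrow> 'b::ab_group_add \<Rightarrow> 'b) \<Rightarrow> ('h \<Rightarrow> 'b) set" where
  "hom_space sH sB = {\<phi>. Vector_Spaces.linear sH sB \<phi>}"

text \<open>By \<open>free_lift_tensor2_eq\<close>, this does not depend on the representative \<open>\<Delta> a\<close>.\<close>

definition convolution ::
    "('k::field \<Rightarrow> 'b::comm_ring \<Rightarrow> 'b) \<Rightarrow> ('h \<Rightarrow> ('h \<times> 'h \<Rightarrow>\<^sub>0 'k)) \<Rightarrow> ('h \<Rightarrow> 'b) \<Rightarrow> ('h \<Rightarrow> 'b) \<Rightarrow> 'h \<Rightarrow> 'b" where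
  "convolution sB \<Delta> \<phi> \<psi> = (\<lambda>a. free_lift sB (\<lambda>(x, y). \<phi> x * \<psi> y) (\<Delta> a))"

definition convolution_bracket ::
    "('k::field \<Rightarrow> 'b::comm_ring \<Rightarrow> 'b) \<Rightarrow> ('h \<Rightarrow> ('h \<times> 'h \<Rightarrow>\<^sub>0 'k)) \<Rightarrow> ('h \<Rightarrow> 'b) \<Rightarrow> ('h \<Rightarrow> 'b) \<Rightarrow> 'h \<Rightarrow> 'b" where
  "convolution_bracket sB \<Delta> \<phi> \<psi> = convolution sB \<Delta> \<phi> \<psi> - convolution sB \<Delta> \<psi> \<phi>"

definition convolution_one ::
    "('k \<Rightarrow> 'b::comm_monoid_mult \<Rightarrow> 'b) \<Rightarrow> ('h \<Rightarrow> 'k) \<Rightarrow> 'h \<Rightarrow> 'b" where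
  "convolution_one sB \<epsilon> = (\<lambda>a. sB (\<epsilon> a) 1)"

definition characters ::
    "('k::field \<Rightarrow> 'h::ring_1 \<Rightarrow> 'h) \<Rightarrow> ('k \<Rightarrow> 'b::{comm_ring, comm_monoid_mult} \<Rightarrow> 'b) \<Rightarrow> ('h \<Rightarrow> 'b) set" where
  "characters sH sB =
     {\<phi> \<in> hom_space sH sB. (\<forall>a b. \<phi> (a * b) = \<phi> a * \<phi> b) \<and> \<phi> 1 = 1}"

definition infinitesimal_characters ::
    "('k::field \<Rightarrow> 'h::ring_1 \<Rightarrow> 'h) \<Rightarrow> ('h \<Rightarrow> 'k)
      \<Rightarrow> ('k \<Rightarrow> 'b::{comm_ring, comm_monoid_mult} \<Rightarrow> 'b) \<Rightarrow> ('h \<Rightarrow> 'b) set" where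
  "infinitesimal_characters sH \<epsilon> sB =
     {\<phi> \<in> hom_space sH sB. \<forall>a b. \<phi> (a * b) = sB (\<epsilon> a) (\<phi> b) + sB (\<epsilon> b) (\<phi> a)}"

definition character_group ::
    "('k::field \<Rightarrow> 'h::ring_1 \<Rightarrow> 'h) \<Rightarrow> ('h \<Rightarrow> ('h \<times> 'h \<Rightarrow>\<^sub>0 'k)) \<Rightarrow> ('h \<Rightarrow> 'k)
      \<Rightarrow> ('k \<Rightarrow> 'b::{comm_ring, comm_monoid_mult} \<Rightarrow> 'b) \<Rightarrow> ('h \<Rightarrow> 'b) monoid" where
  "character_group sH \<Delta> \<epsilon> sB =
     \<lparr>carrier = characters sH sB, mult = convolution sB \<Delta>, one = convolution_one sB \<epsilon>\<rparr>"

text \<open>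
  The affine subspace \<open>{\<phi>. \<phi> 1 = 1}\<close> of \<open>Hom(H, B)\<close>, as a manifold modelled on the vector
  subspace \<open>{\<phi>. \<phi> 1 = 0}\<close>, with the translation by the unit as a global chart.
\<close>

definition augmentation_space ::
    "('k::field \<Rightarrow> 'h::ring_1 \<Rightarrow> 'h) \<Rightarrow> ('k \<Rightarrow> 'b::{comm_ring, comm_monoid_mult} \<Rightarrow> 'b) \<Rightarrow> ('h \<Rightarrow> 'b) set" where
  "augmentation_space sH sB = {\<phi> \<in> hom_space sH sB. \<phi> 1 = 0}"

definition affine_space ::
    "('k::field \<Rightarrow> 'h::ring_1 \<Rightarrow> 'h) \<Rightarrow> ('k \<Rightarrow> 'b::{comm_ring, comm_monoid_mult} \<Rightarrow> 'b) \<Rightarrow> ('h \<Rightarrow> 'b) set" where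
  "affine_space sH sB = {\<phi> \<in> hom_space sH sB. \<phi> 1 = 1}"

definition affine_atlas ::
    "('k::field \<Rightarrow> 'h::ring_1 \<Rightarrow> 'h) \<Rightarrow> ('h \<Rightarrow> 'k)
      \<Rightarrow> ('k \<Rightarrow> 'b::{comm_ring, comm_monoid_mult} \<Rightarrow> 'b) \<Rightarrow> ('h \<Rightarrow> 'b, 'h \<Rightarrow> 'b) chart set" where
  "affine_atlas sH \<epsilon> sB = {(affine_space sH sB, \<lambda>\<phi>. \<phi> - convolution_one sB \<epsilon>)}"

text \<open>
  The derivative at the unit of the inclusion of the character group into the locally convex
  space \<open>Hom(H, B)\<close>, whose tangent spaces are identified with \<open>Hom(H, B)\<close> by means of the
  global chart given by the identity.
\<close>

definition inclusion_derivative ::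
    "('k::rc_field \<Rightarrow> 'h::ring_1 \<Rightarrow> 'h) \<Rightarrow> ('h \<Rightarrow> 'k)
      \<Rightarrow> ('k \<Rightarrow> 'b::{comm_ring, comm_monoid_mult, t2_space} \<Rightarrow> 'b)
      \<Rightarrow> ('h \<Rightarrow> 'b, 'h \<Rightarrow> 'b) chart set \<Rightarrow> (('h \<Rightarrow> 'b, 'h \<Rightarrow> 'b) chart \<Rightarrow> 'h \<Rightarrow> 'b) \<Rightarrow> 'h \<Rightarrow> 'b" where
  "inclusion_derivative sH \<epsilon> sB \<A> v =
     tangent_map (fun_scale sB) \<A> (fun_scale sB) {(hom_space sH sB, id)} id
       (convolution_one sB \<epsilon>) v (hom_space sH sB, id)"

end

theory Submission
  imports Defs "HOL-Computational_Algebra.Formal_Power_Series"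
begin

text \<open>
  By gradedness and connectedness, an augmentation-vanishing functional is locally nilpotent for
  the convolution product: its \<open>k\<close>-th power kills all elements of degree less than \<open>k\<close>.  Hence
  \<open>exp\<close> and \<open>log\<close> are given at each element of the Hopf algebra by finitely many terms, and they
  are mutually inverse bijections between the functionals with \<open>\<phi> 1 = 0\<close> and those with \<open>\<phi> 1 = 1\<close>
  which identify infinitesimal characters with characters.  So \<open>log\<close> is a global chart adapted to
  the group of characters.  In this chart all structure maps are polynomial at each element of the
  Hopf algebra; such maps are smooth, and over the reals they extend to the complexification by the
  same polynomials.  The bracket is read off the mixed second derivative \<open>(v \<star> w - w \<star> v) / 2\<close> of
  \<open>log (exp x \<star> exp y)\<close> at the origin.
\<close>

section \<open>Directional derivatives of polynomial maps\<close>

text \<open>No convergence in \<open>B\<close> is involved: the cutoff of a series at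
  \<open>a\<close> depends on \<open>a\<close> alone and serves all functionals in
  \<open>aug\<close> at once. With that cutoff fixed, \<open>cseries\<close> is a polynomial formula
  on all functions \<open>'h \<Rightarrow> 'b\<close>, while its algebraic laws are proved on the
  relevant subspaces. Analyticity can therefore be shown for everywhere defined maps and then
  transferred to their restrictions. The delicate point is the target: in the real case the complex
  extension has to take values in the complexification of the model space, which may be a proper
  subspace. This comes from an identity principle, a polynomial that vanishes at all natural numbers
  being zero; the same principle leads from the powers of a character to its logarithm.\<close>

lemma tendsto_fun_iff:
  fixes f :: "'x \<Rightarrow> 'i \<Rightarrow> 'v::topological_space"
  shows "(f \<longlongrightarrow> l) F \<longleftrightarrow> (\<forall>i. ((\<lambda>x. f x i) \<longlongrightarrow> l i) F)"
proof -
  have "(f \<longlongrightarrow> l) F \<longleftrightarrow> limitin (product_topology (\<lambda>_. euclidean) UNIV) f l F"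
    by (simp only: euclidean_product_topology limitin_canonical_iff)
  then show ?thesis
    by (simp add: limitin_componentwise)
qed

locale topological_vs = vector_space t
  for t :: "'k::real_normed_field \<Rightarrow> 'v::{ab_group_add, t2_space} \<Rightarrow> 'v" +
  assumes continuous_add: "continuous_on UNIV (\<lambda>(x, y). x + y :: 'v)"
    and continuous_scale: "continuous_on UNIV (\<lambda>(c, x). t c x)"
begin

lemma tendsto_add':
  assumes "(f \<longlongrightarrow> a) F" "(g \<longlongrightarrow> b) F"
  shows "((\<lambda>x. f x + g x :: 'v) \<longlongrightarrow> a + b) F"
  using continuous_on_tendsto_compose[OF continuous_add tendsto_Pair[OF assms]] by simp

lemma tendsto_scale':
  assumes "(f \<longlongrightarrow> a) F" "(g \<longlongrightarrow> b) F"
  shows "((\<lambda>x. t (f x) (g x)) \<longlongrightarrow> t a b) F"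
  using continuous_on_tendsto_compose[OF continuous_scale tendsto_Pair[OF assms]] by simp

lemma tendsto_diff':
  assumes "(f \<longlongrightarrow> a) F" "(g \<longlongrightarrow> b) F"
  shows "((\<lambda>x. f x - g x :: 'v) \<longlongrightarrow> a - b) F"
  using tendsto_add'[OF assms(1) tendsto_scale'[OF tendsto_const[of "- 1"] assms(2)]] by simp

end

text \<open>The product is a parameter rather than the operation of a type class, so that the
  complexification with \<open>complexified_mul\<close> is an instance as well.\<close>

locale topological_algebra = topological_vs t
  for t :: "'k::real_normed_field \<Rightarrow> 'v::{ab_group_add, t2_space} \<Rightarrow> 'v" +
  fixes mul :: "'v \<Rightarrow> 'v \<Rightarrow> 'v"
  assumes mul_add_left: "mul (x + y) z = mul x z + mul y z"
    and mul_add_right: "mul z (x + y) = mul z x + mul z y"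
    and mul_scale_left: "mul (t c x) y = t c (mul x y)"
    and mul_scale_right: "mul x (t c y) = t c (mul x y)"
    and continuous_mul: "continuous_on UNIV (\<lambda>(x, y). mul x y)"
begin

lemma tendsto_mul:
  assumes "(f \<longlongrightarrow> a) F" "(g \<longlongrightarrow> b) F"
  shows "((\<lambda>x. mul (f x) (g x)) \<longlongrightarrow> mul a b) F"
  using continuous_on_tendsto_compose[OF continuous_mul tendsto_Pair[OF assms]] by simp

lemma mul_diff_left: "mul (x - y) z = mul x z - mul y z"
  by (metis add_diff_cancel_right' diff_add_cancel mul_add_left)

lemma mul_diff_right: "mul z (x - y) = mul z x - mul z y"
  by (metis add_diff_cancel_right' diff_add_cancel mul_add_right)

lemma mul_zero: "mul 0 x = 0" "mul x 0 = 0"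
  by (metis diff_self mul_diff_left, metis diff_self mul_diff_right)

lemma mul_sum_left: "mul (sum f A) z = (\<Sum>i\<in>A. mul (f i) z)"
  by (induction A rule: infinite_finite_induct) (auto simp: mul_zero mul_add_left)

lemma mul_sum_right: "mul z (sum f A) = (\<Sum>i\<in>A. mul z (f i))"
  by (induction A rule: infinite_finite_induct) (auto simp: mul_zero mul_add_right)

end

section \<open>Rules for directional derivatives\<close>

context topological_vs
begin

lemma has_dir_derivative_unique:
  assumes "has_dir_derivative s t f x v d" "has_dir_derivative s t f x v d'"
  shows "d = d'"
  using assms unfolding has_dir_derivative_def
  by (rule tendsto_unique[OF at_neq_bot])

lemma dir_derivative_eq:
  assumes "has_dir_derivative s t f x v d"
  shows "dir_derivative s t f x v = d"
  unfolding dir_derivative_def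
  using assms has_dir_derivative_unique by blast

lemma has_dir_derivative_const: "has_dir_derivative s t (\<lambda>_. b) x v 0"
  by (simp add: has_dir_derivative_def)

lemma has_dir_derivative_linear:
  assumes "Vector_Spaces.linear s t l"
  shows "has_dir_derivative s t l x v (l v)"
proof -
  interpret l: Vector_Spaces.linear s t l by fact
  have "eventually (\<lambda>c. t (inverse c) (l (x + s c v) - l x) = l v) (at 0)"
    using eventually_neq_at_within[of 0 0 UNIV]
    by eventually_elim (simp add: l.add l.scale)
  then show ?thesis
    unfolding has_dir_derivative_def by (rule tendsto_eventually)
qed

lemma has_dir_derivative_add:
  assumes "has_dir_derivative s t f x v d" "has_dir_derivative s t g x v e"
  shows "has_dir_derivative s t (\<lambda>x. f x + g x) x v (d + e)"
  using tendsto_add'[OF assms[unfolded has_dir_derivative_def]]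
  by (simp add: has_dir_derivative_def scale_right_distrib[symmetric] add_diff_add)

lemma has_dir_derivative_scale:
  assumes "has_dir_derivative s t f x v d"
  shows "has_dir_derivative s t (\<lambda>x. t c (f x)) x v (t c d)"
  using tendsto_scale'[OF tendsto_const[of c] assms[unfolded has_dir_derivative_def]]
  by (simp add: has_dir_derivative_def scale_right_diff_distrib[symmetric] mult.commute[of c])

lemma has_dir_derivative_diff:
  assumes "has_dir_derivative s t f x v d" "has_dir_derivative s t g x v e"
  shows "has_dir_derivative s t (\<lambda>x. f x - g x) x v (d - e)"
  using has_dir_derivative_add[OF assms(1) has_dir_derivative_scale[OF assms(2), of "- 1"]] by simp

lemma has_dir_derivative_sum:
  assumes "\<And>i. i \<in> A \<Longrightarrow> has_dir_derivative s t (f i) x v (d i)"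
  shows "has_dir_derivative s t (\<lambda>x. \<Sum>i\<in>A. f i x) x v (\<Sum>i\<in>A. d i)"
  using assms
  by (induction A rule: infinite_finite_induct)
     (auto intro: has_dir_derivative_const has_dir_derivative_add)

text \<open>Multiplying the difference quotient back by \<open>c\<close> gives continuity along the
  line in direction \<open>v\<close>, which is what the product rule relies on.\<close>

lemma has_dir_derivative_imp_tendsto:
  assumes "has_dir_derivative s t f x v d"
  shows "((\<lambda>c. f (x + s c v)) \<longlongrightarrow> f x) (at 0)"
proof -
  have "((\<lambda>c. t c (t (inverse c) (f (x + s c v) - f x)) + f x) \<longlongrightarrow> t 0 d + f x) (at 0)"
    by (intro tendsto_add' tendsto_scale' tendsto_ident_at tendsto_const assms[unfolded has_dir_derivative_def])
  moreover have "eventually (\<lambda>c. t c (t (inverse c) (f (x + s c v) - f x)) + f x = f (x + s c v)) (at 0)"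
    using eventually_neq_at_within[of 0 0 UNIV] by eventually_elim simp
  ultimately show ?thesis
    by (auto elim: Lim_transform_eventually)
qed

lemma has_dir_derivative_cong:
  assumes "\<And>c. f (x + s c v) = g (x + s c v)" "f x = g x"
  shows "has_dir_derivative s t f x v d \<longleftrightarrow> has_dir_derivative s t g x v d"
  using assms by (simp add: has_dir_derivative_def)

end

lemma (in topological_algebra) has_dir_derivative_mul:
  assumes "has_dir_derivative s t f x v d" "has_dir_derivative s t g x v e"
  shows "has_dir_derivative s t (\<lambda>x. mul (f x) (g x)) x v (mul d (g x) + mul (f x) e)"
proof -
  have "((\<lambda>c. mul (t (inverse c) (f (x + s c v) - f x)) (g (x + s c v))
      + mul (f x) (t (inverse c) (g (x + s c v) - g x))) \<longlongrightarrow> mul d (g x) + mul (f x) e) (at 0)"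
    using assms has_dir_derivative_imp_tendsto[OF assms(2)] unfolding has_dir_derivative_def
    by (intro tendsto_add' tendsto_mul tendsto_const)
  then show ?thesis
    by (simp add: has_dir_derivative_def mul_scale_left mul_scale_right mul_diff_left mul_diff_right
        scale_right_distrib[symmetric])
qed

text \<open>Each formation rule survives both differentiation and complexification, so smoothness
  and complex extendability follow by induction on the rules. Continuity of the linear building
  blocks makes every member continuous.\<close>

inductive polynomial_fun ::
    "('k::field \<Rightarrow> 'e::{ab_group_add, t2_space} \<Rightarrow> 'e)
      \<Rightarrow> ('k \<Rightarrow> 'v::{ab_group_add, t2_space} \<Rightarrow> 'v) \<Rightarrow> ('v \<Rightarrow> 'v \<Rightarrow> 'v) \<Rightarrow> ('e \<Rightarrow> 'v) \<Rightarrow> bool"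
  for s t mul where
  const: "polynomial_fun s t mul (\<lambda>_. b)"
| linear: "Vector_Spaces.linear s t l \<Longrightarrow> continuous_on UNIV l \<Longrightarrow> polynomial_fun s t mul l"
| add: "polynomial_fun s t mul p \<Longrightarrow> polynomial_fun s t mul q \<Longrightarrow> polynomial_fun s t mul (\<lambda>x. p x + q x)"
| mul: "polynomial_fun s t mul p \<Longrightarrow> polynomial_fun s t mul q \<Longrightarrow> polynomial_fun s t mul (\<lambda>x. mul (p x) (q x))"

lemma polynomial_fun_sum:
  assumes "\<And>i. i \<in> A \<Longrightarrow> polynomial_fun s t mul (p i)"
  shows "polynomial_fun s t mul (\<lambda>x. \<Sum>i\<in>A. p i x)"
  using assms
  by (induction A rule: infinite_finite_induct) (auto intro: polynomial_fun.const polynomial_fun.add)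

lemma polynomial_fun_compose_linear:
  assumes "polynomial_fun s t mul p" "Vector_Spaces.linear r s l" "continuous_on UNIV l"
  shows "polynomial_fun r t mul (\<lambda>x. p (l x))"
  using assms(1)
proof induction
  case (linear k)
  have "continuous_on UNIV (\<lambda>x. k (l x))"
    using continuous_on_compose2[OF linear(2) assms(3)] by simp
  moreover have "Vector_Spaces.linear r t (\<lambda>x. k (l x))"
    using assms(2) linear(1) by (simp add: Vector_Spaces.linear_iff)
  ultimately show ?case
    by (rule polynomial_fun.linear[rotated])
qed (auto intro: polynomial_fun.intros)

lemma (in topological_algebra) continuous_polynomial_fun:
  assumes "polynomial_fun s t mul p"
  shows "continuous_on S p"
  using assms
proof induction
  case (linear l)
  then show ?case using continuous_on_subset by blast
qed (auto simp: continuous_on_def intro: tendsto_add' tendsto_mul)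

lemma vector_space_fun_scale: "vector_space t \<Longrightarrow> vector_space (fun_scale t)"
  unfolding vector_space_def by (auto simp: fun_scale_def fun_eq_iff)

lemma vector_space_prod_scale: "vector_space s \<Longrightarrow> vector_space t \<Longrightarrow> vector_space (prod_scale s t)"
  unfolding vector_space_def by (auto simp: prod_scale_def)

lemma linearI':
  assumes "vector_space s" "vector_space t"
    "\<And>x y. f (x + y) = f x + f y" "\<And>c x. f (s c x) = t c (f x)"
  shows "Vector_Spaces.linear s t f"
  using assms by (simp add: Vector_Spaces.linear_iff)

text \<open>Base point and the whole sequence of directions form one variable \<open>(x, w)\<close>.
  The derivative in direction \<open>w k\<close> is then a polynomial in the same variable, so the
  result can be differentiated again.\<close>

lemma (in topological_algebra) polynomial_fun_derivative:
  fixes s :: "'k \<Rightarrow> 'e::{ab_group_add, t2_space} \<Rightarrow> 'e" and p :: "'e \<times> (nat \<Rightarrow> 'e) \<Rightarrow> 'v"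
  assumes "polynomial_fun (prod_scale s (fun_scale s)) t mul p" and s: "vector_space s"
  shows "\<exists>q. polynomial_fun (prod_scale s (fun_scale s)) t mul q \<and>
    (\<forall>x w. has_dir_derivative s t (\<lambda>y. p (y, w)) x (w k) (q (x, w)))"
  using assms(1)
proof induction
  case (const b)
  show ?case
    by (intro exI[of _ "\<lambda>_. 0"]) (auto intro: polynomial_fun.const has_dir_derivative_const)
next
  case (linear l)
  let ?r = "prod_scale s (fun_scale s) :: 'k \<Rightarrow> 'e \<times> (nat \<Rightarrow> 'e) \<Rightarrow> _"
  interpret l: Vector_Spaces.linear ?r t l by fact
  interpret s: vector_space s by fact
  interpret fs: vector_space "fun_scale s" using s by (rule vector_space_fun_scale)
  \<comment> \<open>The derivative of \<open>l\<close> in the first variable is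
    \<open>l (w k, 0)\<close>, the composition of \<open>l\<close> with this linear map.\<close>
  have "Vector_Spaces.linear ?r ?r (\<lambda>z. (snd z k, 0))"
    by (intro linearI' l.vs1.vector_space_axioms) (auto simp: prod_scale_def fun_scale_def fun_eq_iff)
  moreover have "continuous_on UNIV (\<lambda>z :: 'e \<times> (nat \<Rightarrow> 'e). (snd z k, 0 :: nat \<Rightarrow> 'e))"
    by (intro continuous_on_Pair continuous_on_const
        continuous_on_product_then_coordinatewise[OF continuous_on_snd[OF continuous_on_id]])
  ultimately have "polynomial_fun ?r t mul (\<lambda>z. l (snd z k, 0))"
    using polynomial_fun_compose_linear[OF polynomial_fun.linear[OF linear]] by blast
  moreover have "has_dir_derivative s t (\<lambda>y. l (y, w)) x (w k) (l (snd (x, w) k, 0))" for x w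
  proof -
    have split: "l (y, w) = l (y, 0) + l (0, w)" for y
      by (simp flip: l.add)
    have "Vector_Spaces.linear s t (\<lambda>y. l (y, 0))"
    proof (intro linearI' s vector_space_axioms)
      show "l (y + y', 0) = l (y, 0) + l (y', 0)" for y y'
        by (simp flip: l.add)
      show "l (s c y, 0) = t c (l (y, 0))" for c y
        by (simp flip: l.scale add: prod_scale_def)
    qed
    from has_dir_derivative_add[OF has_dir_derivative_linear[OF this] has_dir_derivative_const[where b = "l (0, w)"]]
    show ?thesis
      by (simp flip: split)
  qed
  ultimately show ?case by blast
next
  case (add p q)
  then obtain p' q' where
    "polynomial_fun (prod_scale s (fun_scale s)) t mul p'" "polynomial_fun (prod_scale s (fun_scale s)) t mul q'"
    "\<And>x w. has_dir_derivative s t (\<lambda>y. p (y, w)) x (w k) (p' (x, w))"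
    "\<And>x w. has_dir_derivative s t (\<lambda>y. q (y, w)) x (w k) (q' (x, w))"
    by blast
  then show ?case
    by (intro exI[of _ "\<lambda>z. p' z + q' z"]) (auto intro: polynomial_fun.add has_dir_derivative_add)
next
  case (mul p q)
  then obtain p' q' where *:
    "polynomial_fun (prod_scale s (fun_scale s)) t mul p'" "polynomial_fun (prod_scale s (fun_scale s)) t mul q'"
    "\<And>x w. has_dir_derivative s t (\<lambda>y. p (y, w)) x (w k) (p' (x, w))"
    "\<And>x w. has_dir_derivative s t (\<lambda>y. q (y, w)) x (w k) (q' (x, w))"
    by blast
  then show ?case using mul.hyps
    by (intro exI[of _ "\<lambda>z. mul (p' z) (q z) + mul (p z) (q' z)"] conjI allI polynomial_fun.add polynomial_fun.mul
        has_dir_derivative_mul[where f = "\<lambda>y. p (y, _)" and g = "\<lambda>y. q (y, _)"])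
qed

text \<open>
  The pair \<open>\<pi>, J\<close> identifies the target with a space of functions; this covers both
  \<open>'i \<Rightarrow> 'b\<close> and its complexification \<open>('i \<Rightarrow> 'b) \<times> ('i \<Rightarrow> 'b)\<close>.
\<close>

lemma (in topological_algebra) smooth_map_on_polynomial:
  fixes s :: "'k \<Rightarrow> 'e::{ab_group_add, t2_space} \<Rightarrow> 'e"
    and t' :: "'k \<Rightarrow> 'f::{ab_group_add, t2_space} \<Rightarrow> 'f"
    and \<pi> :: "'f \<Rightarrow> 'i \<Rightarrow> 'v" and J :: "('i \<Rightarrow> 'v) \<Rightarrow> 'f"
  assumes s: "vector_space s" and E: "module.subspace s E"
    and F: "module.subspace t' F" "closed F"
    and J: "\<And>f. J (\<pi> f) = f" "\<And>q. \<pi> (J q) = q" "continuous_on UNIV J"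
    and \<pi>: "Vector_Spaces.linear t' (fun_scale t) \<pi>"
    and f: "\<And>i. polynomial_fun s t mul (\<lambda>x. \<pi> (f x) i)" "f ` E \<subseteq> F"
  shows "smooth_map_on s E t' F E f"
proof -
  interpret s: vector_space s by fact
  interpret \<pi>: Vector_Spaces.linear t' "fun_scale t" \<pi> by fact
  let ?r = "prod_scale s (fun_scale s) :: 'k \<Rightarrow> 'e \<times> (nat \<Rightarrow> 'e) \<Rightarrow> _"
  \<comment> \<open>\<open>J\<close> carries coordinatewise limits over to the topology of the
    target.\<close>
  have derivI: "has_dir_derivative s t' g x v (J d)"
    if "\<And>i. has_dir_derivative s t (\<lambda>y. \<pi> (g y) i) x v (d i)" for g x v d
  proof -
    have "((\<lambda>c. \<pi> (t' (inverse c) (g (x + s c v) - g x))) \<longlongrightarrow> d) (at 0)"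
      using that unfolding has_dir_derivative_def
      by (simp add: tendsto_fun_iff \<pi>.scale \<pi>.diff fun_scale_def)
    from continuous_on_tendsto_compose[OF J(3) this] show ?thesis
      by (simp add: has_dir_derivative_def J)
  qed
  have uniq: "dir_derivative s t' g x v = J d"
    if d: "\<And>i. has_dir_derivative s t (\<lambda>y. \<pi> (g y) i) x v (d i)" for g x v d
  proof -
    have *: "has_dir_derivative s t' g x v (J d)" using d by (rule derivI)
    moreover have "e = J d" if "has_dir_derivative s t' g x v e" for e
      using that * unfolding has_dir_derivative_def by (rule tendsto_unique[OF at_neq_bot])
    ultimately show ?thesis
      unfolding dir_derivative_def by (rule the_equality)
  qed
  \<comment> \<open>All coordinates of an iterated derivative are polynomials in base point and
    directions, which makes the next derivative exist.\<close>
  have Q: "\<exists>Q. (\<forall>i. polynomial_fun ?r t mul (Q i)) \<and>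
      (\<forall>x w i. \<pi> (iter_derivative s t' f k x w) i = Q i (x, w))" for k
  proof (induction k)
    case 0
    have "Vector_Spaces.linear ?r s fst"
      by (intro linearI' s vector_space_prod_scale vector_space_fun_scale) (auto simp: prod_scale_def)
    then have "polynomial_fun ?r t mul (\<lambda>z. \<pi> (f (fst z)) i)" for i
      by (rule polynomial_fun_compose_linear[OF f(1)]) (intro continuous_intros)
    then show ?case by (intro exI[of _ "\<lambda>i z. \<pi> (f (fst z)) i"]) simp
  next
    case (Suc k)
    then obtain Q where Q: "\<And>i. polynomial_fun ?r t mul (Q i)"
      "\<And>x w i. \<pi> (iter_derivative s t' f k x w) i = Q i (x, w)" by blast
    obtain Q' where Q': "\<And>i. polynomial_fun ?r t mul (Q' i)"
      "\<And>i x w. has_dir_derivative s t (\<lambda>y. Q i (y, w)) x (w k) (Q' i (x, w))"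
      using polynomial_fun_derivative[OF Q(1) s, of _ k] by metis
    have "iter_derivative s t' f (Suc k) x w = J (\<lambda>i. Q' i (x, w))" for x w
      using uniq[of "\<lambda>y. iter_derivative s t' f k y w"] Q Q' by simp
    then show ?case using Q'(1) by (intro exI[of _ Q']) (simp add: J)
  qed
  have deriv: "has_dir_derivative s t' (\<lambda>y. iter_derivative s t' f k y w) x (w k)
      (iter_derivative s t' f (Suc k) x w)" for k x w
  proof -
    obtain Q where Q: "\<And>i. polynomial_fun ?r t mul (Q i)"
      "\<And>x w i. \<pi> (iter_derivative s t' f k x w) i = Q i (x, w)" using Q by blast
    obtain Q' where Q': "\<And>i x w. has_dir_derivative s t (\<lambda>y. Q i (y, w)) x (w k) (Q' i (x, w))"
      using polynomial_fun_derivative[OF Q(1) s, of _ k] by metis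
    have *: "has_dir_derivative s t (\<lambda>y. \<pi> (iter_derivative s t' f k y w) i) x (w k) (Q' i (x, w))" for i
      using Q' by (simp add: Q)
    show ?thesis
      using derivI[OF *] uniq[OF *] by simp
  qed
  \<comment> \<open>Difference quotients with base point and direction in \<open>E\<close> lie in
    the subspace \<open>F\<close>, and their limit stays there because \<open>F\<close> is
    closed.\<close>
  have mem: "iter_derivative s t' f k x w \<in> F" if "x \<in> E" "w \<in> {..<k} \<rightarrow>\<^sub>E E" for k x w
  proof -
    have "iter_derivative s t' f k x w \<in> F" if "x \<in> E" "\<And>i. i < k \<Longrightarrow> w i \<in> E"
      using that
    proof (induction k arbitrary: x)
      case 0
      then show ?case using f(2) by auto
    next
      case (Suc k)
      have "x + s c (w k) \<in> E" for c
        using Suc.prems E by (simp add: s.subspace_add s.subspace_scale)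
      then have "t' (inverse c) (iter_derivative s t' f k (x + s c (w k)) w - iter_derivative s t' f k x w) \<in> F" for c
        using F(1) Suc by (simp add: \<pi>.vs1.subspace_diff \<pi>.vs1.subspace_scale)
      then show ?case
        by (intro Lim_in_closed_set[OF F(2) always_eventually at_neq_bot
            deriv[of k w x, unfolded has_dir_derivative_def]] allI)
    qed
    then show ?thesis using that by auto
  qed
  have cont: "continuous_on A (\<lambda>(x, w). iter_derivative s t' f k x w)" for k A
  proof -
    obtain Q where Q: "\<And>i. polynomial_fun ?r t mul (Q i)"
      "\<And>x w i. \<pi> (iter_derivative s t' f k x w) i = Q i (x, w)" using Q by blast
    have "iter_derivative s t' f k x w = J (\<lambda>i. Q i (x, w))" for x w
      by (metis J(1) Q(2) ext)
    moreover have "continuous_on A (\<lambda>z. J (\<lambda>i. Q i z))"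
      by (intro continuous_on_compose2[OF J(3)] continuous_on_coordinatewise_then_product
          continuous_polynomial_fun[OF Q(1)]) auto
    ultimately show ?thesis
      by (simp add: case_prod_beta)
  qed
  have "\<exists>d. has_dir_derivative s t' (\<lambda>y. iter_derivative s t' f k y w) x (w k) d" for k x w
    using deriv by blast
  then show ?thesis
    unfolding smooth_map_on_def
    by (intro conjI allI ballI openin_subtopology_self mem cont)
qed

section \<open>Complexification and analyticity of polynomial maps\<close>

text \<open>In characteristic 0 the natural numbers are enough sample points, also for vector
  coefficients. This is applied to complex extensions known on real points and to powers of a
  character, known for natural exponents.\<close>

lemma (in vector_space) coefficients_eq_0:
  fixes c :: "nat \<Rightarrow> 'b"
  assumes char: "\<And>n. n > 0 \<Longrightarrow> (of_nat n :: 'a) \<noteq> 0"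
    and "\<And>n. (\<Sum>i\<le>d. scale (of_nat n ^ i) (c i)) = 0" "i \<le> d"
  shows "c i = 0"
  using assms(2,3)
proof (induction d arbitrary: c i)
  case 0
  from "0.prems"(1)[of 0] "0.prems"(2) show ?case by simp
next
  case (Suc d)
  \<comment> \<open>Passing from \<open>p(n)\<close> to \<open>p(2n) - 2\<^sup>d\<^sup>+\<^sup>1 p(n)\<close> removes the leading term.\<close>
  define c' where "c' i = scale (2 ^ i - 2 ^ Suc d) (c i)" for i
  have "(\<Sum>i\<le>d. scale (of_nat n ^ i) (c' i)) = 0" for n
  proof -
    have "(\<Sum>i\<le>d. scale (of_nat n ^ i) (c' i)) = (\<Sum>i\<le>Suc d. scale (of_nat n ^ i) (c' i))"
      by (simp add: c'_def)
    also have "\<dots> = (\<Sum>i\<le>Suc d. scale (of_nat (2 * n) ^ i) (c i))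
        - scale (2 ^ Suc d) (\<Sum>i\<le>Suc d. scale (of_nat n ^ i) (c i))"
      unfolding scale_sum_right sum_subtractf[symmetric] c'_def
      by (intro sum.cong) (simp_all add: scale_left_diff_distrib scale_right_diff_distrib power_mult_distrib mult.commute del: power_Suc)
    also have "\<dots> = 0" by (simp only: Suc.prems(1) scale_zero_right diff_zero)
    finally show ?thesis .
  qed
  from Suc.IH[OF this] have "c' i = 0" if "i \<le> d" for i using that by blast
  moreover have "(2 ^ i - 2 ^ Suc d :: 'a) \<noteq> 0" if "i \<le> d" for i
  proof -
    \<comment> \<open>Up to sign the factor is the image of a positive natural number, hence nonzero
      in characteristic 0.\<close>
    have "(2 ^ Suc d :: 'a) = 2 ^ i * 2 ^ (Suc d - i)"
      using that by (simp flip: power_add)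
    then have "(2 ^ Suc d - 2 ^ i :: 'a) = 2 ^ i * (2 ^ (Suc d - i) - 1)"
      by (simp add: algebra_simps)
    also have "\<dots> = of_nat (2 ^ i * (2 ^ (Suc d - i) - 1))"
      by simp
    also have "\<dots> \<noteq> 0"
      using that one_less_power[of "2 :: nat" "Suc d - i"] by (intro char) auto
    finally show ?thesis by auto
  qed
  ultimately have zero: "c i = 0" if "i \<le> d" for i
    using that by (auto simp: c'_def)
  have "c (Suc d) = 0"
    using Suc.prems(1)[of 1] zero by simp
  with zero Suc.prems(2) show ?case by (cases "i = Suc d") auto
qed

text \<open>An infinite sequence that is zero from some index on lets polynomials of different
  degrees be added, multiplied and compared without aligning their degrees.\<close>

definition has_coefficients ::
    "('k::field \<Rightarrow> 'v::ab_group_add \<Rightarrow> 'v) \<Rightarrow> ('k \<Rightarrow> 'v) \<Rightarrow> (nat \<Rightarrow> 'v) \<Rightarrow> bool" where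
  "has_coefficients t P c \<longleftrightarrow> (\<exists>d. (\<forall>i>d. c i = 0) \<and> (\<forall>z. P z = (\<Sum>i\<le>d. t (z ^ i) (c i))))"

context vector_space
begin

lemma has_coefficients_eventually:
  assumes "has_coefficients scale P c"
  shows "\<exists>d. \<forall>e\<ge>d. (\<forall>i>e. c i = 0) \<and> (\<forall>z. P z = (\<Sum>i\<le>e. scale (z ^ i) (c i)))"
proof -
  from assms obtain d where d: "\<And>i. i > d \<Longrightarrow> c i = 0" "\<And>z. P z = (\<Sum>i\<le>d. scale (z ^ i) (c i))"
    unfolding has_coefficients_def by blast
  have "P z = (\<Sum>i\<le>e. scale (z ^ i) (c i))" if "e \<ge> d" for e z
    unfolding d(2) using that d(1) by (intro sum.mono_neutral_left) auto
  with d(1) show ?thesis by (intro exI[of _ d]) auto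
qed

lemma has_coefficients_diff:
  assumes "has_coefficients scale P c" "has_coefficients scale Q e"
  shows "has_coefficients scale (\<lambda>z. P z - Q z) (\<lambda>i. c i - e i)"
proof -
  obtain m where m: "\<And>e. e \<ge> m \<Longrightarrow> (\<forall>i>e. c i = 0) \<and> (\<forall>z. P z = (\<Sum>i\<le>e. scale (z ^ i) (c i)))"
    using has_coefficients_eventually[OF assms(1)] by blast
  obtain n where n: "\<And>j. j \<ge> n \<Longrightarrow> (\<forall>i>j. e i = 0) \<and> (\<forall>z. Q z = (\<Sum>i\<le>j. scale (z ^ i) (e i)))"
    using has_coefficients_eventually[OF assms(2)] by blast
  show ?thesis
    unfolding has_coefficients_def using m[of "max m n"] n[of "max m n"]
    by (intro exI[of _ "max m n"]) (simp add: scale_right_diff_distrib sum_subtractf)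
qed

lemma has_coefficients_linear:
  "has_coefficients scale (\<lambda>z. a + scale z b) (\<lambda>i. if i = 0 then a else if i = 1 then b else 0)"
  unfolding has_coefficients_def by (intro exI[of _ 1]) (auto simp: atMost_Suc)

lemma has_coefficients_const: "has_coefficients scale (\<lambda>z. a) (\<lambda>i. if i = 0 then a else 0)"
  unfolding has_coefficients_def by (intro exI[of _ 0]) auto

lemma has_coefficients_add:
  assumes "has_coefficients scale P c" "has_coefficients scale Q e"
  shows "has_coefficients scale (\<lambda>z. P z + Q z) (\<lambda>i. c i + e i)"
  using has_coefficients_diff[OF assms(1) has_coefficients_diff[OF has_coefficients_const[of 0] assms(2)]]
  by (simp cong: if_cong)

lemma has_coefficients_unique:
  assumes char: "\<And>n. n > 0 \<Longrightarrow> (of_nat n :: 'a) \<noteq> 0"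
    and "has_coefficients scale P c" "has_coefficients scale Q e" "\<And>n. P (of_nat n) = Q (of_nat n)"
  shows "c = e"
proof
  fix i
  obtain m where m: "\<And>j. j \<ge> m \<Longrightarrow> (\<forall>i>j. c i - e i = 0) \<and> (\<forall>z. P z - Q z = (\<Sum>i\<le>j. scale (z ^ i) (c i - e i)))"
    using has_coefficients_eventually[OF has_coefficients_diff[OF assms(2,3)]] by blast
  have "(\<Sum>i\<le>max m i. scale (of_nat n ^ i) (c i - e i)) = 0" for n
    using m[of "max m i"] assms(4) by (metis diff_self max.cobounded1)
  from coefficients_eq_0[OF char this, of i] show "c i = e i" by simp
qed

end

context topological_algebra
begin

lemma has_coefficients_mul:
  assumes "has_coefficients t P c" "has_coefficients t Q e"
  shows "has_coefficients t (\<lambda>z. mul (P z) (Q z)) (\<lambda>k. \<Sum>i\<le>k. mul (c i) (e (k - i)))"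
proof -
  obtain m where m: "\<And>i. i > m \<Longrightarrow> c i = 0" "\<And>z. P z = (\<Sum>i\<le>m. t (z ^ i) (c i))"
    using assms(1) unfolding has_coefficients_def by blast
  obtain n where n: "\<And>i. i > n \<Longrightarrow> e i = 0" "\<And>z. Q z = (\<Sum>i\<le>n. t (z ^ i) (e i))"
    using assms(2) unfolding has_coefficients_def by blast
  have "mul (P z) (Q z) = (\<Sum>k\<le>m + n. t (z ^ k) (\<Sum>i\<le>k. mul (c i) (e (k - i))))" for z
  proof -
    have "mul (P z) (Q z) = (\<Sum>i\<le>m. \<Sum>j\<le>n. t (z ^ (i + j)) (mul (c i) (e j)))"
      unfolding m n mul_sum_left mul_sum_right
      by (subst sum.swap) (simp add: mul_scale_left mul_scale_right power_add mult.commute)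
    also have "\<dots> = (\<Sum>(i, j)\<in>{..m} \<times> {..n}. t (z ^ (i + j)) (mul (c i) (e j)))"
      by (simp add: sum.cartesian_product)
    \<comment> \<open>The rectangle is enlarged to a triangle: outside the rectangle one of the two
      coefficients is zero.\<close>
    also have "\<dots> = (\<Sum>(i, j)\<in>{(i, j). i + j \<le> m + n}. t (z ^ (i + j)) (mul (c i) (e j)))"
    proof (rule sum.mono_neutral_left)
      show "finite {(i, j). i + j \<le> m + n}"
        by (rule finite_subset[of _ "{..m + n} \<times> {..m + n}"]) auto
      have "t (z ^ (i + j)) (mul (c i) (e j)) = 0" if "i > m \<or> j > n" for i j
        using that m(1) n(1) by (auto simp: mul_zero)
      then show "\<forall>p\<in>{(i, j). i + j \<le> m + n} - {..m} \<times> {..n}. (case p of (i, j) \<Rightarrow> t (z ^ (i + j)) (mul (c i) (e j))) = 0"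
        by (auto simp del: scale_eq_0_iff) (meson not_le)+
    qed auto
    also have "\<dots> = (\<Sum>k\<le>m + n. \<Sum>i\<le>k. t (z ^ (i + (k - i))) (mul (c i) (e (k - i))))"
      by (rule sum.triangle_reindex_eq)
    finally show ?thesis by (simp add: scale_sum_right)
  qed
  moreover have "(\<Sum>i\<le>k. mul (c i) (e (k - i))) = 0" if "k > m + n" for k
  proof (rule sum.neutral, rule ballI)
    fix i assume "i \<in> {..k}"
    then have "i > m \<or> k - i > n" using that by auto
    then show "mul (c i) (e (k - i)) = 0" using m(1) n(1) by (auto simp: mul_zero)
  qed
  ultimately show ?thesis unfolding has_coefficients_def by blast
qed

lemma polynomial_fun_scale:
  assumes "polynomial_fun s t mul p"
  shows "polynomial_fun s t mul (\<lambda>x. t c (p x))"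
  using assms
proof induction
  case (linear l)
  interpret l: Vector_Spaces.linear s t l by fact
  have "Vector_Spaces.linear s t (\<lambda>x. t c (l x))"
    by (intro linearI' l.vs1.vector_space_axioms vector_space_axioms)
      (auto simp: l.add l.scale scale_right_distrib mult.commute)
  moreover have "continuous_on UNIV (\<lambda>x. t c (l x))"
    using linear(2) by (auto simp: continuous_on_def intro!: tendsto_scale')
  ultimately show ?case by (rule polynomial_fun.linear)
next
  case (add p q)
  then show ?case by (simp add: scale_right_distrib polynomial_fun.add)
next
  case (mul p q)
  then show ?case
    using polynomial_fun.mul[of s t mul "\<lambda>x. t c (p x)" q] by (simp add: mul_scale_left)
qed (rule polynomial_fun.const)

lemma polynomial_fun_along_line:
  assumes "polynomial_fun s t mul p"
  shows "\<exists>c. has_coefficients t (\<lambda>z. p (x + s z v)) c"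
  using assms
proof induction
  case (const b)
  show ?case using has_coefficients_const by blast
next
  case (linear l)
  then interpret l: Vector_Spaces.linear s t l by blast
  show ?case using has_coefficients_linear[of "l x" "l v"] by (auto simp: l.add l.scale)
next
  case (add p q)
  then show ?case using has_coefficients_add by blast
next
  case (mul p q)
  then show ?case using has_coefficients_mul by blast
qed

end

section \<open>Complex extensions of polynomial maps and their uniqueness\<close>

lemma vector_space_complexified_scale:
  assumes "vector_space s"
  shows "vector_space (complexified_scale s)"
proof -
  interpret vector_space s by fact
  show ?thesis
    by unfold_locales
      (auto simp: complexified_scale_def scale_left_distrib scale_right_distrib scale_left_diff_distrib
        scale_right_diff_distrib algebra_simps)
qed

lemma linear_complexified:
  assumes "Vector_Spaces.linear s t l"
  shows "Vector_Spaces.linear (complexified_scale s) (complexified_scale t) (map_prod l l)"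
proof -
  interpret Vector_Spaces.linear s t l by fact
  show ?thesis
    by (intro linearI' vector_space_complexified_scale vs1.vector_space_axioms vs2.vector_space_axioms)
      (auto simp: complexified_scale_def add diff scale)
qed

definition complexified_mul :: "('v::ab_group_add \<Rightarrow> 'v \<Rightarrow> 'v) \<Rightarrow> 'v \<times> 'v \<Rightarrow> 'v \<times> 'v \<Rightarrow> 'v \<times> 'v" where
  "complexified_mul mul = (\<lambda>(a, b) (c, d). (mul a c - mul b d, mul a d + mul b c))"

context topological_algebra
begin

lemma topological_algebra_complexified:
  "topological_algebra (complexified_scale t) (complexified_mul mul)"
proof -
  interpret C: vector_space "complexified_scale t"
    by (intro vector_space_complexified_scale vector_space_axioms)
  show ?thesis
  proof
    show "continuous_on UNIV (\<lambda>(x, y). x + y :: 'v \<times> 'v)"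
      unfolding continuous_on_def case_prod_beta plus_prod_def
      by (intro ballI tendsto_Pair tendsto_add' tendsto_fst tendsto_snd tendsto_ident_at)
    show "continuous_on UNIV (\<lambda>(c, x). complexified_scale t c x)"
      unfolding continuous_on_def case_prod_beta complexified_scale_def
      by (intro ballI tendsto_Pair tendsto_add' tendsto_diff' tendsto_scale' tendsto_of_real tendsto_Re tendsto_Im
          tendsto_fst tendsto_snd tendsto_ident_at)
    show "continuous_on UNIV (\<lambda>(x, y). complexified_mul mul x y)"
      unfolding continuous_on_def case_prod_beta complexified_mul_def
      by (intro ballI tendsto_Pair tendsto_add' tendsto_diff' tendsto_mul tendsto_fst tendsto_snd tendsto_ident_at)
  qed (auto simp: complexified_mul_def complexified_scale_def mul_add_left mul_add_right mul_diff_left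
        mul_diff_right mul_scale_left mul_scale_right scale_right_distrib scale_right_diff_distrib)
qed

lemma polynomial_fun_extension:
  assumes "polynomial_fun s t mul p"
  shows "\<exists>q. polynomial_fun (complexified_scale s) (complexified_scale t) (complexified_mul mul) q \<and>
    (\<forall>x. q (x, 0) = (p x, 0))"
  using assms
proof induction
  case (const b)
  show ?case by (intro exI[of _ "\<lambda>_. (b, 0)"]) (auto intro: polynomial_fun.const)
next
  case (linear l)
  then interpret l: Vector_Spaces.linear s t l by blast
  have "continuous_on UNIV (map_prod l l)"
    unfolding map_prod_def case_prod_beta using linear(2)
    by (intro continuous_on_Pair continuous_on_compose2[OF linear(2)] continuous_on_fst continuous_on_snd continuous_on_id) auto
  then show ?case
    using polynomial_fun.linear[OF linear_complexified[OF linear(1)]]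
    by (intro exI[of _ "map_prod l l"]) auto
next
  case (add p q)
  then obtain p' q' where
    "polynomial_fun (complexified_scale s) (complexified_scale t) (complexified_mul mul) p'" "\<And>x. p' (x, 0) = (p x, 0)"
    "polynomial_fun (complexified_scale s) (complexified_scale t) (complexified_mul mul) q'" "\<And>x. q' (x, 0) = (q x, 0)"
    by blast
  then show ?case
    by (intro exI[of _ "\<lambda>z. p' z + q' z"]) (auto intro: polynomial_fun.add)
next
  case (mul p q)
  then obtain p' q' where
    "polynomial_fun (complexified_scale s) (complexified_scale t) (complexified_mul mul) p'" "\<And>x. p' (x, 0) = (p x, 0)"
    "polynomial_fun (complexified_scale s) (complexified_scale t) (complexified_mul mul) q'" "\<And>x. q' (x, 0) = (q x, 0)"
    by blast
  then show ?case
    by (intro exI[of _ "\<lambda>z. complexified_mul mul (p' z) (q' z)"])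
      (auto simp: complexified_mul_def mul_zero intro!: polynomial_fun.mul[unfolded complexified_mul_def])
qed

text \<open>Identity principle. On the complex line through \<open>(x, 0)\<close> in direction
  \<open>(y, 0)\<close> the polynomial vanishes at every natural parameter, because these points are
  real. All its coefficients are then 0, and the parameter \<open>\<i>\<close> reaches
  \<open>(x, y)\<close>.\<close>

lemma polynomial_fun_complexified_eq_0:
  assumes q: "polynomial_fun (complexified_scale s) (complexified_scale t) (complexified_mul mul) q"
    and s: "vector_space s" and E: "module.subspace s E"
    and zero: "\<And>x. x \<in> E \<Longrightarrow> q (x, 0) = 0" and xy: "x \<in> E" "y \<in> E"
  shows "q (x, y) = 0"
proof -
  interpret s: vector_space s by fact
  interpret C: topological_algebra "complexified_scale t" "complexified_mul mul"
    by (rule topological_algebra_complexified)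
  let ?P = "\<lambda>z. q ((x, 0) + complexified_scale s z (y, 0))"
  obtain c where c: "has_coefficients (complexified_scale t) ?P c"
    using C.polynomial_fun_along_line[OF q] by blast
  have "?P (of_nat n) = 0" for n
    using E xy zero by (simp add: complexified_scale_def s.subspace_add s.subspace_scale)
  then have "c = (\<lambda>i. 0)"
    using C.has_coefficients_unique[OF _ c C.has_coefficients_const[of 0]] by simp
  then have "?P \<i> = 0"
    using c by (auto simp: has_coefficients_def)
  then show ?thesis by (simp add: complexified_scale_def)
qed

end

text \<open>
  Closed subspaces given by equations carry over to the complexification; hence a polynomial
  map into such a subspace has its complex extension in the complexified subspace.
\<close>

definition equation_space ::
    "('k::field \<Rightarrow> 'v::ab_group_add \<Rightarrow> 'v) \<Rightarrow> ('k \<times> 'i) list set \<Rightarrow> ('i \<Rightarrow> 'v) set" where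
  "equation_space t R = {f. \<forall>l\<in>R. (\<Sum>(c, i)\<leftarrow>l. t c (f i)) = 0}"

context topological_vs
begin

lemma vector_space_fun_scale_t: "vector_space (fun_scale t :: 'k \<Rightarrow> ('i \<Rightarrow> 'v) \<Rightarrow> _)"
  by (intro vector_space_fun_scale vector_space_axioms)

lemma subspace_equation_space:
  fixes R :: "('k \<times> 'i) list set"
  shows "module.subspace (fun_scale t) (equation_space t R)"
proof -
  interpret f: vector_space "fun_scale t :: 'k \<Rightarrow> ('i \<Rightarrow> 'v) \<Rightarrow> _" by (rule vector_space_fun_scale_t)
  have add: "(\<Sum>(c, i)\<leftarrow>l. t c (f i + g i)) = (\<Sum>(c, i)\<leftarrow>l. t c (f i)) + (\<Sum>(c, i)\<leftarrow>l. t c (g i))"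
    and scale: "(\<Sum>(c, i)\<leftarrow>l. t (c * d) (f i)) = t d (\<Sum>(c, i)\<leftarrow>l. t c (f i))"
    and zero: "(\<Sum>(c, i)\<leftarrow>l. 0 :: 'v) = 0"
    for l :: "('k \<times> 'i) list" and f g d
    by (induction l) (auto simp: scale_right_distrib mult.commute)
  show ?thesis
    by (rule f.subspaceI) (auto simp: equation_space_def fun_scale_def add scale zero)
qed

lemma closed_equation_space: "closed (equation_space t R)"
proof -
  have "continuous_on UNIV (\<lambda>f. \<Sum>(c, i)\<leftarrow>l. t c (f i))" for l :: "('k \<times> 'i) list"
  proof (induction l)
    case (Cons p l)
    have "continuous_on UNIV (\<lambda>f. t c (f i))" for c and i :: 'i
      unfolding continuous_on_def
      using tendsto_scale'[OF tendsto_const] continuous_on_product_coordinates[of i, unfolded continuous_on_def]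
      by blast
    with Cons show ?case
      by (cases p) (auto simp: continuous_on_def intro!: tendsto_add')
  qed auto
  then have "closed ((\<lambda>f. \<Sum>(c, i)\<leftarrow>l. t c (f i)) -` {0})" for l :: "('k \<times> 'i) list"
    by (intro closed_vimage) auto
  then have "closed (\<Inter>l\<in>R. (\<lambda>f. \<Sum>(c, i)\<leftarrow>l. t c (f i)) -` {0})"
    by blast
  also have "(\<Inter>l\<in>R. (\<lambda>f. \<Sum>(c, i)\<leftarrow>l. t c (f i)) -` {0}) = equation_space t R"
    by (auto simp: equation_space_def)
  finally show ?thesis .
qed

end

lemma subspace_complexified:
  assumes "vector_space s" "module.subspace s E"
  shows "module.subspace (complexified_scale s) (E \<times> E)"
proof -
  interpret s: vector_space s by fact
  interpret C: vector_space "complexified_scale s" using assms(1) by (rule vector_space_complexified_scale)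
  show ?thesis
    using assms(2)
    by (intro C.subspaceI)
      (auto simp: complexified_scale_def zero_prod_def s.subspace_0 s.subspace_add s.subspace_diff s.subspace_scale)
qed

text \<open>Each coordinate is extended separately, so the target is the point at issue. An equation
  of \<open>F\<close>, applied to the extension, is a polynomial that vanishes on the real points of
  \<open>E\<close>, hence on the whole complexification.\<close>

lemma analytic_map_on_polynomial:
  fixes s :: "'k::rc_field \<Rightarrow> 'e::{ab_group_add, t2_space} \<Rightarrow> 'e"
    and t :: "'k \<Rightarrow> 'v::{ab_group_add, t2_space} \<Rightarrow> 'v" and f :: "'e \<Rightarrow> 'i \<Rightarrow> 'v"
  assumes "topological_algebra t mul" and s: "vector_space s" and E: "module.subspace s E"
    and F: "F = equation_space t R"
    and f: "\<And>i. polynomial_fun s t mul (\<lambda>x. f x i)" "f ` E \<subseteq> F"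
  shows "analytic_map_on s E (fun_scale t) F E f"
proof -
  interpret topological_algebra t mul by fact
  interpret s: vector_space s by fact
  interpret C: topological_algebra "complexified_scale t" "complexified_mul mul"
    by (rule topological_algebra_complexified)
  have F_subspace: "module.subspace (fun_scale t) F" and F_closed: "closed F"
    unfolding F by (rule subspace_equation_space closed_equation_space)+
  show ?thesis
  proof (cases "(\<real> :: 'k set) = UNIV")
    case False
    have "smooth_map_on s E (fun_scale t) F E f"
      using f
      by (intro smooth_map_on_polynomial[where \<pi> = "\<lambda>f. f" and J = "\<lambda>f. f"] s E F_subspace F_closed
          linearI' vector_space_fun_scale_t) auto
    with False show ?thesis by (simp add: analytic_map_on_def)
  next
    case True
    obtain q where q: "\<And>i. polynomial_fun (complexified_scale s) (complexified_scale t) (complexified_mul mul) (q i)"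
      "\<And>i x. q i (x, 0) = (f x i, 0)"
      using polynomial_fun_extension[OF f(1)] by metis
    define g where "g z = ((\<lambda>i. fst (q i z)), (\<lambda>i. snd (q i z)))" for z
    let ?J = "\<lambda>h :: 'i \<Rightarrow> 'v \<times> 'v. ((\<lambda>i. fst (h i)), (\<lambda>i. snd (h i)))"
    have g: "g z \<in> F \<times> F" if "z \<in> E \<times> E" for z
    proof -
      have "(\<Sum>(c, i)\<leftarrow>l. t c (fst (q i z))) = 0 \<and> (\<Sum>(c, i)\<leftarrow>l. t c (snd (q i z))) = 0"
        if "l \<in> R" for l
      proof -
        define Q where "Q w = ((\<Sum>(c, i)\<leftarrow>l. t c (fst (q i w))), (\<Sum>(c, i)\<leftarrow>l. t c (snd (q i w))))" for w
        have "polynomial_fun (complexified_scale s) (complexified_scale t) (complexified_mul mul)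
            (\<lambda>w. ((\<Sum>(c, i)\<leftarrow>l. t c (fst (q i w))), (\<Sum>(c, i)\<leftarrow>l. t c (snd (q i w)))))"
        proof (induction l)
          case Nil
          show ?case using polynomial_fun.const[where b = "0 :: 'v \<times> 'v"] by (simp add: zero_prod_def)
        next
          case (Cons p l)
          obtain c i where p: "p = (c, i)" by (cases p)
          \<comment> \<open>Over the reals every coefficient acts on the complexification as a
            complex scalar, so the equation stays a complex linear combination of the
            \<open>q i\<close>.\<close>
          obtain r where r: "c = of_real r" using True by (metis Reals_cases UNIV_I)
          from polynomial_fun.add[OF C.polynomial_fun_scale[OF q(1)[of i], of "of_real r"] Cons]
                    show ?case
            by (simp add: p r complexified_scale_def case_prod_beta)
        qed
        then have "polynomial_fun (complexified_scale s) (complexified_scale t) (complexified_mul mul) Q"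
          by (simp add: Q_def[abs_def])
        moreover have "Q (x, 0) = 0" if "x \<in> E" for x
        proof -
          have "f x \<in> F" using that f(2) by blast
          then have "(\<Sum>(c, i)\<leftarrow>l. t c (f x i)) = 0"
            using \<open>l \<in> R\<close> by (simp add: F equation_space_def)
          moreover have "(\<Sum>(c, i)\<leftarrow>l. 0 :: 'v) = 0"
            by (induction l) auto
          ultimately show ?thesis by (simp add: Q_def q zero_prod_def)
        qed
        ultimately have "Q (x, y) = 0" if "x \<in> E" "y \<in> E" for x y
          using that by (rule polynomial_fun_complexified_eq_0[OF _ s E])
        from this[of "fst z" "snd z"] \<open>z \<in> E \<times> E\<close> have "Q z = 0" by auto
        then show ?thesis by (simp add: Q_def zero_prod_def)
      qed
      then show ?thesis by (auto simp: g_def F equation_space_def)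
    qed
    have J_cont: "continuous_on UNIV ?J"
      by (intro continuous_on_Pair continuous_on_coordinatewise_then_product continuous_on_fst continuous_on_snd
          continuous_on_product_coordinates)
    have "smooth_map_on (complexified_scale s) (E \<times> E) (complexified_scale (fun_scale t)) (F \<times> F) (E \<times> E) g"
    proof (rule C.smooth_map_on_polynomial[where \<pi> = "\<lambda>u i. (fst u i, snd u i)" and J = ?J])
      show "Vector_Spaces.linear (complexified_scale (fun_scale t)) (fun_scale (complexified_scale t))
          (\<lambda>u i. (fst u i, snd u i))"
        by (intro linearI' C.vector_space_fun_scale_t vector_space_complexified_scale vector_space_fun_scale_t)
          (auto simp: complexified_scale_def fun_scale_def fun_eq_iff)
    qed (use g q(1) J_cont in \<open>auto simp: g_def intro!: vector_space_complexified_scale s subspace_complexified E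
        vector_space_fun_scale_t F_subspace closed_Times F_closed\<close>)
    moreover have "\<forall>x\<in>E. (x, 0) \<in> E \<times> E \<and> g (x, 0) = (f x, 0)"
      using s.subspace_0[OF E] by (auto simp: g_def q fun_eq_iff)
    ultimately show ?thesis
      using True unfolding analytic_map_on_def by auto
  qed
qed

section \<open>The convolution algebra\<close>

lemma free_lift_free_lift:
  assumes "vector_space t"
  shows "free_lift t g (free_lift free_scale h u) = free_lift t (\<lambda>p. free_lift t g (h p)) u"
proof -
  interpret Vector_Spaces.linear free_scale t "free_lift t g"
    using assms by (rule linear_free_lift)
  show ?thesis
    by (simp add: free_lift_def[of free_scale] sum scale free_lift_def[of t "\<lambda>p. free_lift t g (h p)"])
qed

lemma free_lift_pure:
  assumes "vector_space t"
  shows "free_lift t g (pure p) = g p"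
  using assms by (simp add: free_lift_def vector_space.vector_space_assms(4))

lemma free_lift_tensor3_eq:
  assumes t: "vector_space t" and eq: "tensor3_eq s u w"
    and 1: "\<And>y z. Vector_Spaces.linear s t (\<lambda>x. \<beta> x y z)"
    and 2: "\<And>x z. Vector_Spaces.linear s t (\<lambda>y. \<beta> x y z)"
    and 3: "\<And>x y. Vector_Spaces.linear s t (\<lambda>z. \<beta> x y z)"
  shows "free_lift t (\<lambda>(x, y, z). \<beta> x y z) u = free_lift t (\<lambda>(x, y, z). \<beta> x y z) w"
proof -
  let ?L = "free_lift t (\<lambda>(x, y, z). \<beta> x y z)"
  interpret L: Vector_Spaces.linear free_scale t ?L
    using t by (rule linear_free_lift)
  have p: "?L (pure (x, y, z)) = \<beta> x y z" for x y z
    by (simp add: free_lift_pure t)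
  have l: "\<beta> (x + x') y z = \<beta> x y z + \<beta> x' y z" "\<beta> (s c x) y z = t c (\<beta> x y z)"
      "\<beta> x (y + y') z = \<beta> x y z + \<beta> x y' z" "\<beta> x (s c y) z = t c (\<beta> x y z)"
      "\<beta> x y (z + z') = \<beta> x y z + \<beta> x y z'" "\<beta> x y (s c z) = t c (\<beta> x y z)" for x x' y y' z z' c
    using 1 2 3 by (simp_all add: Vector_Spaces.linear_iff)
  have "?L r = 0" if "r \<in> tensor3_relations s" for r
    using that by (auto simp: tensor3_relations_def L.diff L.scale p l)
  then have "?L (u - w) = 0"
    using eq L.eq_0_on_span unfolding tensor3_eq_def by blast
  then show ?thesis by (simp add: L.diff)
qed

locale character_setting = graded_connected_hopf_algebra sH \<Delta> \<epsilon> S H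
  for sH :: "'k::rc_field \<Rightarrow> 'h::ring_1 \<Rightarrow> 'h" and \<Delta> \<epsilon> S H +
  fixes sB :: "'k \<Rightarrow> 'b::{comm_ring, comm_monoid_mult, t2_space} \<Rightarrow> 'b"
  assumes algebra_B: "commutative_locally_convex_algebra sB"
begin

sublocale B: topological_algebra sB "(*)"
proof -
  interpret sB: vector_space sB
    using algebra_B by (simp add: commutative_locally_convex_algebra_def locally_convex_space_def)
  have scale: "sB c x * y = sB c (x * y)" for c x y
    using algebra_B by (simp add: commutative_locally_convex_algebra_def)
  have scale': "x * sB c y = sB c (x * y)" for c x y
    by (metis scale mult.commute)
  show "topological_algebra sB (*)"
    using algebra_B
    by unfold_locales
      (auto simp: commutative_locally_convex_algebra_def locally_convex_space_def distrib_left distrib_right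
        scale scale')
qed

lemmas mult_scale = B.mul_scale_left B.mul_scale_right

abbreviation A :: "('h \<Rightarrow> 'b) set" where "A \<equiv> hom_space sH sB"
abbreviation conv (infixl "\<star>" 70) where "conv \<equiv> convolution sB \<Delta>"
abbreviation unit :: "'h \<Rightarrow> 'b" where "unit \<equiv> convolution_one sB \<epsilon>"
abbreviation sA :: "'k \<Rightarrow> ('h \<Rightarrow> 'b) \<Rightarrow> 'h \<Rightarrow> 'b" where "sA \<equiv> fun_scale sB"

sublocale A: vector_space sA
  by (rule B.vector_space_fun_scale_t)

lemma hom_spaceI:
  assumes "\<And>a b. \<phi> (a + b) = \<phi> a + \<phi> b" "\<And>c a. \<phi> (sH c a) = sB c (\<phi> a)"
  shows "\<phi> \<in> A"
  using assms by (simp add: hom_space_def Vector_Spaces.linear_iff vector_space_axioms B.vector_space_axioms)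

lemma hom_space_add: "\<phi> \<in> A \<Longrightarrow> \<phi> (a + b) = \<phi> a + \<phi> b"
  and hom_space_scale: "\<phi> \<in> A \<Longrightarrow> \<phi> (sH c a) = sB c (\<phi> a)"
  by (simp_all add: hom_space_def Vector_Spaces.linear_iff)

lemma hom_space_0: "\<phi> \<in> A \<Longrightarrow> \<phi> 0 = 0"
  using hom_space_scale[of \<phi> 0 0] by simp

lemma hom_space_sum: "\<phi> \<in> A \<Longrightarrow> \<phi> (sum f I) = (\<Sum>i\<in>I. \<phi> (f i))"
  by (induction I rule: infinite_finite_induct) (simp_all add: hom_space_0 hom_space_add)

lemma subspace_hom_space: "A.subspace A"
  by (rule A.subspaceI)
    (auto intro!: hom_spaceI simp: hom_space_add hom_space_scale fun_scale_def B.scale_right_distrib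
      mult.commute add_ac)

lemma conv_eq: "(\<phi> \<star> \<psi>) a = (\<Sum>p\<in>Poly_Mapping.keys (\<Delta> a). sB (Poly_Mapping.lookup (\<Delta> a) p) (\<phi> (fst p) * \<psi> (snd p)))"
  by (simp add: convolution_def free_lift_def case_prod_unfold)

lemma bilinear_mult:
  assumes "\<phi> \<in> A" "\<psi> \<in> A"
  shows "Vector_Spaces.linear sH sB (\<lambda>x. \<phi> x * \<psi> y)" "Vector_Spaces.linear sH sB (\<lambda>y. \<phi> x * \<psi> y)"
  using assms
  by (auto intro!: linearI' vector_space_axioms B.vector_space_axioms
      simp: hom_space_add hom_space_scale mult_scale distrib_left distrib_right)

text \<open>For linear arguments any representative of the coproduct gives the same value. This
  turns the coproduct axioms, which hold modulo the tensor relations, into equations in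
  \<open>B\<close>.\<close>

lemma conv_tensor2_eq:
  assumes "\<phi> \<in> A" "\<psi> \<in> A" "tensor2_eq sH (\<Delta> a) u"
  shows "(\<phi> \<star> \<psi>) a = free_lift sB (\<lambda>(x, y). \<phi> x * \<psi> y) u"
  unfolding convolution_def
  by (rule free_lift_tensor2_eq[OF B.vector_space_axioms assms(3)]) (intro bilinear_mult assms)+

lemma conv_in_hom_space:
  assumes "\<phi> \<in> A" "\<psi> \<in> A"
  shows "\<phi> \<star> \<psi> \<in> A"
proof -
  interpret L: Vector_Spaces.linear free_scale sB "free_lift sB (\<lambda>(x, y). \<phi> x * \<psi> y)"
    by (rule linear_free_lift[OF B.vector_space_axioms])
  show ?thesis
  proof (rule hom_spaceI)
    show "(\<phi> \<star> \<psi>) (a + b) = (\<phi> \<star> \<psi>) a + (\<phi> \<star> \<psi>) b" for a b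
      unfolding conv_tensor2_eq[OF assms coproduct_add] L.add by (simp add: convolution_def)
    show "(\<phi> \<star> \<psi>) (sH c a) = sB c ((\<phi> \<star> \<psi>) a)" for c a
      unfolding conv_tensor2_eq[OF assms coproduct_scale] L.scale by (simp add: convolution_def)
  qed
qed

lemma unit_in_hom_space: "unit \<in> A"
  using counit_linear
  by (auto intro!: hom_spaceI simp: convolution_one_def Vector_Spaces.linear_iff B.scale_left_distrib)

lemma conv_unit_left:
  assumes "\<phi> \<in> A"
  shows "unit \<star> \<phi> = \<phi>"
proof
  fix a
  have "(unit \<star> \<phi>) a = \<phi> (free_lift sH (\<lambda>(x, y). sH (\<epsilon> x) y) (\<Delta> a))"
    using assms
    by (simp add: conv_eq free_lift_def hom_space_sum hom_space_scale convolution_one_def mult_scale case_prod_unfold)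
  then show "(unit \<star> \<phi>) a = \<phi> a" by (simp add: counit_left)
qed

lemma conv_unit_right:
  assumes "\<phi> \<in> A"
  shows "\<phi> \<star> unit = \<phi>"
proof
  fix a
  have "(\<phi> \<star> unit) a = \<phi> (free_lift sH (\<lambda>(x, y). sH (\<epsilon> y) x) (\<Delta> a))"
    using assms
    by (simp add: conv_eq free_lift_def hom_space_sum hom_space_scale convolution_one_def mult_scale case_prod_unfold)
  then show "(\<phi> \<star> unit) a = \<phi> a" by (simp add: counit_right)
qed

lemma free_lift_mult_left: "free_lift sB g u * b = free_lift sB (\<lambda>p. g p * b) u"
  and free_lift_mult_right: "b * free_lift sB g u = free_lift sB (\<lambda>p. b * g p) u"
  by (simp_all add: free_lift_def sum_distrib_left sum_distrib_right mult_scale)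

lemma conv_assoc:
  assumes "\<phi> \<in> A" "\<psi> \<in> A" "\<eta> \<in> A"
  shows "\<phi> \<star> \<psi> \<star> \<eta> = \<phi> \<star> (\<psi> \<star> \<eta>)"
proof
  fix a
  let ?L = "free_lift sB (\<lambda>(x, y, z). \<phi> x * \<psi> y * \<eta> z)"
  note vs = B.vector_space_axioms
  have "(\<phi> \<star> \<psi> \<star> \<eta>) a = ?L (free_lift free_scale
      (\<lambda>(x, y). free_lift free_scale (\<lambda>(x1, x2). pure (x1, x2, y)) (\<Delta> x)) (\<Delta> a))"
    by (simp add: convolution_def free_lift_mult_left free_lift_free_lift[OF vs] case_prod_unfold free_lift_pure[OF vs])
  also have "\<dots> = ?L (free_lift free_scale
      (\<lambda>(x, y). free_lift free_scale (\<lambda>(y1, y2). pure (x, y1, y2)) (\<Delta> y)) (\<Delta> a))"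
    using assms
    by (intro free_lift_tensor3_eq[OF vs coassociative] linearI' vector_space_axioms vs)
      (simp_all add: hom_space_add hom_space_scale mult_scale distrib_left distrib_right)
  also have "\<dots> = (\<phi> \<star> (\<psi> \<star> \<eta>)) a"
    by (simp add: convolution_def free_lift_mult_right free_lift_free_lift[OF vs] case_prod_unfold
        free_lift_pure[OF vs] mult.assoc)
  finally show "(\<phi> \<star> \<psi> \<star> \<eta>) a = (\<phi> \<star> (\<psi> \<star> \<eta>)) a" .
qed

text \<open>These hold for all functions, since the value at \<open>a\<close> is a finite bilinear
  expression in the values of the two factors.\<close>

lemma conv_add_left: "(\<phi> + \<phi>') \<star> \<psi> = \<phi> \<star> \<psi> + \<phi>' \<star> \<psi>"
  and conv_add_right: "\<psi> \<star> (\<phi> + \<phi>') = \<psi> \<star> \<phi> + \<psi> \<star> \<phi>'"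
  and conv_diff_left: "(\<phi> - \<phi>') \<star> \<psi> = \<phi> \<star> \<psi> - \<phi>' \<star> \<psi>"
  and conv_diff_right: "\<psi> \<star> (\<phi> - \<phi>') = \<psi> \<star> \<phi> - \<psi> \<star> \<phi>'"
  and conv_scale_left: "sA c \<phi> \<star> \<psi> = sA c (\<phi> \<star> \<psi>)"
  and conv_scale_right: "\<psi> \<star> sA c \<phi> = sA c (\<psi> \<star> \<phi>)"
  and conv_zero_left: "0 \<star> \<psi> = 0"
  and conv_zero_right: "\<psi> \<star> 0 = 0"
  by (auto simp: fun_eq_iff conv_eq fun_scale_def distrib_left distrib_right left_diff_distrib right_diff_distrib
      B.scale_right_distrib B.scale_right_diff_distrib sum.distrib sum_subtractf mult_scale B.scale_sum_right
      mult.commute)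

lemma conv_mult:
  assumes "\<phi> \<in> A" "\<psi> \<in> A"
  shows "(\<phi> \<star> \<psi>) (a * b) =
    free_lift sB (\<lambda>(x, y). free_lift sB (\<lambda>(x', y'). \<phi> (x * x') * \<psi> (y * y')) (\<Delta> b)) (\<Delta> a)"
  unfolding conv_tensor2_eq[OF assms coproduct_mult]
  by (simp add: free_lift_free_lift[OF B.vector_space_axioms] case_prod_unfold free_lift_pure[OF B.vector_space_axioms])

lemma free_lift_sum: "free_lift sB (\<lambda>p. \<Sum>i\<in>I. g i p) u = (\<Sum>i\<in>I. free_lift sB (g i) u)"
  unfolding free_lift_def B.scale_sum_right by (rule sum.swap)

text \<open>The coproduct is multiplicative, so splittings of both factors over products give one of
  their convolution. Characters use it with one summand each, infinitesimal characters with two,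
  divided powers with several.\<close>

lemma conv_mult_sum:
  assumes "\<phi> \<in> A" "\<psi> \<in> A"
    and \<phi>: "\<And>x y. \<phi> (x * y) = (\<Sum>i\<in>I. \<alpha> i x * \<beta> i y)"
    and \<psi>: "\<And>x y. \<psi> (x * y) = (\<Sum>j\<in>J. \<gamma> j x * \<delta> j y)"
  shows "(\<phi> \<star> \<psi>) (a * b) = (\<Sum>i\<in>I. \<Sum>j\<in>J. (\<alpha> i \<star> \<gamma> j) a * (\<beta> i \<star> \<delta> j) b)"
proof -
  have "(\<alpha> i \<star> \<gamma> j) a * (\<beta> i \<star> \<delta> j) b = free_lift sB (\<lambda>p. free_lift sB
      (\<lambda>q. \<alpha> i (fst p) * \<beta> i (fst q) * (\<gamma> j (snd p) * \<delta> j (snd q))) (\<Delta> b)) (\<Delta> a)" for i j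
    unfolding convolution_def free_lift_mult_left
    unfolding free_lift_mult_right
    \<comment> \<open>Commutativity of \<open>B\<close> interchanges the two middle factors.\<close>
    by (simp add: case_prod_unfold mult_ac)
  then show ?thesis
    unfolding conv_mult[OF assms(1,2)] \<phi> \<psi>
    by (simp add: sum_product free_lift_sum case_prod_unfold)
qed

subsection \<open>Powers and local nilpotency\<close>

primrec cpow :: "('h \<Rightarrow> 'b) \<Rightarrow> nat \<Rightarrow> 'h \<Rightarrow> 'b" where
  "cpow \<phi> 0 = unit"
| "cpow \<phi> (Suc k) = \<phi> \<star> cpow \<phi> k"

lemma cpow_in_hom_space: "\<phi> \<in> A \<Longrightarrow> cpow \<phi> k \<in> A"
  by (induction k) (auto intro: unit_in_hom_space conv_in_hom_space)

lemma cpow_1: "\<phi> \<in> A \<Longrightarrow> cpow \<phi> 1 = \<phi>"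
  by (simp add: conv_unit_right)

lemma cpow_add: "\<phi> \<in> A \<Longrightarrow> cpow \<phi> (i + j) = cpow \<phi> i \<star> cpow \<phi> j"
  by (induction i) (simp_all add: conv_unit_left conv_assoc cpow_in_hom_space)

lemma cpow_scale: "cpow (sA c \<phi>) k = sA (c ^ k) (cpow \<phi> k)"
  by (induction k) (simp_all add: conv_scale_left conv_scale_right mult.commute)

abbreviation aug :: "('h \<Rightarrow> 'b) set" where "aug \<equiv> augmentation_space sH sB"

text \<open>Connectedness in usable form: a linear functional that vanishes at \<open>1\<close>
  vanishes on all of degree 0.\<close>

lemma component_0: assumes "a \<in> H 0" obtains c where "a = sH c 1"
proof -
  obtain C where C: "C \<subseteq> H 0" "H 0 \<subseteq> span C" "card C = dim (H 0)"
    using basis_exists by metis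
  then obtain b where b: "C = {b}" using connected card_1_singletonE by metis
  obtain r where r: "1 = sH r b" using C one_degree unfolding b span_singleton by auto
  obtain q where q: "a = sH q b" using C assms unfolding b span_singleton by auto
  have "r \<noteq> 0" using r by auto
  then have "a = sH (q / r) 1" by (simp add: q r)
  then show ?thesis by (rule that)
qed

text \<open>A term of the coproduct of \<open>a\<close> has degrees \<open>i + j = n\<close>. If
  \<open>i = 0\<close>, the first tensor factor is killed by \<open>\<phi>\<close>; otherwise
  \<open>j < n \<le> k\<close> in the step from \<open>k\<close> to \<open>Suc k\<close>, and the
  induction hypothesis kills the second.\<close>

lemma cpow_vanishes:
  assumes \<phi>: "\<phi> \<in> aug"
  shows "a \<in> H n \<Longrightarrow> n < k \<Longrightarrow> cpow \<phi> k a = 0"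
proof (induction k arbitrary: a n)
  case (Suc k)
  have hom: "\<phi> \<in> A" "cpow \<phi> k \<in> A"
    using \<phi> cpow_in_hom_space by (auto simp: augmentation_space_def)
  obtain u where u: "u \<in> module.span free_scale {pure (x, y) | x y i j. x \<in> H i \<and> y \<in> H j \<and> i + j = n}"
    "tensor2_eq sH (\<Delta> a) u"
    using coproduct_degree[OF Suc.prems(1)] by blast
  interpret L: Vector_Spaces.linear free_scale sB "free_lift sB (\<lambda>(x, y). \<phi> x * cpow \<phi> k y)"
    by (rule linear_free_lift[OF B.vector_space_axioms])
  have "\<phi> x * cpow \<phi> k y = 0" if "x \<in> H i" "y \<in> H j" "i + j = n" for x y i j
  proof (cases i)
    case 0
    with that(1) obtain c where "x = sH c 1" using component_0 by blast
    then show ?thesis using \<phi> hom by (simp add: augmentation_space_def hom_space_scale)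
  next
    case (Suc i')
    then have "cpow \<phi> k y = 0" using Suc.IH[OF that(2)] Suc.prems(2) that(3) by simp
    then show ?thesis by simp
  qed
  then have "free_lift sB (\<lambda>(x, y). \<phi> x * cpow \<phi> k y) u = 0"
    by (intro L.eq_0_on_span[OF _ u(1)]) (auto simp: free_lift_pure B.vector_space_axioms)
  then show ?case
    using conv_tensor2_eq[OF hom u(2)] by simp
qed simp

text \<open>The bound comes from the degrees occurring in \<open>a\<close> and works for all of
  \<open>aug\<close>. It is kept at least 2 because the terms of order 1 and 2 are read off later,
  even at elements of low degree.\<close>

lemma nilpotency_bound_exists: "\<exists>N\<ge>2. \<forall>\<phi>\<in>aug. \<forall>k>N. cpow \<phi> k a = 0"
proof -
  obtain f where f: "\<And>n. f n \<in> H n" "finite {n. f n \<noteq> 0}" "a = (\<Sum>n | f n \<noteq> 0. f n)"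
    using direct_sum by metis
  obtain N where N: "\<And>n. f n \<noteq> 0 \<Longrightarrow> n \<le> N"
    using f(2) unfolding finite_nat_set_iff_bounded_le by blast
  have "cpow \<phi> k a = 0" if "\<phi> \<in> aug" "k > max 2 N" for \<phi> k
  proof -
    have "cpow \<phi> k \<in> A" using that cpow_in_hom_space by (auto simp: augmentation_space_def)
    then have "cpow \<phi> k a = (\<Sum>n | f n \<noteq> 0. cpow \<phi> k (f n))"
      using f(3) hom_space_sum by metis
    also have "\<dots> = 0"
      using that(2) N by (intro sum.neutral ballI cpow_vanishes[OF that(1) f(1)]) fastforce
    finally show ?thesis .
  qed
  then show ?thesis by (intro exI[of _ "max 2 N"]) auto
qed

definition nilpotency_bound :: "'h \<Rightarrow> nat" where
  "nilpotency_bound a = (SOME N. N \<ge> 2 \<and> (\<forall>\<phi>\<in>aug. \<forall>k>N. cpow \<phi> k a = 0))"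

lemma nilpotency_bound: "nilpotency_bound a \<ge> 2" "\<phi> \<in> aug \<Longrightarrow> k > nilpotency_bound a \<Longrightarrow> cpow \<phi> k a = 0"
  using someI_ex[OF nilpotency_bound_exists[of a]] unfolding nilpotency_bound_def by auto

end

lemma sum_square_eq_triangle:
  fixes g :: "nat \<Rightarrow> nat \<Rightarrow> 'a::comm_monoid_add"
  assumes "\<And>i j. i \<le> M \<Longrightarrow> j \<le> M \<Longrightarrow> i + j > M \<Longrightarrow> g i j = 0"
  shows "(\<Sum>i\<le>M. \<Sum>j\<le>M. g i j) = (\<Sum>k\<le>M. \<Sum>i\<le>k. g i (k - i))"
proof -
  have "(\<Sum>i\<le>M. \<Sum>j\<le>M. g i j) = (\<Sum>(i, j)\<in>{..M} \<times> {..M}. g i j)"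
    by (simp add: sum.cartesian_product)
  also have "\<dots> = (\<Sum>(i, j)\<in>{(i, j). i + j \<le> M}. g i j)"
    using assms by (intro sum.mono_neutral_right) (auto, meson not_le)
  also have "\<dots> = (\<Sum>k\<le>M. \<Sum>i\<le>k. g i (k - i))"
    by (rule sum.triangle_reindex_eq)
  finally show ?thesis .
qed

lemma sum_fun_eval: "(\<Sum>i\<in>I. f i) x = (\<Sum>i\<in>I. f i x)"
  by (induction I rule: infinite_finite_induct) auto

context character_setting
begin

subsection \<open>Power series in the convolution algebra\<close>

lemma aug_in_hom_space: "\<phi> \<in> aug \<Longrightarrow> \<phi> \<in> A"
  by (simp add: augmentation_space_def)

lemma subspace_aug: "A.subspace aug"
  using subspace_hom_space
  by (auto simp: augmentation_space_def A.subspace_def fun_scale_def)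

lemma cpow_eval_one: "\<phi> \<in> aug \<Longrightarrow> k > 0 \<Longrightarrow> cpow \<phi> k 1 = 0"
  by (rule cpow_vanishes[OF _ one_degree])

lemma unit_eval_one: "unit 1 = 1"
  by (simp add: convolution_one_def counit_one)

text \<open>Well-behaved for \<open>\<phi> \<in> aug\<close> only, where the powers vanish beyond the bound.\<close>

definition cseries :: "'k fps \<Rightarrow> ('h \<Rightarrow> 'b) \<Rightarrow> 'h \<Rightarrow> 'b" where
  "cseries F \<phi> a = (\<Sum>k\<le>nilpotency_bound a. sB (fps_nth F k) (cpow \<phi> k a))"

text \<open>Cutoffs differ from element to element. Raising them to a common one makes values at
  several elements comparable term by term.\<close>

lemma cseries_eq:
  assumes "\<phi> \<in> aug" "nilpotency_bound a \<le> N"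
  shows "cseries F \<phi> a = (\<Sum>k\<le>N. sB (fps_nth F k) (cpow \<phi> k a))"
  unfolding cseries_def using assms nilpotency_bound(2)[of \<phi> a]
  by (intro sum.mono_neutral_left) auto

lemma cseries_in_hom_space:
  assumes "\<phi> \<in> aug"
  shows "cseries F \<phi> \<in> A"
proof (rule hom_spaceI)
  fix a b c
  have hom: "cpow \<phi> k \<in> A" for k
    using assms aug_in_hom_space cpow_in_hom_space by blast
  define N where "N = Max {nilpotency_bound a, nilpotency_bound b, nilpotency_bound (a + b), nilpotency_bound (sH c a)}"
  have N: "nilpotency_bound a \<le> N" "nilpotency_bound b \<le> N" "nilpotency_bound (a + b) \<le> N"
    "nilpotency_bound (sH c a) \<le> N"
    by (simp_all add: N_def)
  show "cseries F \<phi> (a + b) = cseries F \<phi> a + cseries F \<phi> b"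
    by (simp add: cseries_eq[OF assms N(1)] cseries_eq[OF assms N(2)] cseries_eq[OF assms N(3)]
        hom_space_add[OF hom] B.scale_right_distrib sum.distrib)
  show "cseries F \<phi> (sH c a) = sB c (cseries F \<phi> a)"
    by (simp add: cseries_eq[OF assms N(1)] cseries_eq[OF assms N(4)]
        hom_space_scale[OF hom] B.scale_sum_right mult.commute)
qed

lemma cseries_eval_one: "\<phi> \<in> aug \<Longrightarrow> cseries F \<phi> 1 = sB (fps_nth F 0) 1"
  by (simp add: cseries_def cpow_eval_one unit_eval_one sum.atMost_shift del: cpow.simps(2))

lemma cseries_in_aug: "\<phi> \<in> aug \<Longrightarrow> fps_nth F 0 = 0 \<Longrightarrow> cseries F \<phi> \<in> aug"
  by (simp add: augmentation_space_def[of sH sB] cseries_in_hom_space cseries_eval_one)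

lemma conv_cong:
  assumes "\<And>p. p \<in> Poly_Mapping.keys (\<Delta> a) \<Longrightarrow> \<phi> (fst p) = \<phi>' (fst p) \<and> \<psi> (snd p) = \<psi>' (snd p)"
  shows "(\<phi> \<star> \<psi>) a = (\<phi>' \<star> \<psi>') a"
  using assms by (simp add: conv_eq)

lemma conv_sum_left: "(\<Sum>i\<in>I. f i) \<star> \<psi> = (\<Sum>i\<in>I. f i \<star> \<psi>)"
  and conv_sum_right: "\<psi> \<star> (\<Sum>i\<in>I. f i) = (\<Sum>i\<in>I. \<psi> \<star> f i)"
  by (induction I rule: infinite_finite_induct)
    (simp_all add: conv_zero_left conv_zero_right conv_add_left conv_add_right)

lemma cseries_mult:
  assumes \<phi>: "\<phi> \<in> aug"
  shows "cseries F \<phi> \<star> cseries G \<phi> = cseries (F * G) \<phi>"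
proof
  fix a
  have hom: "\<phi> \<in> A" using \<phi> by (rule aug_in_hom_space)
  let ?D = "Poly_Mapping.keys (\<Delta> a)"
  let ?b = nilpotency_bound
  \<comment> \<open>\<open>M\<close> dominates the cutoffs at \<open>a\<close> and at every tensor
    factor in the representative of its coproduct, so both series may be replaced by sums with the
    same range.\<close>
  define M where "M = Max (insert (?b a) (?b ` (fst ` ?D \<union> snd ` ?D)))"
  have M: "?b a \<le> M" "\<And>p. p \<in> ?D \<Longrightarrow> ?b (fst p) \<le> M \<and> ?b (snd p) \<le> M"
    by (auto simp: M_def intro!: Max_ge)
  define trunc where "trunc F = (\<Sum>k\<le>M. sA (fps_nth F k) (cpow \<phi> k))" for F
  have trunc: "cseries F \<phi> x = trunc F x" if "?b x \<le> M" for F x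
    using that \<phi> by (simp add: trunc_def cseries_eq fun_scale_def sum_fun_eval)
  have trunc_conv: "trunc F \<star> trunc G = (\<Sum>i\<le>M. \<Sum>j\<le>M. sA (fps_nth F i * fps_nth G j) (cpow \<phi> (i + j)))"
    unfolding trunc_def conv_sum_left
    unfolding conv_sum_right by (simp add: conv_scale_left conv_scale_right cpow_add hom mult.commute)
  have "(cseries F \<phi> \<star> cseries G \<phi>) a = (trunc F \<star> trunc G) a"
    using M(2) by (intro conv_cong) (auto simp: trunc)
  also have "\<dots> = (\<Sum>i\<le>M. \<Sum>j\<le>M. sB (fps_nth F i * fps_nth G j) (cpow \<phi> (i + j) a))"
    by (simp add: trunc_conv sum_fun_eval) (simp add: fun_scale_def)
  also have "\<dots> = (\<Sum>k\<le>M. \<Sum>i\<le>k. sB (fps_nth F i * fps_nth G (k - i)) (cpow \<phi> (i + (k - i)) a))"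
    using M(1) nilpotency_bound(2)[OF \<phi>, of a] by (intro sum_square_eq_triangle) auto
  also have "\<dots> = cseries (F * G) \<phi> a"
    by (simp add: cseries_eq[OF \<phi> M(1)] fps_mult_nth B.scale_sum_left atLeast0AtMost)
  finally show "(cseries F \<phi> \<star> cseries G \<phi>) a = cseries (F * G) \<phi> a" .
qed

lemma cseries_1: "cseries 1 \<phi> = unit"
  by (simp add: fun_eq_iff cseries_def sum.atMost_shift)

lemma cseries_X:
  assumes "\<phi> \<in> aug"
  shows "cseries fps_X \<phi> = \<phi>"
proof
  fix a
  obtain n where n: "nilpotency_bound a = Suc (Suc n)"
    using nilpotency_bound(1)[of a] by (metis Suc_le_D numeral_2_eq_2 Suc_le_mono)
  show "cseries fps_X \<phi> a = \<phi> a"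
    using cpow_1[OF aug_in_hom_space[OF assms]]
    by (simp add: cseries_def n sum.atMost_Suc_shift fps_X_def
        del: sum.atMost_Suc cpow.simps(2))
qed

lemma cseries_diff: "cseries (F - G) \<phi> = cseries F \<phi> - cseries G \<phi>"
  by (simp add: fun_eq_iff cseries_def B.scale_left_diff_distrib sum_subtractf)

lemma cpow_cseries: "\<phi> \<in> aug \<Longrightarrow> cpow (cseries F \<phi>) n = cseries (F ^ n) \<phi>"
  by (induction n) (simp_all add: cseries_1 cseries_mult)

lemma cseries_compose:
  assumes \<phi>: "\<phi> \<in> aug" and F: "fps_nth F 0 = 0"
  shows "cseries G (cseries F \<phi>) = cseries (G oo F) \<phi>"
proof
  fix a
  let ?M = "nilpotency_bound a"
  have "cseries G (cseries F \<phi>) a = (\<Sum>k\<le>?M. sB (fps_nth G k) (\<Sum>j\<le>?M. sB (fps_nth (F ^ k) j) (cpow \<phi> j a)))"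
    by (simp add: cseries_def[of G] cpow_cseries[OF \<phi>]) (simp add: cseries_def)
  also have "\<dots> = (\<Sum>j\<le>?M. sB (\<Sum>k\<le>?M. fps_nth G k * fps_nth (F ^ k) j) (cpow \<phi> j a))"
    unfolding B.scale_sum_right B.scale_sum_left by (subst sum.swap) simp
  also have "\<dots> = (\<Sum>j\<le>?M. sB (\<Sum>k\<le>j. fps_nth G k * fps_nth (F ^ k) j) (cpow \<phi> j a))"
  proof (intro sum.cong refl)
    fix j assume "j \<in> {..?M}"
    \<comment> \<open>\<open>F ^ k\<close> starts in order \<open>k\<close>, so its coefficient of
      order \<open>j\<close> vanishes for \<open>k > j\<close>.\<close>
    then have "(\<Sum>k\<le>?M. fps_nth G k * fps_nth (F ^ k) j) = (\<Sum>k\<le>j. fps_nth G k * fps_nth (F ^ k) j)"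
      using startsby_zero_power_prefix[OF F] by (intro sum.mono_neutral_right) auto
    then show "sB (\<Sum>k\<le>?M. fps_nth G k * fps_nth (F ^ k) j) (cpow \<phi> j a)
        = sB (\<Sum>k\<le>j. fps_nth G k * fps_nth (F ^ k) j) (cpow \<phi> j a)" by simp
  qed
  also have "\<dots> = cseries (G oo F) \<phi> a"
    by (simp add: cseries_def fps_compose_nth atLeast0AtMost)
  finally show "cseries G (cseries F \<phi>) a = cseries (G oo F) \<phi> a" .
qed

section \<open>Exponential and logarithm\<close>

definition cexp :: "('h \<Rightarrow> 'b) \<Rightarrow> 'h \<Rightarrow> 'b" where
  "cexp = cseries (fps_exp 1)"

text \<open>\<open>fps_ln 1\<close> is the series of log (1 + X), hence the shift by
  \<open>unit\<close>; its constant term 0 puts the value into \<open>aug\<close> for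
  \<open>\<phi>\<close> in \<open>aff\<close>.\<close>

definition clog :: "('h \<Rightarrow> 'b) \<Rightarrow> 'h \<Rightarrow> 'b" where
  "clog \<phi> = cseries (fps_ln 1) (\<phi> - unit)"

abbreviation aff :: "('h \<Rightarrow> 'b) set" where "aff \<equiv> affine_space sH sB"

lemma diff_unit_in_aug: "\<phi> - unit \<in> aug \<longleftrightarrow> \<phi> \<in> aff"
proof
  assume "\<phi> - unit \<in> aug"
  then have "\<phi> - unit \<in> A" "\<phi> 1 = 1"
    using unit_eval_one by (auto simp: augmentation_space_def)
  with A.subspace_add[OF subspace_hom_space this(1) unit_in_hom_space]
  have "\<phi> \<in> A" "\<phi> 1 = 1" by (simp_all only: diff_add_cancel)
  then show "\<phi> \<in> aff" by (simp add: affine_space_def)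
next
  assume "\<phi> \<in> aff"
  then show "\<phi> - unit \<in> aug"
    using A.subspace_diff[OF subspace_hom_space _ unit_in_hom_space] unit_eval_one
    by (auto simp: augmentation_space_def affine_space_def)
qed

lemma cexp_diff_unit: "cexp \<eta> - unit = cseries (fps_exp 1 - 1) \<eta>"
  by (simp add: cexp_def cseries_diff cseries_1)

lemma cexp_in_aff: "\<eta> \<in> aug \<Longrightarrow> cexp \<eta> \<in> aff"
  by (simp flip: diff_unit_in_aug add: cexp_diff_unit cseries_in_aug)

lemma clog_in_aug: "\<phi> \<in> aff \<Longrightarrow> clog \<phi> \<in> aug"
  by (simp add: clog_def cseries_in_aug diff_unit_in_aug)

text \<open>Both inversion formulas hold for the formal power series log (1 + X) and exp X - 1 and
  are transported by \<open>cseries_compose\<close>.\<close>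

lemma clog_cexp:
  assumes "\<eta> \<in> aug"
  shows "clog (cexp \<eta>) = \<eta>"
proof -
  have "fps_ln 1 oo (fps_exp 1 - 1) = (fps_X :: 'k fps)"
    by (simp add: fps_ln_fps_exp_inv fps_inv_fps_exp_compose)
  then show ?thesis
    by (simp add: clog_def cexp_diff_unit cseries_compose assms cseries_X)
qed

lemma cexp_clog:
  assumes "\<phi> \<in> aff"
  shows "cexp (clog \<phi>) = \<phi>"
proof -
  have "(fps_exp 1 - 1) oo fps_ln 1 = (fps_X :: 'k fps)"
    by (simp add: fps_ln_fps_exp_inv fps_inv_fps_exp_compose)
  then have "cexp (clog \<phi>) - unit = \<phi> - unit"
    using assms diff_unit_in_aug by (simp add: clog_def cexp_diff_unit cseries_compose cseries_X)
  then show ?thesis by simp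
qed

lemma cexp_scale: "cexp (sA c \<eta>) = cseries (fps_exp c) \<eta>"
  unfolding fun_eq_iff cexp_def cseries_def cpow_scale by (simp add: fun_scale_def)

lemma cexp_add_scale:
  assumes "\<eta> \<in> aug"
  shows "cexp (sA c \<eta>) \<star> cexp (sA d \<eta>) = cexp (sA (c + d) \<eta>)"
  by (simp add: cexp_scale cseries_mult assms fps_exp_add_mult)

lemma cexp_zero: "cexp 0 = unit"
  using cexp_scale[of 0 0] by (simp add: cseries_1)

lemma cexp_minus:
  assumes "\<eta> \<in> aug"
  shows "cexp (- \<eta>) \<star> cexp \<eta> = unit" "cexp \<eta> \<star> cexp (- \<eta>) = unit"
  using cexp_add_scale[OF assms, of "- 1" 1] cexp_add_scale[OF assms, of 1 "- 1"]
  by (simp_all add: cexp_zero)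

subsection \<open>Characters and infinitesimal characters\<close>

abbreviation char :: "('h \<Rightarrow> 'b) set" where "char \<equiv> characters sH sB"
abbreviation infchar :: "('h \<Rightarrow> 'b) set" where "infchar \<equiv> infinitesimal_characters sH \<epsilon> sB"

lemma char_subset_aff: "char \<subseteq> aff"
  by (auto simp: characters_def affine_space_def)

lemma infchar_mult:
  assumes "\<eta> \<in> infchar"
  shows "\<eta> (a * b) = unit a * \<eta> b + \<eta> a * unit b"
  using assms by (simp add: infinitesimal_characters_def convolution_one_def mult_scale)

lemma infchar_subset_aug: "infchar \<subseteq> aug"
proof
  fix \<eta> assume *: "\<eta> \<in> infchar"
  from infchar_mult[OF this, of 1 1] have "\<eta> 1 = \<eta> 1 + \<eta> 1"
    by (simp add: unit_eval_one)
  with * show "\<eta> \<in> aug"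
    by (simp add: infinitesimal_characters_def augmentation_space_def)
qed

lemma unit_in_char: "unit \<in> char"
  by (simp add: characters_def unit_in_hom_space unit_eval_one)
    (simp add: convolution_one_def counit_mult mult_scale)

lemma conv_eval_one:
  assumes "\<phi> \<in> A" "\<psi> \<in> A"
  shows "(\<phi> \<star> \<psi>) 1 = \<phi> 1 * \<psi> 1"
  using conv_tensor2_eq[OF assms coproduct_one] by (simp add: free_lift_pure B.vector_space_axioms)

lemma conv_in_char:
  assumes "\<phi> \<in> char" "\<psi> \<in> char"
  shows "\<phi> \<star> \<psi> \<in> char"
proof -
  have hom: "\<phi> \<in> A" "\<psi> \<in> A"
    using assms by (auto simp: characters_def)
  have "(\<phi> \<star> \<psi>) (a * b) = (\<phi> \<star> \<psi>) a * (\<phi> \<star> \<psi>) b" for a b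
    using conv_mult_sum[OF hom, where I = "{0::nat}" and \<alpha> = "\<lambda>_. \<phi>" and \<beta> = "\<lambda>_. \<phi>"
        and J = "{0::nat}" and \<gamma> = "\<lambda>_. \<psi>" and \<delta> = "\<lambda>_. \<psi>" and a = a and b = b] assms
    by (simp add: characters_def)
  then show ?thesis
    using assms hom by (simp add: characters_def conv_in_hom_space conv_eval_one)
qed

lemma cpow_in_char: "\<phi> \<in> char \<Longrightarrow> cpow \<phi> n \<in> char"
  by (induction n) (simp_all add: unit_in_char conv_in_char)

text \<open>Over products \<open>\<eta>\<close> splits as \<open>unit\<close> times
  \<open>\<eta>\<close> plus \<open>\<eta>\<close> times \<open>unit\<close>. Convolution by
  \<open>\<eta>\<close> therefore acts on a splitting of \<open>\<psi>\<close> by the Leibniz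
  rule.\<close>

lemma conv_infchar_mult:
  assumes "\<eta> \<in> infchar" "\<psi> \<in> A" "\<And>x y. \<psi> (x * y) = (\<Sum>j\<in>J. \<gamma> j x * \<delta> j y)"
    and "\<And>j. j \<in> J \<Longrightarrow> \<gamma> j \<in> A" "\<And>j. j \<in> J \<Longrightarrow> \<delta> j \<in> A"
  shows "(\<eta> \<star> \<psi>) (a * b) = (\<Sum>j\<in>J. \<gamma> j a * (\<eta> \<star> \<delta> j) b + (\<eta> \<star> \<gamma> j) a * \<delta> j b)"
proof -
  have "\<eta> \<in> A" using assms(1) by (simp add: infinitesimal_characters_def)
  \<comment> \<open>The booleans index the two summands.\<close>
  have "\<eta> (x * y) = (\<Sum>i\<in>UNIV. (if i then unit else \<eta>) x * (if i then \<eta> else unit) y)" for x y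
    by (simp add: infchar_mult[OF assms(1)] UNIV_bool add.commute)
  from conv_mult_sum[OF \<open>\<eta> \<in> A\<close> assms(2) this assms(3), of a b] assms(4,5)
  show ?thesis
    by (simp add: UNIV_bool conv_unit_left sum.distrib add.commute)
qed

text \<open>The powers divided by factorials form a sequence of divided powers, as for any primitive
  element. The induction compares \<open>Suc k\<close> times both sides, because that multiple of
  the next divided power is the convolution of \<open>\<eta>\<close> with the present one.\<close>

lemma cpow_infchar_mult:
  assumes "\<eta> \<in> infchar"
  shows "sB (1 / fact k) (cpow \<eta> k (a * b)) =
    (\<Sum>i\<le>k. sB (1 / fact i) (cpow \<eta> i a) * sB (1 / fact (k - i)) (cpow \<eta> (k - i) b))"
proof -
  define e where "e k = sA (1 / fact k) (cpow \<eta> k)" for k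
  have hom: "\<eta> \<in> A" "e k \<in> A" for k
    using assms A.subspace_scale[OF subspace_hom_space cpow_in_hom_space]
    by (auto simp: e_def infinitesimal_characters_def)
  have conv_e: "\<eta> \<star> e k = sA (of_nat (Suc k)) (e (Suc k))" for k
    by (simp add: e_def conv_scale_right del: of_nat_Suc)
  have e_0: "e 0 = unit" by (simp add: e_def)
  have "e k (x * y) = (\<Sum>i\<le>k. e i x * e (k - i) y)" for x y
  proof (induction k arbitrary: x y)
    case 0
    show ?case using unit_in_char by (simp add: e_0 characters_def)
  next
    case (Suc k)
    define t where "t i = e i x * e (Suc k - i) y" for i
    have "sB (of_nat (Suc k)) (e (Suc k) (x * y)) = (\<eta> \<star> e k) (x * y)"
      by (simp add: conv_e fun_scale_def)
    also have "\<dots> = (\<Sum>i\<le>k. e i x * (\<eta> \<star> e (k - i)) y + (\<eta> \<star> e i) x * e (k - i) y)"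
      by (rule conv_infchar_mult[OF assms hom(2) Suc.IH hom(2) hom(2)])
    also have "\<dots> = (\<Sum>i\<le>k. sB (of_nat (Suc k - i)) (t i)) + (\<Sum>i\<le>k. sB (of_nat (Suc i)) (t (Suc i)))"
      by (simp add: t_def conv_e fun_scale_def mult_scale sum.distrib Suc_diff_le del: of_nat_Suc)
    \<comment> \<open>The terms added at \<open>i = Suc k\<close> in the first sum and at
      \<open>i = 0\<close> in the second have weight 0; the two weights of each \<open>t i\<close>
      now add up to \<open>Suc k\<close>.\<close>
    also have "\<dots> = (\<Sum>i\<le>Suc k. sB (of_nat (Suc k - i)) (t i)) + (\<Sum>i\<le>Suc k. sB (of_nat i) (t i))"
      by (subst (2) sum.atMost_Suc_shift) (simp del: of_nat_Suc)
    also have "\<dots> = (\<Sum>i\<le>Suc k. sB (of_nat (Suc k)) (t i))"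
      unfolding sum.distrib[symmetric]
      by (intro sum.cong refl) (simp flip: B.scale_left_distrib of_nat_add del: of_nat_Suc)
    also have "\<dots> = sB (of_nat (Suc k)) (\<Sum>i\<le>Suc k. t i)"
      by (simp only: B.scale_sum_right)
    finally show ?case
      by (simp add: t_def del: of_nat_Suc sum.atMost_Suc)
  qed
  from this[of a b] show ?thesis by (simp add: e_def fun_scale_def)
qed

lemma cexp_in_char:
  assumes \<eta>: "\<eta> \<in> infchar"
  shows "cexp \<eta> \<in> char"
proof -
  have aug: "\<eta> \<in> aug" using \<eta> infchar_subset_aug by blast
  have "cexp \<eta> (a * b) = cexp \<eta> a * cexp \<eta> b" for a b
  proof -
    let ?b = nilpotency_bound
    \<comment> \<open>If \<open>i + j\<close> exceeds \<open>M\<close>, one of the two powers is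
      beyond its own cutoff, so the product of the two sums reduces to a triangle.\<close>
    define M where "M = Max {?b a + ?b b, ?b (a * b)}"
    have M: "?b a + ?b b \<le> M" "?b a \<le> M" "?b b \<le> M" "?b (a * b) \<le> M"
      by (simp_all add: M_def)
    have "sB (1 / fact i) (cpow \<eta> i a) * sB (1 / fact j) (cpow \<eta> j b) = 0" if "i + j > M" for i j
    proof -
      have "i > ?b a \<or> j > ?b b" using that M(1) by linarith
      then show ?thesis using nilpotency_bound(2)[OF aug] by auto
    qed
    then have "(\<Sum>i\<le>M. \<Sum>j\<le>M. sB (1 / fact i) (cpow \<eta> i a) * sB (1 / fact j) (cpow \<eta> j b)) =
        (\<Sum>k\<le>M. \<Sum>i\<le>k. sB (1 / fact i) (cpow \<eta> i a) * sB (1 / fact (k - i)) (cpow \<eta> (k - i) b))"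
      by (intro sum_square_eq_triangle) auto
    then show ?thesis
      unfolding cexp_def cseries_eq[OF aug M(2)] cseries_eq[OF aug M(3)] cseries_eq[OF aug M(4)]
      by (simp add: sum_product cpow_infchar_mult[OF \<eta>])
  qed
  then show ?thesis
    using cexp_in_aff[OF aug] by (simp add: characters_def affine_space_def)
qed

lemma has_coefficients_cexp:
  assumes "\<eta> \<in> aug"
  shows "has_coefficients sB (\<lambda>z. cexp (sA z \<eta>) a) (\<lambda>k. sB (1 / fact k) (cpow \<eta> k a))"
  unfolding has_coefficients_def cexp_scale cseries_def
  using nilpotency_bound(2)[OF assms, of a]
  by (intro exI[of _ "nilpotency_bound a"]) auto

text \<open>
  For a character \<open>\<phi> = exp \<eta>\<close>, multiplicativity of \<open>exp (n\<eta>) = \<phi>\<^sup>n\<close> for all natural numbers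
  \<open>n\<close> is an identity between polynomials in \<open>n\<close>; the linear coefficients show that \<open>\<eta>\<close>
  is an infinitesimal character.
\<close>

lemma clog_in_infchar:
  assumes "\<phi> \<in> char"
  shows "clog \<phi> \<in> infchar"
proof -
  have aff: "\<phi> \<in> aff" using assms char_subset_aff by blast
  define \<eta> where "\<eta> = clog \<phi>"
  have \<eta>: "\<eta> \<in> aug" "cexp \<eta> = \<phi>"
    using aff by (simp_all add: \<eta>_def clog_in_aug cexp_clog)
  \<comment> \<open>At natural parameters the one-parameter group takes powers of
    \<open>\<phi>\<close> as values, and these are already known to be characters.\<close>
  have pow: "cexp (sA (of_nat n) \<eta>) = cpow \<phi> n" for n
    unfolding \<eta>(2)[symmetric] cexp_scale unfolding cexp_def
    using \<eta>(1) fps_exp_power_mult[of "1 :: 'k" n] by (simp add: cpow_cseries)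
  have "\<eta> (a * b) = unit a * \<eta> b + \<eta> a * unit b" for a b
  proof -
    have "(\<lambda>k. sB (1 / fact k) (cpow \<eta> k (a * b))) =
        (\<lambda>k. \<Sum>i\<le>k. sB (1 / fact i) (cpow \<eta> i a) * sB (1 / fact (k - i)) (cpow \<eta> (k - i) b))"
    proof (rule B.has_coefficients_unique)
      show "has_coefficients sB (\<lambda>z. cexp (sA z \<eta>) (a * b)) (\<lambda>k. sB (1 / fact k) (cpow \<eta> k (a * b)))"
        by (rule has_coefficients_cexp[OF \<eta>(1)])
      show "has_coefficients sB (\<lambda>z. cexp (sA z \<eta>) a * cexp (sA z \<eta>) b)
          (\<lambda>k. \<Sum>i\<le>k. sB (1 / fact i) (cpow \<eta> i a) * sB (1 / fact (k - i)) (cpow \<eta> (k - i) b))"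
        by (intro B.has_coefficients_mul has_coefficients_cexp[OF \<eta>(1)])
      show "cexp (sA (of_nat n) \<eta>) (a * b) = cexp (sA (of_nat n) \<eta>) a * cexp (sA (of_nat n) \<eta>) b" for n
        using cpow_in_char[OF assms, of n] by (simp add: pow characters_def)
    qed auto
    from fun_cong[OF this, of 1] show ?thesis
      using \<eta>(1) by (simp add: conv_unit_right aug_in_hom_space)
  qed
  then show ?thesis
    using aug_in_hom_space[OF \<eta>(1)]
    by (simp add: infinitesimal_characters_def convolution_one_def mult_scale flip: \<eta>_def)
qed

lemma image_clog: "clog ` aff = aug" "clog ` char = infchar"
proof -
  show "clog ` aff = aug"
  proof (intro subset_antisym subsetI)
    fix \<eta> assume "\<eta> \<in> aug"
    from imageI[OF cexp_in_aff[OF this], of clog] show "\<eta> \<in> clog ` aff"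
      by (simp add: clog_cexp \<open>\<eta> \<in> aug\<close>)
  qed (use clog_in_aug in blast)
  have "\<eta> \<in> clog ` char" if "\<eta> \<in> infchar" for \<eta>
    using imageI[OF cexp_in_char[OF that], of clog] that infchar_subset_aug by (auto simp: clog_cexp)
  then show "clog ` char = infchar"
    using clog_in_infchar by blast
qed

lemma inj_on_clog: "inj_on clog aff"
  by (metis cexp_clog inj_onI)

end

section \<open>Locally convex spaces of functions and single charts\<close>

lemma locally_convex_space_fun_scale:
  fixes s :: "'k::real_normed_field \<Rightarrow> 'v::{ab_group_add, t2_space} \<Rightarrow> 'v" and E :: "('i \<Rightarrow> 'v) set"
  assumes lcs: "locally_convex_space s UNIV" and E: "module.subspace (fun_scale s) E"
  shows "locally_convex_space (fun_scale s) E"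
proof -
  have "vector_space s" using lcs by (simp add: locally_convex_space_def)
  interpret topological_vs s
    using lcs by (intro topological_vs.intro topological_vs_axioms.intro) (simp_all add: locally_convex_space_def)
  interpret fs: vector_space "fun_scale s :: 'k \<Rightarrow> ('i \<Rightarrow> 'v) \<Rightarrow> _" by (rule vector_space_fun_scale_t)
  have convex: "\<exists>C. open C \<and> 0 \<in> C \<and> C \<subseteq> U \<and>
      (\<forall>x\<in>C. \<forall>y\<in>C. \<forall>r\<in>{0..1}. s (of_real r) x + s (of_real (1 - r)) y \<in> C)"
    if "open U" "0 \<in> U" for U
    using lcs that by (simp add: locally_convex_space_def)
  have "\<exists>C. openin (top_of_set E) C \<and> 0 \<in> C \<and> C \<subseteq> U \<and>
      (\<forall>x\<in>C. \<forall>y\<in>C. \<forall>r\<in>{0..1}. fun_scale s (of_real r) x + fun_scale s (of_real (1 - r)) y \<in> C)"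
    if U: "openin (top_of_set E) U" "0 \<in> U" for U
  proof -
    obtain T where T: "open T" "U = E \<inter> T"
      using U(1) by (auto simp: openin_open)
    then obtain X where X: "finite {i. X i \<noteq> UNIV}" "\<And>i. open (X i)" "0 \<in> Pi\<^sub>E UNIV X" "Pi\<^sub>E UNIV X \<subseteq> T"
      using U(2) by (auto simp: open_fun_def openin_product_topology_alt)
    \<comment> \<open>Factors equal to the whole space keep \<open>UNIV\<close>, so the convex box
      still restricts finitely many coordinates only.\<close>
    have "\<exists>C. open C \<and> 0 \<in> C \<and> C \<subseteq> X i \<and> (X i = UNIV \<longrightarrow> C = UNIV) \<and>
        (\<forall>x\<in>C. \<forall>y\<in>C. \<forall>r\<in>{0..1}. s (of_real r) x + s (of_real (1 - r)) y \<in> C)" for i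
    proof (cases "X i = UNIV")
      case True
      then show ?thesis by (intro exI[of _ UNIV]) auto
    next
      case False
      then show ?thesis using convex[of "X i"] X(2,3) by (auto simp: PiE_iff)
    qed
    then obtain C where C: "\<And>i. open (C i)" "\<And>i. 0 \<in> C i" "\<And>i. C i \<subseteq> X i" "\<And>i. X i = UNIV \<Longrightarrow> C i = UNIV"
      "\<And>i x y r. x \<in> C i \<Longrightarrow> y \<in> C i \<Longrightarrow> r \<in> {0..1} \<Longrightarrow> s (of_real r) x + s (of_real (1 - r)) y \<in> C i"
      by metis
    have "open (Pi\<^sub>E UNIV C)"
      using C(1,4) by (intro open_PiE finite_subset[OF _ X(1)]) auto
    then have "openin (top_of_set E) (E \<inter> Pi\<^sub>E UNIV C)"
      by (rule openin_open_Int)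
    moreover have "Pi\<^sub>E UNIV C \<subseteq> T"
      by (rule subset_trans[OF PiE_mono X(4)]) (rule C(3))
    moreover have "fun_scale s (of_real r) x + fun_scale s (of_real (1 - r)) y \<in> E \<inter> Pi\<^sub>E UNIV C"
      if "x \<in> E \<inter> Pi\<^sub>E UNIV C" "y \<in> E \<inter> Pi\<^sub>E UNIV C" "r \<in> {0..1}" for x y r
    proof
      show "fun_scale s (of_real r) x + fun_scale s (of_real (1 - r)) y \<in> E"
        using that by (intro fs.subspace_add[OF E] fs.subspace_scale[OF E]) auto
      show "fun_scale s (of_real r) x + fun_scale s (of_real (1 - r)) y \<in> Pi\<^sub>E UNIV C"
        using that C(5) by (simp add: PiE_iff fun_scale_def)
    qed
    ultimately show ?thesis
      using T(2) C(2) fs.subspace_0[OF E] by (intro exI[of _ "E \<inter> Pi\<^sub>E UNIV C"]) auto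
  qed
  moreover have "continuous_on (E \<times> E) (\<lambda>(x, y). x + y)"
    unfolding continuous_on_def case_prod_unfold tendsto_fun_iff plus_fun_def
  proof (intro ballI allI)
    fix p :: "('i \<Rightarrow> 'v) \<times> ('i \<Rightarrow> 'v)" and i
    have "((\<lambda>x. x) \<longlongrightarrow> p) (at p within E \<times> E)" by (rule tendsto_ident_at)
    from tendsto_fst[OF this] tendsto_snd[OF this]
    show "((\<lambda>x. fst x i + snd x i) \<longlongrightarrow> fst p i + snd p i) (at p within E \<times> E)"
      by (intro tendsto_add') (simp_all add: tendsto_fun_iff)
  qed
  moreover have "continuous_on (UNIV \<times> E) (\<lambda>(c, x). fun_scale s c x)"
    unfolding continuous_on_def case_prod_unfold tendsto_fun_iff fun_scale_def
  proof (intro ballI allI)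
    fix p :: "'k \<times> ('i \<Rightarrow> 'v)" and i
    have "((\<lambda>x. x) \<longlongrightarrow> p) (at p within UNIV \<times> E)" by (rule tendsto_ident_at)
    from tendsto_fst[OF this] tendsto_snd[OF this]
    show "((\<lambda>x. s (fst x) (snd x i)) \<longlongrightarrow> s (fst p) (snd p i)) (at p within UNIV \<times> E)"
      by (intro tendsto_scale') (simp_all add: tendsto_fun_iff)
  qed
  ultimately show ?thesis
    using E vector_space_fun_scale_t by (auto simp: locally_convex_space_def)
qed

text \<open>\<open>inv_into\<close> is arbitrary outside the image of a chart, so chart expressions
  agree with polynomial maps on \<open>E\<close> only. This suffices: lines from points of
  \<open>E\<close> in directions of \<open>E\<close> never leave \<open>E\<close>, and in the real
  case the extension is prescribed only on \<open>E\<close>.\<close>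

lemma analytic_map_on_cong:
  fixes s :: "'k::rc_field \<Rightarrow> 'e::{ab_group_add, t2_space} \<Rightarrow> 'e"
  assumes s: "vector_space s" and E: "module.subspace s E" and eq: "\<And>x. x \<in> E \<Longrightarrow> f x = g x"
    and f: "analytic_map_on s E t F E f"
  shows "analytic_map_on s E t F E g"
proof (cases "(\<real> :: 'k set) = UNIV")
  case True
  with f eq show ?thesis by (simp add: analytic_map_on_def)
next
  case False
  interpret s: vector_space s by fact
  have smooth: "smooth_map_on s E t F E f"
    using f False by (simp add: analytic_map_on_def)
  have line: "x + s c v \<in> E" if "x \<in> E" "v \<in> E" for x v c
    using that E by (simp add: s.subspace_add s.subspace_scale)
  have deriv: "has_dir_derivative s t f' x v = has_dir_derivative s t g' x v"
    if "\<And>y. y \<in> E \<Longrightarrow> f' y = g' y" "x \<in> E" "v \<in> E" for f' g' x v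
    using that line by (simp add: has_dir_derivative_def fun_eq_iff)
  have iter: "iter_derivative s t f k x w = iter_derivative s t g k x w"
    if "x \<in> E" "\<And>i. i < k \<Longrightarrow> w i \<in> E" for k x w
    using that
  proof (induction k arbitrary: x)
    case (Suc k)
    then have "has_dir_derivative s t (\<lambda>y. iter_derivative s t f k y w) x (w k)
        = has_dir_derivative s t (\<lambda>y. iter_derivative s t g k y w) x (w k)"
      by (intro deriv) auto
    then show ?case by (simp add: dir_derivative_def)
  qed (simp add: eq)
  have "smooth_map_on s E t F E g"
    unfolding smooth_map_on_def
  proof (intro conjI allI ballI)
    show "openin (top_of_set E) E" by simp
    fix k
    show "\<exists>d. has_dir_derivative s t (\<lambda>y. iter_derivative s t g k y v) x (v k) d"
      if xv: "x \<in> E" "v \<in> {..<Suc k} \<rightarrow>\<^sub>E E" for x v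
    proof -
      obtain d where "has_dir_derivative s t (\<lambda>y. iter_derivative s t f k y v) x (v k) d"
        using smooth xv unfolding smooth_map_on_def by blast
      moreover have "has_dir_derivative s t (\<lambda>y. iter_derivative s t f k y v) x (v k)
          = has_dir_derivative s t (\<lambda>y. iter_derivative s t g k y v) x (v k)"
        using xv by (intro deriv iter) (auto simp: PiE_iff)
      ultimately show ?thesis by auto
    qed
    show "iter_derivative s t g k x v \<in> F" if "x \<in> E" "v \<in> {..<k} \<rightarrow>\<^sub>E E" for x v
    proof -
      have "iter_derivative s t f k x v \<in> F"
        using smooth that unfolding smooth_map_on_def by blast
      then show ?thesis using that iter[of x k v] by (auto simp: PiE_iff)
    qed
    have "continuous_on (E \<times> ({..<k} \<rightarrow>\<^sub>E E)) (\<lambda>(x, v). iter_derivative s t f k x v)"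
      using smooth by (simp add: smooth_map_on_def)
    then show "continuous_on (E \<times> ({..<k} \<rightarrow>\<^sub>E E)) (\<lambda>(x, v). iter_derivative s t g k x v)"
      by (rule continuous_on_eq) (auto simp: PiE_iff intro: iter)
  qed
  then show ?thesis using False by (simp add: analytic_map_on_def)
qed

lemma homeomorphic_map_top_of_set:
  assumes "continuous_on S f" "f ` S = T" "continuous_on T g" "\<And>x. x \<in> S \<Longrightarrow> g (f x) = x"
  shows "homeomorphic_map (top_of_set S) (top_of_set T) f"
proof -
  have "homeomorphic_maps (top_of_set S) (top_of_set T) f g"
    using assms by (auto simp: homeomorphic_maps_def)
  then show ?thesis by (auto simp: homeomorphic_map_maps)
qed

lemma chart_on_global:
  assumes "continuous_on S f" "f ` S = T" "continuous_on T g" "\<And>x. x \<in> S \<Longrightarrow> g (f x) = x"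
  shows "chart_on T (top_of_set S) (S, f)"
  using assms homeomorphic_map_top_of_set[OF assms] by (simp add: chart_on_def subtopology_subtopology)

section \<open>The Lie group of characters\<close>

context character_setting
begin

text \<open>Polynomiality is required at each \<open>a\<close> separately: for \<open>cexp\<close>
  and \<open>clog\<close> the cutoff, and with it the degree, varies with \<open>a\<close>.\<close>

definition poly :: "('k \<Rightarrow> 'e::{ab_group_add, t2_space} \<Rightarrow> 'e) \<Rightarrow> ('e \<Rightarrow> 'h \<Rightarrow> 'b) \<Rightarrow> bool" where
  "poly s f \<longleftrightarrow> (\<forall>a. polynomial_fun s sB (*) (\<lambda>x. f x a))"

lemma poly_const: "poly s (\<lambda>_. \<phi>)"
  by (auto simp: poly_def intro: polynomial_fun.const)

lemma poly_add: "poly s f \<Longrightarrow> poly s g \<Longrightarrow> poly s (\<lambda>x. f x + g x)"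
  by (auto simp: poly_def intro: polynomial_fun.add)

lemma poly_scale: "poly s f \<Longrightarrow> poly s (\<lambda>x. sA c (f x))"
  by (auto simp: poly_def fun_scale_def intro: B.polynomial_fun_scale)

lemma poly_diff: "poly s f \<Longrightarrow> poly s g \<Longrightarrow> poly s (\<lambda>x. f x - g x)"
  using poly_add[OF _ poly_scale[of s g "- 1"], of f] by simp

lemma poly_conv: "poly s f \<Longrightarrow> poly s g \<Longrightarrow> poly s (\<lambda>x. f x \<star> g x)"
  unfolding conv_eq poly_def
  by (intro allI polynomial_fun_sum B.polynomial_fun_scale polynomial_fun.mul) auto

lemma poly_cpow: "poly s f \<Longrightarrow> poly s (\<lambda>x. cpow (f x) k)"
proof (induction k)
  case (Suc k)
  then show ?case using poly_conv[of s f "\<lambda>x. cpow (f x) k"] by simp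
qed (simp add: poly_const)

lemma poly_cseries: "poly s f \<Longrightarrow> poly s (\<lambda>x. cseries F (f x))"
  unfolding cseries_def using poly_cpow[of s f] unfolding poly_def
  by (intro allI polynomial_fun_sum B.polynomial_fun_scale) auto

lemma poly_cexp: "poly s f \<Longrightarrow> poly s (\<lambda>x. cexp (f x))"
  unfolding cexp_def by (rule poly_cseries)

lemma poly_clog: "poly s f \<Longrightarrow> poly s (\<lambda>x. clog (f x))"
  unfolding clog_def by (intro poly_cseries poly_diff poly_const)

lemma vector_space_sA2: "vector_space (prod_scale sA sA)"
  by (intro vector_space_prod_scale A.vector_space_axioms)

lemma poly_id: "poly sA (\<lambda>x. x)"
  unfolding poly_def
  by (intro allI polynomial_fun.linear linearI' A.vector_space_axioms B.vector_space_axioms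
      continuous_on_product_coordinates) (auto simp: fun_scale_def)

lemma poly_fst: "poly (prod_scale sA sA) fst"
  unfolding poly_def
  by (intro allI polynomial_fun.linear linearI' vector_space_sA2 B.vector_space_axioms
      continuous_on_product_then_coordinatewise[OF continuous_on_fst[OF continuous_on_id]])
    (auto simp: fun_scale_def prod_scale_def)

lemma poly_snd: "poly (prod_scale sA sA) snd"
  unfolding poly_def
  by (intro allI polynomial_fun.linear linearI' vector_space_sA2 B.vector_space_axioms
      continuous_on_product_then_coordinatewise[OF continuous_on_snd[OF continuous_on_id]])
    (auto simp: fun_scale_def prod_scale_def)

lemma continuous_on_poly: "poly s f \<Longrightarrow> continuous_on T f"
  unfolding poly_def
  by (intro continuous_on_coordinatewise_then_product B.continuous_polynomial_fun[of s]) auto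

section \<open>The model spaces as solution sets of linear equations\<close>

definition hom_equations :: "('k \<times> 'h) list set" where
  "hom_equations = {[(1, a + b), (- 1, a), (- 1, b)] | a b. True} \<union> {[(1, sH c a), (- c, a)] | c a. True}"

definition aug_equations :: "('k \<times> 'h) list set" where
  "aug_equations = insert [(1, 1)] hom_equations"

definition infchar_equations :: "('k \<times> 'h) list set" where
  "infchar_equations = {[(1, a * b), (- \<epsilon> a, b), (- \<epsilon> b, a)] | a b. True} \<union> hom_equations"

lemma hom_space_iff: "\<phi> \<in> A \<longleftrightarrow> (\<forall>a b. \<phi> (a + b) = \<phi> a + \<phi> b) \<and> (\<forall>c a. \<phi> (sH c a) = sB c (\<phi> a))"
  by (auto intro: hom_spaceI simp: hom_space_add hom_space_scale)

lemma equation_iff: "x + (- y - z) = 0 \<longleftrightarrow> x = y + (z :: 'b)" "x - y = 0 \<longleftrightarrow> x = (y :: 'b)"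
  by (auto simp: algebra_simps eq_diff_eq)

lemma hom_space_eq: "A = equation_space sB hom_equations"
proof (rule Set.set_eqI)
  fix \<phi>
  have "\<phi> \<in> equation_space sB hom_equations \<longleftrightarrow>
      (\<forall>a b. sB 1 (\<phi> (a + b)) + (sB (- 1) (\<phi> a) + (sB (- 1) (\<phi> b) + 0)) = 0) \<and>
      (\<forall>c a. sB 1 (\<phi> (sH c a)) + (sB (- c) (\<phi> a) + 0) = 0)"
    unfolding equation_space_def hom_equations_def by (simp add: ball_Un) fastforce
  also have "\<dots> \<longleftrightarrow> \<phi> \<in> A"
    by (simp add: hom_space_iff equation_iff)
  finally show "\<phi> \<in> A \<longleftrightarrow> \<phi> \<in> equation_space sB hom_equations" by simp
qed

lemma aug_eq: "aug = equation_space sB aug_equations"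
  unfolding augmentation_space_def hom_space_eq by (auto simp: equation_space_def aug_equations_def)

lemma infchar_eq: "infchar = equation_space sB infchar_equations"
proof (rule Set.set_eqI)
  fix \<phi>
  have "\<phi> \<in> equation_space sB infchar_equations \<longleftrightarrow>
      (\<forall>a b. sB 1 (\<phi> (a * b)) + (sB (- \<epsilon> a) (\<phi> b) + (sB (- \<epsilon> b) (\<phi> a) + 0)) = 0) \<and>
      \<phi> \<in> equation_space sB hom_equations"
    unfolding equation_space_def infchar_equations_def by (simp add: ball_Un) fastforce
  also have "\<dots> \<longleftrightarrow> \<phi> \<in> infchar"
    by (auto simp: infinitesimal_characters_def hom_space_eq equation_iff)
  finally show "\<phi> \<in> infchar \<longleftrightarrow> \<phi> \<in> equation_space sB infchar_equations" by simp
qed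

lemma subspace_infchar: "A.subspace infchar"
  unfolding infchar_eq by (rule B.subspace_equation_space)

lemma closed_infchar: "closed infchar"
  unfolding infchar_eq by (rule B.closed_equation_space)

lemma locally_convex_space_subspace:
  "A.subspace E \<Longrightarrow> locally_convex_space sA E"
  using algebra_B by (intro locally_convex_space_fun_scale) (auto simp: commutative_locally_convex_algebra_def)

lemma analytic_poly:
  assumes "vector_space s" "module.subspace s E" "F = equation_space sB R"
    "poly s f" "f ` E \<subseteq> F" "\<And>x. x \<in> E \<Longrightarrow> g x = f x"
  shows "analytic_map_on s E sA F E g"
  using assms unfolding poly_def
  by (intro analytic_map_on_cong[OF assms(1,2), of f g] analytic_map_on_polynomial[OF B.topological_algebra_axioms]) auto

section \<open>The global charts given by translation and by the logarithm\<close>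

lemma inv_translation: "x \<in> aug \<Longrightarrow> inv_into aff (\<lambda>\<phi>. \<phi> - unit) x = x + unit"
  by (rule inv_into_f_eq) (auto simp: inj_on_def simp flip: diff_unit_in_aug)

lemma inv_clog_aff: "x \<in> aug \<Longrightarrow> inv_into aff clog x = cexp x"
  by (rule inv_into_f_eq[OF inj_on_clog]) (simp_all add: cexp_in_aff clog_cexp)

lemma inj_on_clog_char: "inj_on clog char"
  using inj_on_clog char_subset_aff by (rule inj_on_subset)

lemma inv_clog: "x \<in> infchar \<Longrightarrow> inv_into char clog x = cexp x"
  using infchar_subset_aug by (intro inv_into_f_eq[OF inj_on_clog_char]) (auto simp: cexp_in_char clog_cexp)

lemma image_translation: "(\<lambda>\<phi>. \<phi> - unit) ` aff = aug"
proof (intro subset_antisym subsetI)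
  fix x assume "x \<in> aug"
  then have "x + unit \<in> aff" by (simp flip: diff_unit_in_aug)
  then show "x \<in> (\<lambda>\<phi>. \<phi> - unit) ` aff" by (intro image_eqI[of _ _ "x + unit"]) auto
qed (auto simp: diff_unit_in_aug)

lemma chart_translation: "chart_on aug (top_of_set aff) (aff, \<lambda>\<phi>. \<phi> - unit)"
  by (rule chart_on_global[OF _ image_translation, of "\<lambda>x. x + unit"])
    (auto intro!: continuous_on_poly[of sA] poly_diff poly_add poly_id poly_const)

lemma chart_clog_aff: "chart_on aug (top_of_set aff) (aff, clog)"
  by (rule chart_on_global[OF _ image_clog(1), of cexp])
    (auto intro!: continuous_on_poly[of sA] poly_clog poly_cexp poly_id simp: cexp_clog)

lemma chart_clog: "chart_on infchar (top_of_set char) (char, clog)"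
  by (rule chart_on_global[OF _ image_clog(2), of cexp])
    (use char_subset_aff in \<open>auto intro!: continuous_on_poly[of sA] poly_clog poly_cexp poly_id simp: cexp_clog\<close>)

lemma Hausdorff_top_of_set: "Hausdorff_space (top_of_set (X :: ('h \<Rightarrow> 'b) set))"
proof (rule Hausdorff_space_subtopology)
  show "Hausdorff_space (euclidean :: ('h \<Rightarrow> 'b) topology)"
    unfolding Hausdorff_space_def disjnt_def by simp (metis hausdorff)
qed

lemma analytic_aug:
  assumes "poly sA f" "f ` aug \<subseteq> aug" "\<And>x. x \<in> aug \<Longrightarrow> g x = f x"
  shows "analytic_map_on sA aug sA aug aug g"
  using assms by (intro analytic_poly[OF A.vector_space_axioms subspace_aug aug_eq])

lemma analytic_infchar:
  assumes "poly sA f" "f ` infchar \<subseteq> infchar" "\<And>x. x \<in> infchar \<Longrightarrow> g x = f x"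
  shows "analytic_map_on sA infchar sA infchar infchar g"
  using assms by (intro analytic_poly[OF A.vector_space_axioms subspace_infchar infchar_eq])

lemma manifold_aff: "analytic_manifold sA aug (top_of_set aff) (affine_atlas sH \<epsilon> sB)"
proof -
  have "analytic_map_on sA aug sA aug aug ((\<lambda>\<phi>. \<phi> - unit) \<circ> inv_into aff (\<lambda>\<phi>. \<phi> - unit))"
    by (intro analytic_aug[OF poly_id]) (auto simp: inv_translation)
  then show ?thesis
    using chart_translation
    by (auto simp: analytic_manifold_def affine_atlas_def analytic_transition_def image_translation
        Hausdorff_top_of_set locally_convex_space_subspace subspace_aug)
qed

text \<open>Relative to the translation chart the changes of charts are the series log (1 + X) and
  exp X - 1, both of which preserve \<open>aug\<close>.\<close>

lemma clog_in_maximal_atlas: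
  "(aff, clog) \<in> maximal_atlas sA aug (top_of_set aff) (affine_atlas sH \<epsilon> sB)"
proof -
  have "analytic_map_on sA aug sA aug aug (clog \<circ> inv_into aff (\<lambda>\<phi>. \<phi> - unit))"
    by (intro analytic_aug[OF poly_cseries[OF poly_id, of "fps_ln 1"]])
      (auto simp: inv_translation clog_def cseries_in_aug)
  moreover have "analytic_map_on sA aug sA aug aug ((\<lambda>\<phi>. \<phi> - unit) \<circ> inv_into aff clog)"
    by (intro analytic_aug[OF poly_cseries[OF poly_id, of "fps_exp 1 - 1"]])
      (auto simp: inv_clog_aff cexp_diff_unit cseries_in_aug)
  ultimately show ?thesis
    using chart_clog_aff
    by (auto simp: maximal_atlas_def affine_atlas_def analytic_transition_def image_translation image_clog)
qed

lemma submanifold_char: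
  "analytic_submanifold sA aug (top_of_set aff) (affine_atlas sH \<epsilon> sB) char infchar {(char, clog)}"
proof -
  have "aff \<inter> char = char" using char_subset_aff by blast
  moreover have "closedin (top_of_set aug) infchar"
    using closed_infchar infchar_subset_aug by (auto simp: closedin_closed)
  ultimately show ?thesis
    unfolding analytic_submanifold_def
    using manifold_aff char_subset_aff subspace_infchar clog_in_maximal_atlas infchar_subset_aug
    by (auto simp: image_clog intro!: exI[of _ aff] clog_in_infchar)
qed

section \<open>The group structure and the analyticity of its operations\<close>

abbreviation "CG \<equiv> character_group sH \<Delta> \<epsilon> sB"

lemma char_in_hom_space: "\<phi> \<in> char \<Longrightarrow> \<phi> \<in> A"
  by (simp add: characters_def)

text \<open>Inverses are formed in the logarithm chart, where inversion becomes the linear map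
  \<open>x \<mapsto> - x\<close>.\<close>

lemma cexp_minus_clog:
  assumes "\<phi> \<in> char"
  shows "cexp (- clog \<phi>) \<in> char" "cexp (- clog \<phi>) \<star> \<phi> = unit" "\<phi> \<star> cexp (- clog \<phi>) = unit"
proof -
  have "clog \<phi> \<in> infchar" "\<phi> \<in> aff" using assms clog_in_infchar char_subset_aff by auto
  then show "cexp (- clog \<phi>) \<in> char" "cexp (- clog \<phi>) \<star> \<phi> = unit" "\<phi> \<star> cexp (- clog \<phi>) = unit"
    using cexp_minus[of "clog \<phi>"] infchar_subset_aug A.subspace_neg[OF subspace_infchar]
    by (auto simp: cexp_clog intro!: cexp_in_char)
qed

lemma group_char: "group CG"
  by (rule groupI)
    (auto simp: character_group_def conv_in_char unit_in_char conv_assoc conv_unit_left char_in_hom_space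
      intro: cexp_minus_clog)

lemma inv_char: "\<phi> \<in> char \<Longrightarrow> inv\<^bsub>CG\<^esub> \<phi> = cexp (- clog \<phi>)"
  using cexp_minus_clog
  by (intro group.inv_equality[OF group_char]) (auto simp: character_group_def)

lemma poly_minus: "poly s f \<Longrightarrow> poly s (\<lambda>x. - f x)"
  using poly_scale[of s f "- 1"] by simp

lemma lie_group_char: "analytic_lie_group sA infchar CG (top_of_set char) {(char, clog)}"
  unfolding analytic_lie_group_def
proof (intro conjI)
  show "group CG" by (rule group_char)
  show "topspace (top_of_set char) = carrier CG" by (simp add: character_group_def)
  have "analytic_map_on sA infchar sA infchar infchar (clog \<circ> inv_into char clog)"
    using infchar_subset_aug by (intro analytic_infchar[OF poly_id]) (auto simp: inv_clog clog_cexp)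
  then show "analytic_manifold sA infchar (top_of_set char) {(char, clog)}"
    using chart_clog
    by (auto simp: analytic_manifold_def analytic_transition_def image_clog Hausdorff_top_of_set
        locally_convex_space_subspace subspace_infchar)
  have mult: "poly (prod_scale sA sA) (\<lambda>z. fst z \<star> snd z)"
    by (intro poly_conv poly_fst poly_snd)
  have subspace2: "module.subspace (prod_scale sA sA) (infchar \<times> infchar)"
  proof -
    interpret P: vector_space "prod_scale sA sA" by (rule vector_space_sA2)
    show ?thesis
      by (rule P.subspaceI)
        (auto simp: prod_scale_def zero_prod_def A.subspace_0 A.subspace_add A.subspace_scale subspace_infchar)
  qed
  have inj2: "inj_on (map_prod clog clog) (char \<times> char)"
    using inj_on_clog_char by (intro map_prod_inj_on)
  have image2: "map_prod clog clog ` (char \<times> char) = infchar \<times> infchar"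
    using image_clog(2) by (simp add: map_prod_surj_on)
  have inv2: "inv_into (char \<times> char) (map_prod clog clog) z = (cexp (fst z), cexp (snd z))"
    if "z \<in> infchar \<times> infchar" for z
    using that infchar_subset_aug by (intro inv_into_f_eq[OF inj2]) (auto simp: cexp_in_char clog_cexp)
  have dom: "char \<times> char \<inter> (\<lambda>(g, h). g \<otimes>\<^bsub>CG\<^esub> h) -` char = char \<times> char"
    by (auto simp: character_group_def conv_in_char)
  have "analytic_map_on (prod_scale sA sA) (infchar \<times> infchar) sA infchar (infchar \<times> infchar)
      (clog \<circ> (\<lambda>(g, h). g \<otimes>\<^bsub>CG\<^esub> h) \<circ> inv_into (char \<times> char) (map_prod clog clog))"
    by (rule analytic_poly[OF vector_space_sA2 subspace2 infchar_eq
          poly_clog[OF poly_conv[OF poly_cexp[OF poly_fst] poly_cexp[OF poly_snd]]]])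
      (auto simp: inv2 character_group_def intro!: clog_in_infchar conv_in_char cexp_in_char)
  moreover have "continuous_map (prod_topology (top_of_set char) (top_of_set char)) (top_of_set char)
      (\<lambda>(g, h). g \<otimes>\<^bsub>CG\<^esub> h)"
    using continuous_on_poly[OF mult, of "char \<times> char"]
    by (auto simp: character_group_def case_prod_unfold conv_in_char)
  ultimately show "analytic_manifold_map (prod_scale sA sA) (infchar \<times> infchar)
      (prod_topology (top_of_set char) (top_of_set char)) (product_atlas {(char, clog)} {(char, clog)})
      sA infchar (top_of_set char) {(char, clog)} (\<lambda>(g, h). g \<otimes>\<^bsub>CG\<^esub> h)"
    by (auto simp: analytic_manifold_map_def product_atlas_def dom image2)
  have "char \<inter> (\<lambda>g. inv\<^bsub>CG\<^esub> g) -` char = char"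
    using cexp_minus_clog by (auto simp: inv_char)
  moreover have "analytic_map_on sA infchar sA infchar infchar (clog \<circ> (\<lambda>g. inv\<^bsub>CG\<^esub> g) \<circ> inv_into char clog)"
    using infchar_subset_aug A.subspace_neg[OF subspace_infchar] A.subspace_neg[OF subspace_aug]
    by (intro analytic_infchar[OF poly_minus[OF poly_id]])
      (auto simp: inv_clog inv_char cexp_in_char clog_cexp subset_iff)
  moreover have "continuous_map (top_of_set char) (top_of_set char) (\<lambda>g. inv\<^bsub>CG\<^esub> g)"
  proof -
    have "continuous_on char (\<lambda>g. inv\<^bsub>CG\<^esub> g)"
      by (rule continuous_on_eq[OF continuous_on_poly[OF poly_cexp[OF poly_minus[OF poly_clog[OF poly_id]]]]])
        (simp add: inv_char)
    then show ?thesis using cexp_minus_clog by (auto simp: inv_char)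
  qed
  ultimately show "analytic_manifold_map sA infchar (top_of_set char) {(char, clog)}
      sA infchar (top_of_set char) {(char, clog)} (\<lambda>g. inv\<^bsub>CG\<^esub> g)"
    by (auto simp: analytic_manifold_map_def image_clog)
qed

section \<open>The Lie algebra of the group of characters\<close>

sublocale A: topological_vs sA
  using locally_convex_space_subspace[OF A.subspace_UNIV] unfolding locally_convex_space_def
  by unfold_locales simp_all

section \<open>Derivatives of convolution products, powers and series\<close>

abbreviation has_deriv ::
    "(('h \<Rightarrow> 'b) \<Rightarrow> 'h \<Rightarrow> 'b) \<Rightarrow> ('h \<Rightarrow> 'b) \<Rightarrow> ('h \<Rightarrow> 'b) \<Rightarrow> ('h \<Rightarrow> 'b) \<Rightarrow> bool" where
  "has_deriv \<equiv> has_dir_derivative sA sA"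

lemma has_deriv_iff: "has_deriv f x v d \<longleftrightarrow> (\<forall>a. has_dir_derivative sA sB (\<lambda>y. f y a) x v (d a))"
  by (simp add: has_dir_derivative_def tendsto_fun_iff fun_scale_def)

lemma has_deriv_id: "has_deriv (\<lambda>y. y) x v v"
  by (intro A.has_dir_derivative_linear linearI' A.vector_space_axioms) auto

lemma has_deriv_conv:
  assumes "has_deriv f x v f'" "has_deriv g x v g'"
  shows "has_deriv (\<lambda>y. f y \<star> g y) x v (f' \<star> g x + f x \<star> g')"
proof -
  have "has_dir_derivative sA sB (\<lambda>y. (f y \<star> g y) a) x v ((f' \<star> g x + f x \<star> g') a)" for a
    unfolding conv_eq plus_fun_def sum.distrib[symmetric] B.scale_right_distrib[symmetric]
    using assms unfolding has_deriv_iff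
    by (intro B.has_dir_derivative_sum B.has_dir_derivative_scale B.has_dir_derivative_mul) auto
  then show ?thesis by (simp add: has_deriv_iff)
qed

text \<open>The derivative of the \<open>k\<close>-th power at \<open>\<phi>\<close> in direction
  \<open>\<phi>'\<close>. Convolution need not be commutative, so the product rule does not collapse
  to \<open>k\<close> times a lower power.\<close>

primrec dcpow :: "('h \<Rightarrow> 'b) \<Rightarrow> ('h \<Rightarrow> 'b) \<Rightarrow> nat \<Rightarrow> 'h \<Rightarrow> 'b" where
  "dcpow \<phi> \<phi>' 0 = 0"
| "dcpow \<phi> \<phi>' (Suc k) = \<phi>' \<star> cpow \<phi> k + \<phi> \<star> dcpow \<phi> \<phi>' k"

declare dcpow.simps [simp del]

lemma dcpow_simps [simp]:
  "dcpow \<phi> \<phi>' 0 = 0" "dcpow \<phi> \<phi>' (Suc k) = \<phi>' \<star> cpow \<phi> k + \<phi> \<star> dcpow \<phi> \<phi>' k"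
  by (simp_all add: dcpow.simps fun_eq_iff)

definition dcseries :: "'k fps \<Rightarrow> ('h \<Rightarrow> 'b) \<Rightarrow> ('h \<Rightarrow> 'b) \<Rightarrow> 'h \<Rightarrow> 'b" where
  "dcseries F \<phi> \<phi>' a = (\<Sum>k\<le>nilpotency_bound a. sB (fps_nth F k) (dcpow \<phi> \<phi>' k a))"

lemma has_deriv_cpow:
  assumes "has_deriv f x v f'"
  shows "has_deriv (\<lambda>y. cpow (f y) k) x v (dcpow (f x) f' k)"
proof (induction k)
  case (Suc k)
  from has_deriv_conv[OF assms Suc] show ?case by (simp only: dcpow_simps cpow.simps)
qed (simp only: dcpow_simps cpow.simps A.has_dir_derivative_const)

lemma has_deriv_cseries:
  assumes "has_deriv f x v f'"
  shows "has_deriv (\<lambda>y. cseries F (f y)) x v (dcseries F (f x) f')"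
  using has_deriv_cpow[OF assms] unfolding has_deriv_iff cseries_def dcseries_def
  by (intro allI B.has_dir_derivative_sum B.has_dir_derivative_scale) auto

lemma cpow_zero: "cpow 0 k = (if k = 0 then unit else 0)"
  by (cases k) (auto simp: conv_zero_left)

lemma dcpow_zero: "\<phi>' \<in> A \<Longrightarrow> dcpow 0 \<phi>' k = (if k = 1 then \<phi>' else 0)"
  by (cases k) (auto simp: conv_zero_left conv_zero_right conv_unit_right cpow_zero)

lemma dcseries_zero:
  assumes "\<phi>' \<in> A"
  shows "dcseries F 0 \<phi>' = sA (fps_nth F 1) \<phi>'"
proof
  fix a
  have "dcseries F 0 \<phi>' a = (\<Sum>k\<in>{1}. sB (fps_nth F k) (dcpow 0 \<phi>' k a))"
    unfolding dcseries_def using nilpotency_bound(1)[of a] assms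
    by (intro sum.mono_neutral_right) (auto simp: dcpow_zero)
  then show "dcseries F 0 \<phi>' a = sA (fps_nth F 1) \<phi>' a"
    using assms by (simp add: dcpow_zero fun_scale_def del: dcpow_simps)
qed

lemma has_deriv_cexp:
  assumes "v \<in> A"
  shows "has_deriv cexp 0 v v"
  using has_deriv_cseries[OF has_deriv_id, of "fps_exp 1" 0 v] assms
  by (simp add: dcseries_zero flip: cexp_def)

text \<open>In the logarithm chart this is the value at \<open>g\<close> of the left invariant field
  belonging to \<open>v\<close>: \<open>g \<star> v\<close> is the velocity of
  \<open>g \<star> cexp y\<close> at 0 in direction \<open>v\<close>, and \<open>dcseries\<close> is
  the derivative of the logarithm.\<close>

definition left_field :: "('h \<Rightarrow> 'b) \<Rightarrow> ('h \<Rightarrow> 'b) \<Rightarrow> 'h \<Rightarrow> 'b" where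
  "left_field v g = dcseries (fps_ln 1) (g - unit) (g \<star> v)"

lemma has_deriv_left_translation:
  assumes "g \<in> A" "v \<in> A"
  shows "has_deriv (\<lambda>y. clog (g \<star> cexp y)) 0 v (left_field v g)"
proof -
  have "has_deriv (\<lambda>y. g \<star> cexp y - unit) 0 v (0 \<star> cexp 0 + g \<star> v - 0)"
    using assms
    by (intro A.has_dir_derivative_diff has_deriv_conv A.has_dir_derivative_const has_deriv_cexp)
  from has_deriv_cseries[OF this, of "fps_ln 1"] show ?thesis
    using assms by (simp add: clog_def left_field_def conv_zero_left cexp_zero conv_unit_right)
qed

lemma left_field_unit: "v \<in> A \<Longrightarrow> left_field v unit = v"
  by (simp add: left_field_def dcseries_zero conv_unit_left fps_ln_nth)

text \<open>\<open>dcpow (\<nu> y) (\<mu> y) k\<close> is a sum of products with one factor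
  \<open>\<mu> y\<close> and \<open>k - 1\<close> factors \<open>\<nu> y\<close>. One
  differentiation removes at most one factor that vanishes at \<open>x\<close>, so only
  \<open>k = 1\<close> and \<open>k = 2\<close> can survive.\<close>

lemma has_deriv_dcpow:
  assumes \<nu>: "has_deriv \<nu> x v \<nu>'" and \<mu>: "has_deriv \<mu> x v \<mu>'" and zero: "\<nu> x = 0"
    and hom: "\<nu>' \<in> A" "\<mu> x \<in> A" "\<mu>' \<in> A"
  shows "has_deriv (\<lambda>y. dcpow (\<nu> y) (\<mu> y) k) x v
    (if k = 1 then \<mu>' else if k = 2 then \<mu> x \<star> \<nu>' + \<nu>' \<star> \<mu> x else 0)"
proof (induction k)
  case 0
  show ?case
    using A.has_dir_derivative_const[of sA 0 x v] by (simp only: dcpow_simps zero_neq_one zero_neq_numeral if_False)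
next
  case (Suc k)
  have "has_deriv (\<lambda>y. dcpow (\<nu> y) (\<mu> y) (Suc k)) x v
      (\<mu>' \<star> cpow (\<nu> x) k + \<mu> x \<star> dcpow (\<nu> x) \<nu>' k + (\<nu>' \<star> dcpow (\<nu> x) (\<mu> x) k + \<nu> x \<star>
        (if k = 1 then \<mu>' else if k = 2 then \<mu> x \<star> \<nu>' + \<nu>' \<star> \<mu> x else 0)))"
    unfolding dcpow_simps
    by (intro A.has_dir_derivative_add has_deriv_conv \<mu> has_deriv_cpow[OF \<nu>] \<nu> Suc)
  also have "\<mu>' \<star> cpow (\<nu> x) k + \<mu> x \<star> dcpow (\<nu> x) \<nu>' k + (\<nu>' \<star> dcpow (\<nu> x) (\<mu> x) k + \<nu> x \<star>
        (if k = 1 then \<mu>' else if k = 2 then \<mu> x \<star> \<nu>' + \<nu>' \<star> \<mu> x else 0))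
      = (if Suc k = 1 then \<mu>' else if Suc k = 2 then \<mu> x \<star> \<nu>' + \<nu>' \<star> \<mu> x else 0)"
    using hom unfolding zero cpow_zero
    by (simp add: dcpow_zero conv_zero_left conv_zero_right conv_unit_right del: dcpow_simps)
  finally show ?case .
qed

text \<open>
  Only the terms \<open>\<nu>\<close> and \<open>- \<nu>\<^sup>2 / 2\<close> of the logarithm contribute to the mixed second derivative
  of \<open>log (exp x \<star> exp y)\<close> at \<open>(0, 0)\<close>.
\<close>

lemma has_deriv_left_field:
  assumes "v \<in> A" "w \<in> A"
  shows "has_deriv (\<lambda>x. left_field w (cexp x)) 0 v (v \<star> w - sA (1 / 2) (v \<star> w + w \<star> v))"
proof -
  define D where "D k = (if k = 1 then v \<star> w else if k = (2 :: nat) then w \<star> v + v \<star> w else 0)" for k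
  have exp: "has_deriv cexp 0 v v" using assms(1) by (rule has_deriv_cexp)
  have \<nu>: "has_deriv (\<lambda>x. cexp x - unit) 0 v v"
    using A.has_dir_derivative_diff[OF exp A.has_dir_derivative_const[where b = unit]] by simp
  have \<mu>: "has_deriv (\<lambda>x. cexp x \<star> w) 0 v (v \<star> w)"
    using has_deriv_conv[OF exp A.has_dir_derivative_const[where b = w]] by (simp add: conv_zero_right)
  have D: "has_deriv (\<lambda>x. dcpow (cexp x - unit) (cexp x \<star> w) k) 0 v (D k)" for k
    using has_deriv_dcpow[OF \<nu> \<mu>, of k] assms
    by (simp add: cexp_zero conv_unit_left conv_in_hom_space D_def cong: if_cong split del: if_split del: dcpow_simps)
  have "has_dir_derivative sA sB (\<lambda>x. left_field w (cexp x) a) 0 v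
      ((v \<star> w - sA (1 / 2) (v \<star> w + w \<star> v)) a)" for a
  proof -
    have "has_dir_derivative sA sB (\<lambda>x. left_field w (cexp x) a) 0 v
        (\<Sum>k\<le>nilpotency_bound a. sB (fps_nth (fps_ln 1) k) (D k a))"
      unfolding left_field_def dcseries_def
      using D unfolding has_deriv_iff
      by (intro B.has_dir_derivative_sum B.has_dir_derivative_scale) auto
    \<comment> \<open>Orders 1 and 2 lie within every cutoff; their coefficients in the logarithm
      are 1 and -1/2.\<close>
    also have "(\<Sum>k\<le>nilpotency_bound a. sB (fps_nth (fps_ln 1) k) (D k a))
        = (\<Sum>k\<in>{1, 2}. sB (fps_nth (fps_ln 1) k) (D k a))"
      using nilpotency_bound(1)[of a] by (intro sum.mono_neutral_right) (auto simp: D_def)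
    also have "\<dots> = (v \<star> w - sA (1 / 2) (v \<star> w + w \<star> v)) a"
      by (simp add: D_def fps_ln_nth fun_scale_def add.commute)
    finally show ?thesis .
  qed
  then show ?thesis by (simp add: has_deriv_iff)
qed

section \<open>The commutator bracket on infinitesimal characters\<close>

abbreviation bracket :: "('h \<Rightarrow> 'b) \<Rightarrow> ('h \<Rightarrow> 'b) \<Rightarrow> 'h \<Rightarrow> 'b" where
  "bracket \<equiv> convolution_bracket sB \<Delta>"

lemma infchar_in_hom_space: "\<eta> \<in> infchar \<Longrightarrow> \<eta> \<in> A"
  by (simp add: infinitesimal_characters_def)

text \<open>A convolution \<open>\<eta> \<star> \<psi>\<close> misses the defining identity by
  \<open>\<eta> a * \<psi> b + \<psi> a * \<eta> b\<close>. This defect is symmetric in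
  \<open>\<eta>\<close> and \<open>\<psi>\<close>, so it cancels in the commutator.\<close>

lemma bracket_in_infchar:
  assumes "\<eta> \<in> infchar" "\<psi> \<in> infchar"
  shows "bracket \<eta> \<psi> \<in> infchar"
proof -
  have conv: "(\<eta> \<star> \<psi>) (a * b) = unit a * (\<eta> \<star> \<psi>) b + (\<eta> \<star> \<psi>) a * unit b + (\<eta> a * \<psi> b + \<psi> a * \<eta> b)"
    if "\<eta> \<in> infchar" "\<psi> \<in> infchar" for \<eta> \<psi> a b
  proof -
    have "\<psi> (x * y) = (\<Sum>j\<in>UNIV. (if j then unit else \<psi>) x * (if j then \<psi> else unit) y)" for x y
      by (simp add: infchar_mult[OF that(2)] UNIV_bool add.commute)
    from conv_infchar_mult[OF that(1) infchar_in_hom_space[OF that(2)] this, of a b] that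
    show ?thesis
      by (simp add: UNIV_bool infchar_in_hom_space unit_in_hom_space conv_unit_right add_ac)
  qed
  have "bracket \<eta> \<psi> (a * b) = unit a * bracket \<eta> \<psi> b + unit b * bracket \<eta> \<psi> a" for a b
    using assms
    by (simp add: convolution_bracket_def conv algebra_simps)
  moreover have "bracket \<eta> \<psi> \<in> A"
    using assms unfolding convolution_bracket_def
    by (intro A.subspace_diff[OF subspace_hom_space] conv_in_hom_space infchar_in_hom_space)
  ultimately show ?thesis
    by (simp add: infinitesimal_characters_def convolution_one_def mult_scale)
qed

lemma bracket_simps:
  "bracket (x + y) z = bracket x z + bracket y z" "bracket x (y + z) = bracket x y + bracket x z"
  "bracket (sA c x) y = sA c (bracket x y)" "bracket x (sA c y) = sA c (bracket x y)"
  "bracket x x = 0"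
  by (simp_all add: convolution_bracket_def conv_add_left conv_add_right conv_scale_left conv_scale_right
      A.scale_right_diff_distrib)

lemma jacobi_bracket:
  assumes "x \<in> A" "y \<in> A" "z \<in> A"
  shows "bracket x (bracket y z) + bracket y (bracket z x) + bracket z (bracket x y) = 0"
  using assms
  by (simp add: convolution_bracket_def conv_diff_left conv_diff_right conv_assoc)

lemma lie_algebra_infchar: "lie_algebra_on sA infchar bracket"
  unfolding lie_algebra_on_def
  using A.vector_space_axioms subspace_infchar bracket_in_infchar
  by (auto simp: bracket_simps intro!: jacobi_bracket infchar_in_hom_space)

section \<open>The tangent space at the unit in the logarithm chart\<close>

abbreviation "atlas \<equiv> {(char, clog)}"

abbreviation "tangent_unit \<equiv> tangent_space sA infchar atlas unit"

text \<open>Tangent vectors are families indexed by all charts; with a single chart in the atlas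
  every other entry has to be 0.\<close>

definition tangent_of :: "('h \<Rightarrow> 'b) \<Rightarrow> ('h \<Rightarrow> 'b, 'h \<Rightarrow> 'b) chart \<Rightarrow> 'h \<Rightarrow> 'b" where
  "tangent_of v = (\<lambda>c. if c = (char, clog) then v else 0)"

lemma tangent_of_chart: "tangent_of v (char, clog) = v"
  by (simp add: tangent_of_def)

lemma clog_unit: "clog unit = 0"
  using clog_cexp[of 0] A.subspace_0[OF subspace_aug] by (simp add: cexp_zero)

lemma infchar_scale: "v \<in> infchar \<Longrightarrow> sA c v \<in> infchar"
  using A.subspace_scale[OF subspace_infchar] by blast

text \<open>Chart expressions are known on \<open>infchar\<close> only, but the line through 0 in a
  direction from \<open>infchar\<close> stays inside it.\<close>

lemma dir_derivative_in_chart: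
  assumes "v \<in> infchar" "\<And>x. x \<in> infchar \<Longrightarrow> f x = g x" "has_deriv g 0 v d"
  shows "dir_derivative sA sA f 0 v = d"
proof (rule A.dir_derivative_eq)
  have "has_deriv f 0 v d \<longleftrightarrow> has_deriv g 0 v d"
    using assms(1,2) A.subspace_0[OF subspace_infchar] by (intro A.has_dir_derivative_cong) (auto simp: infchar_scale)
  with assms(3) show "has_deriv f 0 v d" by simp
qed

lemma tangent_unit_eq: "tangent_unit = tangent_of ` infchar"
proof -
  \<comment> \<open>The one compatibility condition compares the chart with itself, where the
    transition is the identity on \<open>infchar\<close>.\<close>
  have "dir_derivative sA sA (clog \<circ> inv_into char clog) (clog unit) v = v" if "v \<in> infchar" for v
    unfolding clog_unit using that infchar_subset_aug
    by (intro dir_derivative_in_chart[OF _ _ has_deriv_id]) (auto simp: inv_clog clog_cexp)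
  then have mem: "v \<in> tangent_unit \<longleftrightarrow> v (char, clog) \<in> infchar \<and> (\<forall>c. c \<noteq> (char, clog) \<longrightarrow> v c = 0)" for v
    using unit_in_char by (auto simp: tangent_space_def split: if_splits)
  show ?thesis
  proof (intro subset_antisym subsetI)
    fix v assume "v \<in> tangent_unit"
    then have "v = tangent_of (v (char, clog))" and "v (char, clog) \<in> infchar"
      unfolding tangent_of_def mem by auto
    then show "v \<in> tangent_of ` infchar" by (rule image_eqI)
  qed (auto simp: mem tangent_of_def)
qed

lemma chart_at_atlas: "p \<in> char \<Longrightarrow> chart_at atlas p = (char, clog)"
  by (simp add: chart_at_def) (rule some_equality, auto)

text \<open>In the logarithm chart the inclusion is \<open>cexp\<close>, whose derivative at 0 is
  the identity; the map therefore reads off the coordinate.\<close>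

lemma inclusion_derivative_tangent_of:
  assumes "v \<in> infchar"
  shows "inclusion_derivative sH \<epsilon> sB atlas (tangent_of v) = v"
proof -
  have "dir_derivative sA sA (id \<circ> id \<circ> inv_into char clog) 0 v = v"
    using assms by (intro dir_derivative_in_chart[OF _ _ has_deriv_cexp]) (auto simp: inv_clog infchar_in_hom_space)
  then show ?thesis
    by (simp add: inclusion_derivative_def tangent_map_def chart_at_atlas unit_in_char unit_in_hom_space
        clog_unit tangent_of_def)
qed

lemma left_invariant_field_eq:
  assumes "v \<in> infchar" "g \<in> char"
  shows "left_invariant_field sA CG atlas (tangent_of v) g (char, clog) = left_field v g"
proof -
  have "dir_derivative sA sA (clog \<circ> (\<lambda>h. g \<otimes>\<^bsub>CG\<^esub> h) \<circ> inv_into char clog) 0 v = left_field v g"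
    using assms
    by (intro dir_derivative_in_chart[OF _ _ has_deriv_left_translation])
      (auto simp: inv_clog character_group_def infchar_in_hom_space char_in_hom_space)
  then show ?thesis
    using assms
    by (simp add: left_invariant_field_def tangent_map_def chart_at_atlas unit_in_char clog_unit
        tangent_of_def character_group_def conv_in_char)
qed

text \<open>Each of the two derivatives contains the same symmetric term
  \<open>sA (1 / 2) (v \<star> w + w \<star> v)\<close>. Their difference leaves
  \<open>v \<star> w - w \<star> v\<close>.\<close>

lemma lie_group_bracket_eq:
  assumes "v \<in> infchar" "w \<in> infchar"
  shows "lie_group_bracket sA CG atlas (tangent_of v) (tangent_of w) = tangent_of (bracket v w)"
proof -
  have deriv: "dir_derivative sA sA
      (\<lambda>x. left_invariant_field sA CG atlas (tangent_of w) (inv_into char clog x) (char, clog)) 0 v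
      = v \<star> w - sA (1 / 2) (v \<star> w + w \<star> v)" if "v \<in> infchar" "w \<in> infchar" for v w
    using that
    by (intro dir_derivative_in_chart[OF _ _ has_deriv_left_field])
      (auto simp: inv_clog left_invariant_field_eq cexp_in_char infchar_in_hom_space)
  have unit: "left_invariant_field sA CG atlas (tangent_of v) unit (char, clog) = v" if "v \<in> infchar" for v
    using that by (simp add: left_invariant_field_eq unit_in_char left_field_unit infchar_in_hom_space)
  have one: "\<one>\<^bsub>CG\<^esub> = unit" by (simp add: character_group_def)
  have "lie_group_bracket sA CG atlas (tangent_of v) (tangent_of w) (char, clog) = bracket v w"
    unfolding lie_group_bracket_def vector_field_bracket_def one using assms
    by (simp add: unit_in_char clog_unit unit deriv convolution_bracket_def add.commute)
  moreover have "lie_group_bracket sA CG atlas (tangent_of v) (tangent_of w) c = 0" if "c \<noteq> (char, clog)" for c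
    using that by (cases c) (auto simp: lie_group_bracket_def vector_field_bracket_def)
  ultimately show ?thesis by (auto simp: tangent_of_def)
qed

lemma tangent_of_linear:
  "tangent_of v + tangent_of w = tangent_of (v + w)" "fun_scale sA c (tangent_of v) = tangent_of (sA c v)"
  "tangent_of 0 = 0"
  by (auto simp: tangent_of_def fun_scale_def fun_eq_iff)

lemma lie_algebra_tangent_unit:
  "lie_algebra_on (fun_scale sA) tangent_unit (lie_group_bracket sA CG atlas)"
proof -
  interpret T: vector_space "fun_scale sA :: _ \<Rightarrow> (('h \<Rightarrow> 'b, 'h \<Rightarrow> 'b) chart \<Rightarrow> 'h \<Rightarrow> 'b) \<Rightarrow> _"
    by (rule A.vector_space_fun_scale_t)
  have closed: "x + y \<in> infchar" "sA c x \<in> infchar" "0 \<in> infchar" if "x \<in> infchar" "y \<in> infchar" for x y c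
    using that A.subspace_add[OF subspace_infchar] infchar_scale A.subspace_0[OF subspace_infchar] by auto
  have "T.subspace tangent_unit"
    unfolding tangent_unit_eq
    using A.subspace_0[OF subspace_infchar]
    by (intro T.subspaceI) (auto simp: tangent_of_linear closed intro!: image_eqI[of 0 tangent_of 0])
  then show ?thesis
    using T.vector_space_axioms lie_algebra_infchar
    unfolding lie_algebra_on_def tangent_unit_eq
    by (simp add: lie_group_bracket_eq tangent_of_linear closed)
qed

lemma tangent_unit_iso:
  "topological_lie_algebra_iso (fun_scale sA) tangent_unit (lie_group_bracket sA CG atlas)
    sA infchar bracket (inclusion_derivative sH \<epsilon> sB atlas)"
proof -
  let ?L = "inclusion_derivative sH \<epsilon> sB atlas"
  \<comment> \<open>On the tangent space the map is evaluation at one index, which is continuous for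
    the pointwise topology.\<close>
  have "continuous_on tangent_unit ?L"
    by (rule continuous_on_eq[OF continuous_on_subset[OF continuous_on_product_coordinates[where i = "(char, clog)"]]])
      (auto simp: tangent_unit_eq inclusion_derivative_tangent_of tangent_of_chart)
  moreover have "continuous_on infchar tangent_of"
  proof (rule continuous_on_coordinatewise_then_product)
    show "continuous_on infchar (\<lambda>v. tangent_of v c)" for c
      unfolding tangent_of_def
      by (cases "c = (char, clog)") (simp_all only: simp_thms if_True if_False continuous_on_id continuous_on_const)
  qed
  moreover have "?L ` tangent_unit = infchar"
    by (simp add: tangent_unit_eq image_image inclusion_derivative_tangent_of)
  ultimately have "homeomorphic_map (top_of_set tangent_unit) (top_of_set infchar) ?L"
    by (intro homeomorphic_map_top_of_set[of _ _ _ tangent_of])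
      (auto simp: tangent_unit_eq inclusion_derivative_tangent_of)
  then show ?thesis
    unfolding topological_lie_algebra_iso_def
    using lie_algebra_tangent_unit lie_algebra_infchar A.subspace_add[OF subspace_infchar] infchar_scale
    by (auto simp: tangent_unit_eq inclusion_derivative_tangent_of tangent_of_linear lie_group_bracket_eq
        bracket_in_infchar)
qed

end

theorem theoremA:
  fixes sH :: "'k::rc_field \<Rightarrow> 'h::ring_1 \<Rightarrow> 'h"
    and \<Delta> :: "'h \<Rightarrow> ('h \<times> 'h \<Rightarrow>\<^sub>0 'k)"
    and \<epsilon> :: "'h \<Rightarrow> 'k"
    and S :: "'h \<Rightarrow> 'h"
    and H :: "nat \<Rightarrow> 'h set"
    and sB :: "'k \<Rightarrow> 'b::{comm_ring, comm_monoid_mult, t2_space} \<Rightarrow> 'b"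
  assumes "graded_connected_hopf_algebra sH \<Delta> \<epsilon> S H"
    and "commutative_locally_convex_algebra sB"
  shows "\<exists>F \<A>.
    analytic_submanifold (fun_scale sB) (augmentation_space sH sB)
      (top_of_set (affine_space sH sB)) (affine_atlas sH \<epsilon> sB) (characters sH sB) F \<A> \<and>
    analytic_lie_group (fun_scale sB) F
      (character_group sH \<Delta> \<epsilon> sB) (top_of_set (characters sH sB)) \<A> \<and>
    topological_lie_algebra_iso
      (fun_scale (fun_scale sB))
      (tangent_space (fun_scale sB) F \<A> \<one>\<^bsub>character_group sH \<Delta> \<epsilon> sB\<^esub>)
      (lie_group_bracket (fun_scale sB) (character_group sH \<Delta> \<epsilon> sB) \<A>)
      (fun_scale sB) (infinitesimal_characters sH \<epsilon> sB) (convolution_bracket sB \<Delta>)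
      (inclusion_derivative sH \<epsilon> sB \<A>)"
proof -
  interpret character_setting sH \<Delta> \<epsilon> S H sB
    using assms by (intro character_setting.intro character_setting_axioms.intro)
  have "\<one>\<^bsub>character_group sH \<Delta> \<epsilon> sB\<^esub> = convolution_one sB \<epsilon>"
    by (simp add: character_group_def)
  \<comment> \<open>The witnesses are \<open>infchar\<close> as model space and the single chart
    \<open>(char, clog)\<close> as atlas.\<close>
  then show ?thesis
    using submanifold_char lie_group_char tangent_unit_iso by metis
qed

end
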